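(* Let $\alpha>0$ and let $$f(x)=\sum_{n\ge0}\frac{A_n}{n!}x^n,\qquad A_n\ge0,\qquad \frac{A_n}{n!}=O\Big(\frac1{n^{1+\alpha}}\Big)\ (n\to\infty).$$ Then for every $d\ge1$ the function $$K(\xi,\eta):=f(\langle\xi,\eta\rangle),\qquad\xi,\eta\in\mathbb S^d,$$ is a positive definite function on $\mathbb S^d$ invariant under $SO(d+1)$, and the associated centered Gaussian process $(Z^d_\xi(\omega))_{\xi\in\mathbb S^d}$ (with covariance $K$) has trajectories almost surely in $B^\gamma_{\infty,1}(\mathbb S^d)$ for every $0<\gamma<\alpha$.
   Context: $\mathbb S^d$ is the unit sphere of $\mathbb R^{d+1}$ and $\langle\cdot,\cdot\rangle$ the inner product of $\mathbb R^{d+1}$. Positive definite: $K$ is real, symmetric and $\sum_{i,j}\alpha_i\alpha_jK(\xi_i,\xi_j)\ge0$ for all finite families of points $\xi_i$ and reals $\alpha_i$. Invariant: $K(g\xi,g\eta)=K(\xi,\eta)$ for all $g\in SO(d+1)$. The trajectory regularity is understood for a suitable modification of the process. Besov spaces on $\mathbb S^d$ are those associated with $A=-\Delta_{\mathbb S^d}$ (positive Laplace–Beltrami operator), with eigenvalues $k(k+d-1)$, $k\ge0$, and eigenspaces the spherical harmonics of degree $k$, with orthogonal projectors $\mathrm{Proj}_k$. Let $\Phi\in C^\infty(\mathbb R)$ be real, even, $\mathrm{supp}\,\Phi\subset[-2,2]$, $0\le\Phi\le1$, $\Phi=1$ on $[0,1]$, $\Psi(\lambda):=\Phi(\lambda)-\Phi(2\lambda)$,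 $\Psi_0:=\Phi$, $\Psi_j(\lambda):=\Psi(2^{-j}\lambda)$ ($j\ge1$), and $\Psi_j(\sqrt A)f=\sum_k\Psi_j(\sqrt{k(k+d-1)})\,\mathrm{Proj}_kf$. For $s>0$, a continuous $f$ on $\mathbb S^d$ belongs to $B^s_{\infty,1}$ iff $\sum_{j\ge0}2^{js}\|\Psi_j(\sqrt A)f\|_\infty<\infty$ (equivalent to the definition by real interpolation between $C(\mathbb S^d)$ and $\{f:\|f\|_\infty+\|A^{k/2}f\|_\infty<\infty\}$, $k>s$). *)

theory Defs
  imports "HOL-Probability.Probability" "HOL-Library.Landau_Symbols"
begin

section \<open>Kernels\<close>

definition positive_definite_on :: "'a set \<Rightarrow> ('a \<Rightarrow> 'a \<Rightarrow> real) \<Rightarrow> bool" where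
  "positive_definite_on S K \<longleftrightarrow>
     (\<forall>x\<in>S. \<forall>y\<in>S. K x y = K y x) \<and>
     (\<forall>(m::nat) (x :: nat \<Rightarrow> 'a) (a :: nat \<Rightarrow> real).
        (\<forall>i<m. x i \<in> S) \<longrightarrow> 0 \<le> (\<Sum>i<m. \<Sum>j<m. a i * a j * K (x i) (x j)))"

definition SO_invariant :: "(real^'n \<Rightarrow> real^'n \<Rightarrow> real) \<Rightarrow> bool" where
  "SO_invariant K \<longleftrightarrow>
     (\<forall>Q :: real^'n^'n. rotation_matrix Q \<longrightarrow>
        (\<forall>x\<in>sphere 0 1. \<forall>y\<in>sphere 0 1. K (Q *v x) (Q *v y) = K x y))"

section \<open>Gaussian processes\<close>

text \<open>Degenerate, i.e. almost surely constant, variables count as Gaussian.\<close>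

definition gaussian_variable :: "'w measure \<Rightarrow> ('w \<Rightarrow> real) \<Rightarrow> bool" where
  "gaussian_variable M X \<longleftrightarrow>
     X \<in> borel_measurable M \<and>
     ((\<exists>m. AE w in M. X w = m) \<or>
      (\<exists>m \<sigma>. 0 < \<sigma> \<and> distributed M lborel X (\<lambda>t. ennreal (normal_density m \<sigma> t))))"

text \<open>Joint Gaussianity is expressed by Gaussianity of all finite linear combinations.\<close>

definition centered_gaussian_process ::
  "'w measure \<Rightarrow> 'a set \<Rightarrow> ('a \<Rightarrow> 'a \<Rightarrow> real) \<Rightarrow> ('a \<Rightarrow> 'w \<Rightarrow> real) \<Rightarrow> bool" where
  "centered_gaussian_process M T K Z \<longleftrightarrow>
     (\<forall>(m::nat) (x :: nat \<Rightarrow> 'a) (a :: nat \<Rightarrow> real).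
        (\<forall>i<m. x i \<in> T) \<longrightarrow> gaussian_variable M (\<lambda>w. \<Sum>i<m. a i * Z (x i) w)) \<and>
     (\<forall>x\<in>T. integral\<^sup>L M (Z x) = 0) \<and>
     (\<forall>x\<in>T. \<forall>y\<in>T. integral\<^sup>L M (\<lambda>w. Z x w * Z y w) = K x y)"

definition modification_of ::
  "'w measure \<Rightarrow> 'a set \<Rightarrow> ('a \<Rightarrow> 'w \<Rightarrow> real) \<Rightarrow> ('a \<Rightarrow> 'w \<Rightarrow> real) \<Rightarrow> bool" where
  "modification_of M T Z Y \<longleftrightarrow>
     (\<forall>x\<in>T. Y x \<in> borel_measurable M \<and> (AE w in M. Y x w = Z x w))"

section \<open>Spherical harmonics\<close>

text \<open>The surface measure of the unit sphere as the normalized cone measure: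
  a Borel set \<open>B\<close> of the sphere has measure \<open>n\<close> times the Lebesgue measure of the
  cone \<open>{t x | x \<in> B, 0 < t < 1}\<close>, where \<open>n\<close> is the dimension of the ambient space.
  It lives on the sphere, so values of integrands elsewhere are irrelevant.\<close>

definition surface_measure :: "'a::euclidean_space measure" where
  "surface_measure =
     scale_measure (of_nat DIM('a))
       (distr (restrict_space lborel (ball 0 1 - {0}))
              (restrict_space borel (sphere 0 1))
              (\<lambda>x. x /\<^sub>R norm x))"

definition laplacian :: "('a::euclidean_space \<Rightarrow> real) \<Rightarrow> 'a \<Rightarrow> real" where
  "laplacian p x = (\<Sum>b\<in>Basis. (deriv ^^ 2) (\<lambda>t. p (x + t *\<^sub>R b)) 0)"

definition harmonic_homogeneous_polynomials :: "nat \<Rightarrow> ('a::euclidean_space \<Rightarrow> real) set" where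
  "harmonic_homogeneous_polynomials k =
     {p. real_polynomial_function p \<and>
         (\<forall>c x. p (c *\<^sub>R x) = c ^ k * p x) \<and>
         (\<forall>x. laplacian p x = 0)}"

text \<open>Functions on the sphere are represented as extensional functions, so that
  the orthogonal projection below is uniquely determined.\<close>

definition spherical_harmonics :: "nat \<Rightarrow> ('a::euclidean_space \<Rightarrow> real) set" where
  "spherical_harmonics k =
     (\<lambda>p. restrict p (sphere 0 1)) ` harmonic_homogeneous_polynomials k"

definition harmonic_proj :: "nat \<Rightarrow> ('a::euclidean_space \<Rightarrow> real) \<Rightarrow> 'a \<Rightarrow> real" where
  "harmonic_proj k f =
     (THE h. h \<in> spherical_harmonics k \<and>
        (\<forall>g\<in>spherical_harmonics k. integral\<^sup>L surface_measure (\<lambda>x. (f x - h x) * g x) = 0))"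

section \<open>Besov spaces on the sphere\<close>

definition littlewood_paley_cutoff :: "(real \<Rightarrow> real) \<Rightarrow> bool" where
  "littlewood_paley_cutoff \<Phi> \<longleftrightarrow>
     (\<forall>(m::nat) x. (deriv ^^ m) \<Phi> field_differentiable at x) \<and>
     (\<forall>x. \<Phi> (- x) = \<Phi> x) \<and>
     closure {x. \<Phi> x \<noteq> 0} \<subseteq> {-2..2} \<and>
     (\<forall>x. 0 \<le> \<Phi> x \<and> \<Phi> x \<le> 1) \<and>
     (\<forall>x\<in>{0..1}. \<Phi> x = 1)"

definition dyadic_window :: "(real \<Rightarrow> real) \<Rightarrow> nat \<Rightarrow> real \<Rightarrow> real" where
  "dyadic_window \<Phi> j l =
     (if j = 0 then \<Phi> l else \<Phi> (l / 2 ^ j) - \<Phi> (2 * (l / 2 ^ j)))"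

text \<open>In an ambient space of dimension \<open>d + 1\<close>, the spherical harmonics of degree \<open>k\<close>
  are the eigenfunctions of the positive Laplace-Beltrami operator \<open>A\<close> of the unit sphere
  for the eigenvalue \<open>k (k + d - 1)\<close>; here \<open>d - 1\<close> is \<open>DIM('a) - 2\<close>. The operator
  \<open>\<Psi>\<^sub>j(\<surd>A)\<close> is given by its spectral resolution, a series with only finitely many
  nonzero terms for a compactly supported window.\<close>

definition dyadic_operator ::
  "(real \<Rightarrow> real) \<Rightarrow> nat \<Rightarrow> ('a::euclidean_space \<Rightarrow> real) \<Rightarrow> 'a \<Rightarrow> real" where
  "dyadic_operator \<Phi> j f x =
     (\<Sum>k. dyadic_window \<Phi> j (sqrt (real k * (real k + real DIM('a) - 2))) * harmonic_proj k f x)"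

definition sphere_sup_norm :: "('a::euclidean_space \<Rightarrow> real) \<Rightarrow> real" where
  "sphere_sup_norm f = (SUP x\<in>sphere 0 1. \<bar>f x\<bar>)"

text \<open>The space \<open>B\<^sup>s\<close> with indices \<open>\<infinity>\<close> and \<open>1\<close>. Only the values of \<open>f\<close> on the unit sphere matter.\<close>

definition besov_inf_1 :: "(real \<Rightarrow> real) \<Rightarrow> real \<Rightarrow> ('a::euclidean_space \<Rightarrow> real) set" where
  "besov_inf_1 \<Phi> s =
     {f. continuous_on (sphere 0 1) f \<and>
         summable (\<lambda>j. 2 powr (real j * s) * sphere_sup_norm (dyadic_operator \<Phi> j f))}"

end

theory Submission
  imports Defs "HOL-Library.Function_Algebras" "HOL-Real_Asymp.Real_Asymp"
begin

text \<open>Write \<open>D\<close> for the dimension of the ambient space and \<open>a n = A n / n!\<close>. Each power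
  \<open>(x \<bullet> y) ^ n\<close> is a finite sum of products \<open>m x * m y\<close> with monomials \<open>m\<close> (lemma
  \<open>inner_power_tensor\<close>) and depends on the inner product only; positive definiteness and
  invariance of \<open>K\<close> follow by summation with the nonnegative coefficients \<open>a n\<close>.

  For the regularity, decompose \<open>(x \<bullet> y) ^ n\<close> into spherical harmonics in both variables.
  The Laplace-Beltrami operator acts in the same way in both variables, so harmonics of different
  degrees do not interact, and the diagonal values of the parts of degree \<open>k\<close>, called
  \<open>spectral_weight n k x\<close>, form a probability distribution on the degrees \<open>k \<le> n\<close>.
  Applied to \<open>(x \<bullet> y) ^ n\<close>, the operator produces a combination of the powers \<open>n\<close> and
  \<open>n - 2\<close>. The resulting recursion (\<open>spectral_weight_rec\<close>) shows that the \<open>m\<close>-th moment of the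
  eigenvalue under this distribution is \<open>O(n ^ m)\<close> (\<open>spectral_weight_moment_le\<close>): the power \<open>n\<close>
  lives at frequencies of order \<open>sqrt n\<close>. By Markov's inequality the part of the process at
  frequencies of order \<open>2 ^ j\<close> has variance at most a constant times the sum of
  \<open>a n * min 1 (((n + 1) / 4 ^ j) ^ m)\<close>, which is \<open>O(4 powr (- \<beta> * j))\<close> for every \<open>\<beta> < \<alpha>\<close>
  (\<open>dyadic_block_variance\<close>).

  The dyadic blocks are Gaussian polynomials of degree at most \<open>2 ^ (j + 1)\<close>. For a polynomial \<open>p\<close>
  of degree \<open>N\<close>, the square of its supremum on the sphere is at most a power of \<open>N\<close> times its mean
  square (\<open>nikolskii_L2\<close>). Applied to \<open>p ^ m\<close>, this compares the supremum of \<open>p\<close> with its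
  \<open>L\<close>-norm of order \<open>2 * m\<close> at the cost of a factor that grows more slowly than any given power of
  \<open>N\<close> as \<open>m\<close> increases. Since all Gaussian moments are powers of the variance, the suprema of the
  blocks are almost surely \<open>O(2 powr (- \<gamma> * j))\<close> for every \<open>\<gamma> < \<alpha>\<close>
  (\<open>blocks_decay_of_moments\<close>).

  The spectral components of the process are integrals of \<open>Z\<close> against spherical harmonics, defined
  as almost sure limits of Riemann sums over finer and finer partitions of the sphere
  (\<open>gaussian_process_integral\<close>). The sum of the blocks converges uniformly to a continuous function
  whose dyadic blocks are the given ones (\<open>besov_of_frequency_blocks\<close>), and it is a modification of
  the process because the mean square error of the partial sums tends to zero
  (\<open>frequency_series_is_modification\<close>).\<close>

section \<open>Differential calculus of polynomial functions\<close>

lemmas rpf_intros = real_polynomial_function.intros(2-4)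

definition dir_deriv :: "'a::euclidean_space \<Rightarrow> ('a \<Rightarrow> real) \<Rightarrow> 'a \<Rightarrow> real" where
  "dir_deriv v p x = frechet_derivative p (at x) v"

lemma dir_deriv_eq: "(p has_derivative D) (at x) \<Longrightarrow> dir_deriv v p x = D v"
  unfolding dir_deriv_def using frechet_derivative_at by metis

lemma dir_deriv_has_derivative:
  "real_polynomial_function p \<Longrightarrow> (p has_derivative (\<lambda>v. dir_deriv v p x)) (at x)"
  unfolding dir_deriv_def
  using differentiable_at_real_polynomial_function frechet_derivative_works
  by (metis eta_contract_eq)

lemma dir_deriv_linear: "real_polynomial_function p \<Longrightarrow> linear (\<lambda>v. dir_deriv v p x)"
  using has_derivative_linear dir_deriv_has_derivative by blast

lemma dir_deriv_expand:
  assumes "real_polynomial_function p"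
  shows "dir_deriv v p x = (\<Sum>b\<in>Basis. (v \<bullet> b) * dir_deriv b p x)"
proof -
  have "dir_deriv v p x = dir_deriv (\<Sum>b\<in>Basis. (v \<bullet> b) *\<^sub>R b) p x"
    by (simp add: euclidean_representation)
  also have "\<dots> = (\<Sum>b\<in>Basis. (v \<bullet> b) * dir_deriv b p x)"
    using linear_sum[OF dir_deriv_linear[OF assms], of "\<lambda>b. (v \<bullet> b) *\<^sub>R b" Basis]
      linear_scale[OF dir_deriv_linear[OF assms]] by simp
  finally show ?thesis .
qed

lemma dir_deriv_const [simp]: "dir_deriv v (\<lambda>x. c) x = 0"
  by (rule dir_deriv_eq) auto

lemma dir_deriv_bounded_linear: "bounded_linear f \<Longrightarrow> dir_deriv v f x = f v"
  by (rule dir_deriv_eq) (rule bounded_linear_imp_has_derivative)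

lemma dir_deriv_inner: "dir_deriv v (\<lambda>x. x \<bullet> b) x = v \<bullet> b"
  by (rule dir_deriv_bounded_linear) (rule bounded_linear_inner_left)

lemma dir_deriv_add:
  assumes "real_polynomial_function p" "real_polynomial_function q"
  shows "dir_deriv v (\<lambda>x. p x + q x) x = dir_deriv v p x + dir_deriv v q x"
  by (rule dir_deriv_eq) (intro derivative_intros dir_deriv_has_derivative assms)

lemma dir_deriv_mult:
  assumes "real_polynomial_function p" "real_polynomial_function q"
  shows "dir_deriv v (\<lambda>x. p x * q x) x = p x * dir_deriv v q x + dir_deriv v p x * q x"
  using dir_deriv_eq[OF has_derivative_mult[OF dir_deriv_has_derivative[OF assms(1)] dir_deriv_has_derivative[OF assms(2)]]]
  by simp

lemma dir_deriv_cmult: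
  assumes "real_polynomial_function p"
  shows "dir_deriv v (\<lambda>x. c * p x) x = c * dir_deriv v p x"
  using dir_deriv_mult[of "\<lambda>x. c" p] assms by (simp add: rpf_intros)

lemma real_polynomial_function_dir_deriv:
  assumes "real_polynomial_function p"
  shows "real_polynomial_function (dir_deriv v p)"
  using assms
proof (induction p)
  case (linear f)
  have "dir_deriv v f = (\<lambda>x. f v)" by (auto simp: dir_deriv_bounded_linear[OF linear])
  then show ?case by (simp add: rpf_intros)
next
  case (const c)
  have "dir_deriv v (\<lambda>x. c) = (\<lambda>x::'a. 0)" by auto
  then show ?case by (simp add: rpf_intros)
next
  case (add f g)
  have "dir_deriv v (\<lambda>x. f x + g x) = (\<lambda>x. dir_deriv v f x + dir_deriv v g x)" by (auto simp: dir_deriv_add add)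
  then show ?case using add by (simp add: rpf_intros)
next
  case (mult f g)
  have "dir_deriv v (\<lambda>x. f x * g x) = (\<lambda>x. f x * dir_deriv v g x + dir_deriv v f x * g x)" by (auto simp: dir_deriv_mult mult)
  then show ?case using mult by (simp add: rpf_intros)
qed

lemma continuous_on_dir_deriv: "real_polynomial_function p \<Longrightarrow> continuous_on S (dir_deriv v p)"
  by (metis real_polynomial_function_dir_deriv real_polynomial_function_eq continuous_on_polymonial_function)

text \<open>The second derivatives along coordinate lines are iterated directional derivatives, for which
  the product rule is available.\<close>

lemma laplacian_eq:
  assumes "real_polynomial_function p"
  shows "laplacian p x = (\<Sum>b\<in>Basis. dir_deriv b (dir_deriv b p) x)"
proof -
  have D: "((\<lambda>t. q (x + t *\<^sub>R b)) has_field_derivative dir_deriv b q (x + t *\<^sub>R b)) (at t)"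
    if "real_polynomial_function q" for q and b and t :: real
  proof -
    have "((\<lambda>t. q (x + t *\<^sub>R b)) has_derivative (\<lambda>h. dir_deriv (h *\<^sub>R b) q (x + t *\<^sub>R b))) (at t)"
      by (rule has_derivative_compose[OF _ dir_deriv_has_derivative[OF that]])
        (auto intro!: derivative_eq_intros)
    then show ?thesis
      by (simp add: has_field_derivative_def linear_scale[OF dir_deriv_linear[OF that]] mult_commute_abs)
  qed
  have "(deriv ^^ 2) (\<lambda>t. p (x + t *\<^sub>R b)) 0 = dir_deriv b (dir_deriv b p) x" for b
  proof -
    have "deriv (\<lambda>t. p (x + t *\<^sub>R b)) = (\<lambda>t. dir_deriv b p (x + t *\<^sub>R b))"
      using D[OF assms] DERIV_imp_deriv by blast
    then show ?thesis
      using DERIV_imp_deriv[OF D[OF real_polynomial_function_dir_deriv[OF assms], where t=0]]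
      by (simp add: numeral_2_eq_2)
  qed
  then show ?thesis by (simp add: laplacian_def)
qed

lemma real_polynomial_function_laplacian:
  assumes "real_polynomial_function p"
  shows "real_polynomial_function (laplacian p)"
proof -
  have "laplacian p = (\<lambda>x. \<Sum>b\<in>Basis. dir_deriv b (dir_deriv b p) x)"
    using laplacian_eq[OF assms] by auto
  then show ?thesis
    using assms by (auto intro!: real_polynomial_function_dir_deriv real_polynomial_function_sum)
qed

lemma laplacian_add:
  assumes "real_polynomial_function p" "real_polynomial_function q"
  shows "laplacian (\<lambda>x. p x + q x) x = laplacian p x + laplacian q x"
proof -
  have "dir_deriv b (\<lambda>x. p x + q x) = (\<lambda>x. dir_deriv b p x + dir_deriv b q x)" for b
    using assms by (auto simp: dir_deriv_add)
  then show ?thesis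
    using assms
    by (simp add: laplacian_eq rpf_intros dir_deriv_add
        real_polynomial_function_dir_deriv sum.distrib)
qed

lemma laplacian_cmult:
  assumes "real_polynomial_function p"
  shows "laplacian (\<lambda>x. c * p x) x = c * laplacian p x"
proof -
  have "dir_deriv b (\<lambda>x. c * p x) = (\<lambda>x. c * dir_deriv b p x)" for b
    using assms by (auto simp: dir_deriv_cmult)
  then show ?thesis
    using assms
    by (simp add: laplacian_eq rpf_intros dir_deriv_cmult
        real_polynomial_function_dir_deriv sum_distrib_left)
qed

lemma laplacian_sum:
  fixes p :: "'i \<Rightarrow> 'a::euclidean_space \<Rightarrow> real"
  assumes "\<And>i. i \<in> I \<Longrightarrow> real_polynomial_function (p i)" "finite I"
  shows "laplacian (\<lambda>x. \<Sum>i\<in>I. p i x) x = (\<Sum>i\<in>I. laplacian (p i) x)"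
  using assms(2,1)
proof (induction I rule: finite_induct)
  case empty
  have "dir_deriv b (\<lambda>x. 0) = (\<lambda>x. 0)" for b :: 'a by auto
  then show ?case by (simp add: laplacian_eq real_polynomial_function.intros(2))
next
  case (insert i I)
  then show ?case by (simp add: laplacian_add real_polynomial_function_sum)
qed

section \<open>Homogeneous polynomials\<close>

definition homogeneous :: "nat \<Rightarrow> ('a::euclidean_space \<Rightarrow> real) set" where
  "homogeneous n =
     {p. real_polynomial_function p \<and> (\<forall>c x. p (c *\<^sub>R x) = c ^ n * p x)}"

lemma homogeneousI:
  "real_polynomial_function p \<Longrightarrow> (\<And>c x. p (c *\<^sub>R x) = c ^ n * p x) \<Longrightarrow>
    p \<in> homogeneous n"
  by (simp add: homogeneous_def)

lemma homogeneousD: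
  assumes "p \<in> homogeneous n"
  shows "real_polynomial_function p" and "p (c *\<^sub>R x) = c ^ n * p x"
  using assms by (auto simp: homogeneous_def)

lemma homogeneous_mult:
  assumes "p \<in> homogeneous m" "q \<in> homogeneous n"
  shows "(\<lambda>x. p x * q x) \<in> homogeneous (m + n)"
  using assms
  by (auto simp: homogeneous_def rpf_intros power_add)

lemma homogeneous_add:
  assumes "p \<in> homogeneous n" "q \<in> homogeneous n"
  shows "(\<lambda>x. p x + q x) \<in> homogeneous n"
  using assms
  by (auto simp: homogeneous_def rpf_intros algebra_simps)

lemma homogeneous_cmult:
  assumes "p \<in> homogeneous n"
  shows "(\<lambda>x. c * p x) \<in> homogeneous n"
  using assms
  by (auto simp: homogeneous_def rpf_intros algebra_simps)

lemma homogeneous_sum: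
  assumes "finite I" "\<And>i. i \<in> I \<Longrightarrow> p i \<in> homogeneous n"
  shows "(\<lambda>x. \<Sum>i\<in>I. p i x) \<in> homogeneous n"
  using assms
  by (auto simp: homogeneous_def sum_distrib_left intro!: real_polynomial_function_sum)

lemma homogeneous_inner: "(\<lambda>x. x \<bullet> b) \<in> homogeneous 1"
  by (auto simp: homogeneous_def
      intro!: real_polynomial_function.intros(1) bounded_linear_inner_left)

lemma homogeneous_power:
  assumes "p \<in> homogeneous m"
  shows "(\<lambda>x. p x ^ n) \<in> homogeneous (m * n)"
  using assms
  by (auto simp: homogeneous_def power_mult_distrib power_mult
      intro!: real_polynomial_function_power)

lemma homogeneous_inner_self: "(\<lambda>x. x \<bullet> x) \<in> homogeneous 2"
proof -
  have "(\<lambda>x::'a. x \<bullet> x) = (\<lambda>x. \<Sum>b\<in>Basis. (x \<bullet> b) * (x \<bullet> b))"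
    by (intro ext) (rule euclidean_inner)
  then show ?thesis
    using homogeneous_mult[OF homogeneous_inner homogeneous_inner]
    by (auto intro!: homogeneous_sum simp: numeral_2_eq_2)
qed

lemma euler_homogeneous:
  assumes "p \<in> homogeneous n"
  shows "dir_deriv x p x = real n * p x"
proof -
  note p = homogeneousD[OF assms]
  have "((\<lambda>c::real. p (c *\<^sub>R x)) has_derivative (\<lambda>h. dir_deriv (h *\<^sub>R x) p (1 *\<^sub>R x))) (at 1)"
    by (rule has_derivative_compose[OF _ dir_deriv_has_derivative[OF p(1)]])
      (auto intro!: derivative_eq_intros)
  moreover have "((\<lambda>c::real. c ^ n * p x) has_derivative (\<lambda>h. real n * h * p x)) (at 1)"
    by (auto intro!: derivative_eq_intros)
  ultimately have "(\<lambda>h. dir_deriv (h *\<^sub>R x) p (1 *\<^sub>R x)) = (\<lambda>h. real n * h * p x)"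
    using has_derivative_unique by (simp add: p(2))
  from fun_cong[OF this, of 1] show ?thesis by simp
qed

lemma dir_deriv_homogeneous_scale:
  assumes "p \<in> homogeneous n"
  shows "c * dir_deriv v p (c *\<^sub>R x) = c ^ n * dir_deriv v p x"
proof -
  note p = homogeneousD[OF assms]
  have "((\<lambda>x. p (c *\<^sub>R x)) has_derivative (\<lambda>h. dir_deriv (c *\<^sub>R h) p (c *\<^sub>R x))) (at x)"
    by (rule has_derivative_compose[OF _ dir_deriv_has_derivative[OF p(1)]])
      (auto intro!: derivative_eq_intros)
  moreover have "((\<lambda>x. c ^ n * p x) has_derivative (\<lambda>h. c ^ n * dir_deriv h p x)) (at x)"
    by (auto intro!: derivative_eq_intros dir_deriv_has_derivative p)
  ultimately have "(\<lambda>h. dir_deriv (c *\<^sub>R h) p (c *\<^sub>R x)) = (\<lambda>h. c ^ n * dir_deriv h p x)"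
    using has_derivative_unique by (simp add: p(2))
  from fun_cong[OF this, of v] show ?thesis
    by (simp add: linear_scale[OF dir_deriv_linear[OF p(1)]])
qed

lemma dir_deriv_homogeneous:
  assumes "p \<in> homogeneous (Suc n)"
  shows "dir_deriv v p \<in> homogeneous n"
proof (rule homogeneousI)
  note p = homogeneousD[OF assms]
  show "real_polynomial_function (dir_deriv v p)" by (rule real_polynomial_function_dir_deriv[OF p(1)])
  fix c :: real and x
  have nz: "dir_deriv v p (c *\<^sub>R x) = c ^ n * dir_deriv v p x" if "c \<noteq> 0" for c
    using dir_deriv_homogeneous_scale[OF assms, of c v x] that by simp
  show "dir_deriv v p (c *\<^sub>R x) = c ^ n * dir_deriv v p x"
  proof (cases "c = 0")
    case True
    \<comment> \<open>Division by the scaling factor is impossible here; both sides are continuous in it.\<close>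
    have "isCont (\<lambda>c::real. dir_deriv v p (c *\<^sub>R x)) 0"
      by (rule continuous_on_interior[of UNIV])
        (auto intro!: continuous_on_compose2[OF continuous_on_dir_deriv[OF p(1), of UNIV]] continuous_intros)
    then have "((\<lambda>c::real. dir_deriv v p (c *\<^sub>R x)) \<longlongrightarrow> dir_deriv v p (0 *\<^sub>R x)) (at 0)"
      by (simp add: isCont_def)
    moreover have "((\<lambda>c::real. c ^ n * dir_deriv v p x) \<longlongrightarrow> 0 ^ n * dir_deriv v p x) (at 0)"
      by (intro tendsto_intros)
    then have "((\<lambda>c::real. dir_deriv v p (c *\<^sub>R x)) \<longlongrightarrow> 0 ^ n * dir_deriv v p x) (at 0)"
      by (rule Lim_transform_eventually) (auto simp: eventually_at_filter nz)
    ultimately show ?thesis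
      using True by (simp add: tendsto_unique[of "at (0::real)"])
  qed (rule nz)
qed

lemma dir_deriv_homogeneous_0:
  assumes "p \<in> homogeneous 0"
  shows "dir_deriv v p x = 0"
  using dir_deriv_homogeneous_scale[OF assms, of 0 v x] by simp

lemma laplacian_homogeneous:
  assumes "p \<in> homogeneous (Suc (Suc n))"
  shows "laplacian p \<in> homogeneous n"
proof -
  have "laplacian p = (\<lambda>x. \<Sum>b\<in>Basis. dir_deriv b (dir_deriv b p) x)"
    using laplacian_eq homogeneousD(1)[OF assms] by auto
  then show ?thesis
    using assms by (auto intro!: homogeneous_sum dir_deriv_homogeneous)
qed

lemma laplacian_homogeneous_low:
  assumes "p \<in> homogeneous n" "n < 2"
  shows "laplacian p x = 0"
proof -
  note p = homogeneousD[OF assms(1)]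
  have "dir_deriv b (dir_deriv b p) x = 0" for b
  proof (cases n)
    case 0
    then have "dir_deriv b p = (\<lambda>x. 0)" using dir_deriv_homogeneous_0 assms by blast
    then show ?thesis by simp
  next
    case (Suc m)
    then show ?thesis using dir_deriv_homogeneous[of p 0 b] dir_deriv_homogeneous_0 assms by force
  qed
  then show ?thesis by (simp add: laplacian_eq p)
qed

text \<open>The cross term in the product rule is four times the radial derivative of \<open>q\<close>, which is
  \<open>n * q\<close> by Euler's relation.\<close>

lemma laplacian_norm_sq_mult:
  fixes q :: "'a::euclidean_space \<Rightarrow> real"
  assumes "q \<in> homogeneous n"
  shows "laplacian (\<lambda>x. (x \<bullet> x) * q x) x =
    (x \<bullet> x) * laplacian q x + (4 * real n + 2 * DIM('a)) * q x"
proof -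
  note q [simp] = homogeneousD(1)[OF assms]
  note r [simp] = homogeneousD(1)[OF homogeneous_inner_self]
  note i [simp] = homogeneousD(1)[OF homogeneous_inner]
  have c [simp]: "real_polynomial_function (\<lambda>x::'a. 2 * (x \<bullet> b))" for b
    by (intro rpf_intros i)
  have p [simp]: "real_polynomial_function (\<lambda>x. (x \<bullet> x) * dir_deriv b q x)"
    "real_polynomial_function (\<lambda>x. 2 * (x \<bullet> b) * q x)" for b
    by (intro real_polynomial_function.intros(4) real_polynomial_function_dir_deriv q r c)+
  have pq [simp]: "real_polynomial_function (\<lambda>x. (x \<bullet> x) * q x)"
    by (intro real_polynomial_function.intros(4) q r)
  have r1: "dir_deriv b (\<lambda>x. x \<bullet> x) x = 2 * (x \<bullet> b)" for b and x :: 'a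
    by (rule dir_deriv_eq) (auto intro!: derivative_eq_intros simp: inner_commute)
  have "dir_deriv b (\<lambda>x. (x \<bullet> x) * q x) = (\<lambda>x. (x \<bullet> x) * dir_deriv b q x + 2 * (x \<bullet> b) * q x)" for b
    by (intro ext) (simp add: dir_deriv_mult r1)
  moreover have "dir_deriv b (\<lambda>x. (x \<bullet> x) * dir_deriv b q x + 2 * (x \<bullet> b) * q x) x =
      (x \<bullet> x) * dir_deriv b (dir_deriv b q) x + 4 * ((x \<bullet> b) * dir_deriv b q x) + 2 * (b \<bullet> b) * q x" for b
    by (simp add: dir_deriv_mult dir_deriv_add r1 dir_deriv_cmult dir_deriv_inner real_polynomial_function_dir_deriv)
  ultimately have 1: "laplacian (\<lambda>x. (x \<bullet> x) * q x) x = (\<Sum>b\<in>Basis.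
      (x \<bullet> x) * dir_deriv b (dir_deriv b q) x + 4 * ((x \<bullet> b) * dir_deriv b q x) + 2 * (b \<bullet> b) * q x)"
    by (simp add: laplacian_eq)
  have 2: "(\<Sum>b\<in>Basis.
      (x \<bullet> x) * dir_deriv b (dir_deriv b q) x + 4 * ((x \<bullet> b) * dir_deriv b q x) + 2 * (b \<bullet> b) * q x) =
      (x \<bullet> x) * laplacian q x + 4 * dir_deriv x q x + (\<Sum>b::'a\<in>Basis. 2 * (b \<bullet> b) * q x)"
    unfolding sum.distrib
    by (simp only: laplacian_eq[OF q] dir_deriv_expand[OF q, of x x] sum_distrib_left)
  have 3: "(\<Sum>b::'a\<in>Basis. 2 * (b \<bullet> b) * q x) = 2 * real DIM('a) * q x"
    by simp
  show ?thesis
    unfolding 1 2 3 euler_homogeneous[OF assms] by (simp add: algebra_simps)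
qed

section \<open>Surface measure\<close>

text \<open>Up to a factor, Lebesgue measure is the only locally finite translation invariant measure, so \<open>T\<close> can only
  multiply it by a constant. The constant is one because \<open>T\<close> preserves the unit ball \<open>B\<close>. The
  proof is the classical Fubini argument: the integral of \<open>f x * indicator B (T y)\<close> over all pairs
  is transformed by translating first \<open>x\<close> by \<open>T y\<close> and then \<open>y\<close> so that \<open>x + T y\<close> becomes \<open>T y\<close>.\<close>

lemma nn_integral_lborel_orthogonal:
  fixes T :: "'a::euclidean_space \<Rightarrow> 'a"
  assumes T: "orthogonal_transformation T" and f [measurable]: "f \<in> borel_measurable borel"
  shows "(\<integral>\<^sup>+x. f (T x) \<partial>lborel) = (\<integral>\<^sup>+x. f x \<partial>lborel)"
proof -
  define B where "B = (ball 0 1 :: 'a set)"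
  have [measurable]: "B \<in> sets borel" by (simp add: B_def)
  have lin: "linear T" using T orthogonal_transformation_linear by blast
  have [measurable]: "T \<in> borel_measurable borel"
    using lin by (meson borel_measurable_continuous_onI linear_continuous_on linear_conv_bounded_linear)
  have TB: "T y \<in> B \<longleftrightarrow> y \<in> B" for y
    using T by (simp add: B_def orthogonal_transformation_norm)
  obtain T' where T': "\<And>x. T (T' x) = x"
    using orthogonal_transformation_surj[OF T] by (metis surj_def)
  have shift: "(\<integral>\<^sup>+x. g (x + c) \<partial>lborel) = (\<integral>\<^sup>+x. g x \<partial>lborel)"
    if [measurable]: "g \<in> borel_measurable borel" for g :: "'a \<Rightarrow> ennreal" and c
  proof -
    have "(\<integral>\<^sup>+x. g x \<partial>lborel) = (\<integral>\<^sup>+x. g x \<partial>distr lborel borel ((+) c))"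
      by (simp add: lborel_distr_plus)
    also have "\<dots> = (\<integral>\<^sup>+x. g (x + c) \<partial>lborel)"
      by (subst nn_integral_distr) (auto simp: add.commute)
    finally show ?thesis ..
  qed
  have B1: "(\<integral>\<^sup>+x. indicator B (z - x) \<partial>lborel) = emeasure lborel B" for z :: 'a
  proof -
    have "(\<integral>\<^sup>+x. indicator B (z - x) \<partial>lborel) = (\<integral>\<^sup>+x. indicator B (z - (x + z)) \<partial>lborel)"
      by (rule shift[symmetric]) measurable
    also have "\<dots> = (\<integral>\<^sup>+x. indicator B x \<partial>lborel)"
      by (intro nn_integral_cong) (auto simp: B_def indicator_def)
    finally show ?thesis by simp
  qed
  \<comment> \<open>Both orders of integration of the same double integral, after translating either variable.\<close>
  have "(\<integral>\<^sup>+x. f x \<partial>lborel) * emeasure lborel B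
      = (\<integral>\<^sup>+y. (\<integral>\<^sup>+x. f x * indicator B y \<partial>lborel) \<partial>lborel)"
    by (simp add: nn_integral_multc nn_integral_cmult)
  also have "\<dots> = (\<integral>\<^sup>+y. (\<integral>\<^sup>+x. f (x + T y) * indicator B (T y) \<partial>lborel) \<partial>lborel)"
  proof (rule nn_integral_cong)
    fix y
    have "(\<integral>\<^sup>+x. f (x + T y) * indicator B (T y) \<partial>lborel) = (\<integral>\<^sup>+x. f x * indicator B (T y) \<partial>lborel)"
      by (rule shift) measurable
    then show "(\<integral>\<^sup>+x. f x * indicator B y \<partial>lborel) = (\<integral>\<^sup>+x. f (x + T y) * indicator B (T y) \<partial>lborel)"
      by (simp add: indicator_def TB)
  qed
  also have "\<dots> = (\<integral>\<^sup>+x. (\<integral>\<^sup>+y. f (x + T y) * indicator B (T y) \<partial>lborel) \<partial>lborel)"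
    by (rule lborel_pair.Fubini') measurable
  also have "\<dots> = (\<integral>\<^sup>+x. (\<integral>\<^sup>+y. f (T y) * indicator B (T y - x) \<partial>lborel) \<partial>lborel)"
  proof (rule nn_integral_cong)
    fix x
    have "(\<integral>\<^sup>+y. f (T y) * indicator B (T y - x) \<partial>lborel) =
        (\<integral>\<^sup>+y. f (T (y + T' x)) * indicator B (T (y + T' x) - x) \<partial>lborel)"
      by (rule shift[symmetric]) measurable
    then show "(\<integral>\<^sup>+y. f (x + T y) * indicator B (T y) \<partial>lborel) =
        (\<integral>\<^sup>+y. f (T y) * indicator B (T y - x) \<partial>lborel)"
      by (simp add: linear_add[OF lin] T' add.commute)
  qed
  also have "\<dots> = (\<integral>\<^sup>+y. (\<integral>\<^sup>+x. f (T y) * indicator B (T y - x) \<partial>lborel) \<partial>lborel)"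
    by (rule lborel_pair.Fubini') measurable
  also have "\<dots> = (\<integral>\<^sup>+y. f (T y) \<partial>lborel) * emeasure lborel B"
    by (simp add: nn_integral_multc nn_integral_cmult B1)
  finally have eq: "(\<integral>\<^sup>+x. f x \<partial>lborel) * emeasure lborel B = (\<integral>\<^sup>+y. f (T y) \<partial>lborel) * emeasure lborel B" .
  have fin: "emeasure lborel B < \<infinity>" unfolding B_def by (rule emeasure_lborel_ball_finite)
  have "0 < measure lborel B" unfolding B_def by (rule content_ball_pos) simp
  then have "emeasure lborel B \<noteq> 0" by (auto simp: measure_def)
  then show ?thesis
    using eq fin by (metis ennreal_mult_divide_eq infinity_ennreal_def less_irrefl)
qed

abbreviation surface_integral :: "('a::euclidean_space \<Rightarrow> real) \<Rightarrow> real" where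
  "surface_integral \<equiv> integral\<^sup>L surface_measure"

lemma space_surface_measure [simp]: "space surface_measure = sphere 0 (1::real)"
  by (simp add: surface_measure_def space_scale_measure space_restrict_space)

lemma sets_surface_measure [measurable_cong]:
  "sets surface_measure = sets (restrict_space borel (sphere 0 1))"
  by (simp add: surface_measure_def)

lemma continuous_on_measurable_surface_measure:
  "continuous_on (sphere 0 1) g \<Longrightarrow> g \<in> borel_measurable surface_measure"
  using borel_measurable_continuous_on_restrict[of "sphere 0 1" g]
    measurable_cong_sets[OF sets_surface_measure refl] by blast

lemma measurable_radial_projection:
  "(\<lambda>x. x /\<^sub>R norm x) \<in>
    restrict_space lborel (ball 0 1 - {0}) \<rightarrow>\<^sub>M restrict_space borel (sphere (0::'a::euclidean_space) 1)"
  by (rule measurable_restrict_space2) (auto simp: space_restrict_space intro!: measurable_restrict_space1)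

lemma nn_integral_surface_measure:
  fixes g :: "'a::euclidean_space \<Rightarrow> ennreal"
  assumes [measurable]: "g \<in> borel_measurable surface_measure"
  shows "(\<integral>\<^sup>+x. g x \<partial>surface_measure) =
    of_nat DIM('a) * (\<integral>\<^sup>+x. g (x /\<^sub>R norm x) * indicator (ball 0 1 - {0}) x \<partial>lborel)"
proof -
  have g: "g \<in> borel_measurable (restrict_space borel (sphere 0 1))"
    using assms measurable_cong_sets[OF sets_surface_measure refl] by blast
  show ?thesis
    unfolding surface_measure_def
    by (subst nn_integral_scale_measure, simp add: g)
      (subst nn_integral_distr[OF measurable_radial_projection],
        simp add: g, subst nn_integral_restrict_space, simp_all)
qed

lemma finite_measure_surface_measure: "finite_measure (surface_measure :: 'a::euclidean_space measure)"
proof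
  have "emeasure (surface_measure :: 'a measure) (sphere 0 1) = (\<integral>\<^sup>+(x::'a). 1 \<partial>surface_measure)"
    by simp
  also have "\<dots> = of_nat DIM('a) * emeasure lborel (ball 0 1 - {0::'a})"
    by (subst nn_integral_surface_measure) auto
  finally have e: "emeasure (surface_measure :: 'a measure) (sphere 0 1) =
      of_nat DIM('a) * emeasure lborel (ball 0 1 - {0::'a})" .
  have "emeasure lborel (ball 0 1 - {0::'a}) \<le> emeasure lborel (ball (0::'a) 1)"
    by (rule emeasure_mono) auto
  also have "\<dots> < \<infinity>" by (rule emeasure_lborel_ball_finite)
  finally show "emeasure (surface_measure :: 'a measure) (space surface_measure) \<noteq> \<infinity>"
    unfolding space_surface_measure e by (auto simp: ennreal_mult_eq_top_iff)
qed

interpretation surface: finite_measure "surface_measure :: 'a::euclidean_space measure"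
  by (rule finite_measure_surface_measure)

lemma integrable_surface_measure:
  assumes "continuous_on (sphere 0 1) (g :: 'a::euclidean_space \<Rightarrow> real)"
  shows "integrable surface_measure g"
proof -
  have "bounded (g ` sphere 0 1)"
    using assms compact_continuous_image compact_imp_bounded compact_sphere by blast
  then obtain B where "\<And>x. x \<in> sphere 0 1 \<Longrightarrow> norm (g x) \<le> B"
    unfolding bounded_iff by blast
  then show ?thesis
    using continuous_on_measurable_surface_measure[OF assms]
    by (intro surface.integrable_const_bound[of g B]) auto
qed

lemma orthogonal_transformation_measurable_surface:
  fixes T :: "'a::euclidean_space \<Rightarrow> 'a"
  assumes T: "orthogonal_transformation T"
  shows "T \<in> surface_measure \<rightarrow>\<^sub>M surface_measure"
proof -
  have "continuous_on UNIV T"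
    using T by (meson linear_continuous_on linear_conv_bounded_linear orthogonal_transformation_linear)
  then have "T \<in> borel_measurable borel" by (rule borel_measurable_continuous_onI)
  then have "T \<in> restrict_space borel (sphere 0 1) \<rightarrow>\<^sub>M restrict_space borel (sphere 0 1)"
    using orthogonal_transformation_norm[OF T]
    by (intro measurable_restrict_space3) auto
  then show ?thesis
    using measurable_cong_sets[OF sets_surface_measure sets_surface_measure] by blast
qed

text \<open>The radial projection commutes with \<open>T\<close>, so this is the invariance of Lebesgue measure on the
  punctured ball.\<close>

lemma distr_surface_measure_orthogonal:
  fixes T :: "'a::euclidean_space \<Rightarrow> 'a"
  assumes T: "orthogonal_transformation T"
  shows "distr surface_measure surface_measure T = surface_measure"
proof (rule measure_eqI)
  note T_meas [measurable] = orthogonal_transformation_measurable_surface[OF T]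
  show "sets (distr surface_measure surface_measure T) = sets surface_measure" by simp
  fix A :: "'a set" assume "A \<in> sets (distr surface_measure surface_measure T)"
  then have A: "A \<in> sets surface_measure" by simp
  have lin: "linear T" using T orthogonal_transformation_linear by blast
  define h :: "'a \<Rightarrow> ennreal" where "h x = indicator A (x /\<^sub>R norm x) * indicator (ball 0 1 - {0}) x" for x :: 'a
  have [measurable]: "A \<in> sets borel"
    using A unfolding sets_surface_measure by (subst (asm) sets_restrict_space_iff) auto
  have hm: "h \<in> borel_measurable borel"
    unfolding h_def by (intro borel_measurable_times_ennreal borel_measurable_indicator') simp_all
  have 1: "emeasure (distr surface_measure surface_measure T) A =
      (\<integral>\<^sup>+x. indicator A x \<partial>distr surface_measure surface_measure T)"
    by (rule nn_integral_indicator[symmetric]) (simp add: A)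
  have 2: "(\<integral>\<^sup>+x. indicator A x \<partial>distr surface_measure surface_measure T) =
      (\<integral>\<^sup>+x. indicator A (T x) \<partial>surface_measure)"
    by (rule nn_integral_distr[OF T_meas]) (simp add: A borel_measurable_indicator)
  have 3: "(\<integral>\<^sup>+x. indicator A (T x) \<partial>surface_measure) = of_nat DIM('a) *
      (\<integral>\<^sup>+x. indicator A (T (x /\<^sub>R norm x)) * indicator (ball 0 1 - {0}) x \<partial>lborel)"
    by (rule nn_integral_surface_measure[OF measurable_compose[OF T_meas borel_measurable_indicator[OF A]]])
  have 4: "(\<integral>\<^sup>+x. indicator A (T (x /\<^sub>R norm x)) * indicator (ball 0 1 - {0}) x \<partial>lborel) =
      (\<integral>\<^sup>+x. h (T x) \<partial>lborel)"
  proof (rule nn_integral_cong)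
    fix x
    have "norm (T x) = norm x" using orthogonal_transformation_norm[OF T] .
    moreover from this have "T x = 0 \<longleftrightarrow> x = 0" by (metis norm_eq_zero)
    ultimately show "indicator A (T (x /\<^sub>R norm x)) * indicator (ball 0 1 - {0}) x = h (T x)"
      by (simp add: h_def linear_scale[OF lin] indicator_def)
  qed
  have 5: "of_nat DIM('a) * (\<integral>\<^sup>+x. h x \<partial>lborel) = (\<integral>\<^sup>+x. indicator A x \<partial>surface_measure)"
    unfolding h_def by (rule nn_integral_surface_measure[symmetric, OF borel_measurable_indicator[OF A]])
  show "emeasure (distr surface_measure surface_measure T) A = emeasure surface_measure A"
    unfolding 1 2 3 4 nn_integral_lborel_orthogonal[OF T hm] 5 by (rule nn_integral_indicator[OF A])
qed

lemma integral_surface_measure_orthogonal: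
  fixes g :: "'a::euclidean_space \<Rightarrow> real" and T :: "'a \<Rightarrow> 'a"
  assumes T: "orthogonal_transformation T" and g: "continuous_on (sphere 0 1) g"
  shows "surface_integral (\<lambda>x. g (T x)) = surface_integral g"
  using integral_distr[OF orthogonal_transformation_measurable_surface[OF T]
      continuous_on_measurable_surface_measure[OF g]]
  by (simp add: distr_surface_measure_orthogonal[OF T])

text \<open>The surface measure charges every nonempty relatively open subset of the sphere, because the cone
  over it is open and therefore not a null set.\<close>

lemma continuous_surface_integral_0_imp_0:
  fixes g :: "'a::euclidean_space \<Rightarrow> real"
  assumes g: "continuous_on (sphere 0 1) g" and pos: "\<And>x. x \<in> sphere 0 1 \<Longrightarrow> 0 \<le> g x"
    and int: "surface_integral g = 0" and x: "x \<in> sphere 0 1"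
  shows "g x = 0"
proof -
  let ?U = "ball 0 1 - {0::'a}"
  note [measurable] = continuous_on_measurable_surface_measure[OF g]
  have "AE x in surface_measure. g x = 0"
    using integral_nonneg_eq_0_iff_AE[OF integrable_surface_measure[OF g]] pos int AE_I2[of surface_measure "\<lambda>x. 0 \<le> g x"] by simp
  then have "(\<integral>\<^sup>+x. ennreal (g x) \<partial>surface_measure) = 0"
    by (subst nn_integral_0_iff_AE) (auto elim: eventually_mono)
  then have 0: "(\<integral>\<^sup>+x. ennreal (g (x /\<^sub>R norm x)) * indicator ?U x \<partial>lborel) = 0"
    by (subst (asm) nn_integral_surface_measure) (auto simp: DIM_positive)
  have op: "open ?U" by (intro open_Diff) auto
  have cont: "continuous_on ?U (\<lambda>x. g (x /\<^sub>R norm x))"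
    by (rule continuous_on_compose2[OF g]) (auto intro!: continuous_intros simp: field_simps split: if_splits)
  then have m: "(\<lambda>x. g (x /\<^sub>R norm x) * indicator ?U x) \<in> borel_measurable borel"
    using borel_measurable_continuous_on_indicator[of ?U "\<lambda>x. g (x /\<^sub>R norm x)"] op by (simp add: mult.commute)
  have "(\<lambda>x. ennreal (g (x /\<^sub>R norm x)) * indicator ?U x) =
      (\<lambda>x. ennreal (g (x /\<^sub>R norm x) * indicator ?U x))"
    by (auto simp: indicator_def)
  then have "(\<lambda>x. ennreal (g (x /\<^sub>R norm x)) * indicator ?U x) \<in> borel_measurable lborel"
    using m by simp
  then have "AE x in lborel. ennreal (g (x /\<^sub>R norm x)) * indicator ?U x = 0"
    using 0 nn_integral_0_iff_AE by blast
  then have "AE x in lborel. x \<in> ?U \<longrightarrow> g (x /\<^sub>R norm x) = 0"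
  proof (rule AE_mp, intro AE_I2 impI)
    fix x assume 0: "ennreal (g (x /\<^sub>R norm x)) * indicator ?U x = 0" and x: "x \<in> ?U"
    then have "g (x /\<^sub>R norm x) \<le> 0" by (simp add: ennreal_eq_0_iff)
    moreover have "0 \<le> g (x /\<^sub>R norm x)" using x by (intro pos) simp
    ultimately show "g (x /\<^sub>R norm x) = 0" by simp
  qed
  then have AE: "AE x\<in>?U in lebesgue. x \<in> - (?U \<inter> (\<lambda>x. g (x /\<^sub>R norm x)) -` (-{0}))"
    using AE_completion[of "\<lambda>x. x \<in> ?U \<longrightarrow> g (x /\<^sub>R norm x) = 0" lborel] by (simp add: imp_conjL cong: imp_cong)
  have "closed (- (?U \<inter> (\<lambda>x. g (x /\<^sub>R norm x)) -` (-{0})))"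
    by (intro closed_Compl continuous_open_preimage[OF cont op]) auto
  from mem_closed_if_AE_lebesgue_open[OF op this AE, of "x /\<^sub>R 2"] x
  show ?thesis by (cases "x = 0") auto
qed

lemma measure_surface_pos: "0 < measure (surface_measure :: 'a::euclidean_space measure) (sphere 0 1)"
proof -
  obtain b :: 'a where "b \<in> Basis" using nonempty_Basis by blast
  then have "measure (surface_measure :: 'a measure) (sphere 0 1) \<noteq> 0"
    using continuous_surface_integral_0_imp_0[of "\<lambda>x::'a. 1" b] by auto
  then show ?thesis using zero_less_measure_iff by blast
qed

text \<open>The reflection in the hyperplane orthogonal to \<open>x - y\<close> exchanges \<open>x\<close> and \<open>y\<close>.\<close>

lemma orthogonal_transformation_transitive:
  fixes x y :: "'a::euclidean_space"
  assumes "norm x = norm y"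
  obtains T where "orthogonal_transformation T" "T x = y"
proof (cases "x = y")
  case True
  then show ?thesis using that[of "\<lambda>x. x"] by (simp add: orthogonal_transformation_def linear_id[unfolded id_def])
next
  case False
  define w where "w = x - y"
  define c where "c = 2 / (w \<bullet> w)"
  define T where "T z = z - (c * (z \<bullet> w)) *\<^sub>R w" for z
  have c: "c * (w \<bullet> w) = 2" using False by (simp add: w_def c_def)
  have "linear T"
    unfolding T_def
    by (rule linearI) (simp_all add: inner_add_left distrib_left scaleR_add_left scaleR_right_diff_distrib mult.left_commute)
  moreover have "T u \<bullet> T v = u \<bullet> v" for u v
  proof -
    have "T u \<bullet> T v = u \<bullet> v - 2 * c * (u \<bullet> w) * (v \<bullet> w) + c * (c * (w \<bullet> w)) * (u \<bullet> w) * (v \<bullet> w)"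
      unfolding T_def inner_diff_left inner_diff_right inner_scaleR_left inner_scaleR_right
        inner_commute[of w v] by algebra
    then show ?thesis by (simp add: c)
  qed
  ultimately have orth: "orthogonal_transformation T" by (simp add: orthogonal_transformation_def)
  have "x \<bullet> x = y \<bullet> y" using assms by (simp add: norm_eq)
  then have "2 * (x \<bullet> w) = w \<bullet> w"
    by (simp add: w_def inner_diff_left inner_diff_right inner_commute[of y x])
  then have "c * (2 * (x \<bullet> w)) = 2" using c by simp
  then have "c * (x \<bullet> w) = 1" by simp
  then have "T x = y" by (simp add: T_def w_def)
  then show ?thesis using that orth by blast
qed

section \<open>Green's identity on the sphere\<close>

lemma continuous_on_rpf:
  "real_polynomial_function p \<Longrightarrow> continuous_on S p"
  by (metis real_polynomial_function_eq continuous_on_polymonial_function)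

lemma integrable_rpf: "real_polynomial_function p \<Longrightarrow> integrable surface_measure p"
  by (intro integrable_surface_measure continuous_on_rpf)

lemma orthonormal_plane_rotation:
  fixes a b :: "'a::euclidean_space" and \<theta> :: real
  assumes ab: "a \<bullet> a = 1" "b \<bullet> b = 1" "a \<bullet> b = 0"
  defines "R \<equiv> \<lambda>\<theta> x. x + ((cos \<theta> - 1) * (x \<bullet> a) - sin \<theta> * (x \<bullet> b)) *\<^sub>R a
      + (sin \<theta> * (x \<bullet> a) + (cos \<theta> - 1) * (x \<bullet> b)) *\<^sub>R b"
  shows "orthogonal_transformation (R \<theta>)"
    and "((\<lambda>\<theta>. R \<theta> x) has_vector_derivative
      ((R \<theta> x \<bullet> a) *\<^sub>R b - (R \<theta> x \<bullet> b) *\<^sub>R a)) (at \<theta>)"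
    and "R 0 x = x"
proof -
  have ba: "b \<bullet> a = 0" using ab(3) by (simp add: inner_commute)
  have "linear (R \<theta>)"
    unfolding R_def
    by (rule linearI) (simp_all add: inner_add_left algebra_simps)
  moreover have "R \<theta> u \<bullet> R \<theta> v = u \<bullet> v" for u v
  proof -
    have "R \<theta> u \<bullet> R \<theta> v = u \<bullet> v
        + ((sin \<theta>)\<^sup>2 + (cos \<theta>)\<^sup>2 - 1) * ((u \<bullet> a) * (v \<bullet> a) + (u \<bullet> b) * (v \<bullet> b))"
      unfolding R_def
      by (simp only: inner_add_left inner_add_right inner_scaleR_left inner_scaleR_right ab ba
          inner_commute[of a v] inner_commute[of b v]) algebra
    then show ?thesis by simp
  qed
  ultimately show "orthogonal_transformation (R \<theta>)" by (simp add: orthogonal_transformation_def)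
  show "((\<lambda>\<theta>. R \<theta> x) has_vector_derivative
      ((R \<theta> x \<bullet> a) *\<^sub>R b - (R \<theta> x \<bullet> b) *\<^sub>R a)) (at \<theta>)"
    unfolding R_def
    by (auto intro!: derivative_eq_intros simp: inner_add_left ab ba)
      (simp add: algebra_simps)
  show "R 0 x = x" by (simp add: R_def)
qed

text \<open>The field \<open>x\<^sub>a \<partial>\<^sub>b - x\<^sub>b \<partial>\<^sub>a\<close> generates the rotations of a coordinate plane, so the integral is
  the derivative at zero of the integral of the rotated function, which is constant in the angle.\<close>

lemma surface_integral_rotation_field:
  fixes \<psi> :: "'a::euclidean_space \<Rightarrow> real"
  assumes \<psi>: "real_polynomial_function \<psi>" and ab: "a \<in> Basis" "b \<in> Basis"
  shows "surface_integral (\<lambda>x. (x \<bullet> a) * dir_deriv b \<psi> x - (x \<bullet> b) * dir_deriv a \<psi> x) = 0"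
proof (cases "a = b")
  case False
  define R where "R \<theta> x = x + ((cos \<theta> - 1) * (x \<bullet> a) - sin \<theta> * (x \<bullet> b)) *\<^sub>R a
      + (sin \<theta> * (x \<bullet> a) + (cos \<theta> - 1) * (x \<bullet> b)) *\<^sub>R b" for \<theta> :: real and x :: 'a
  define L where "L x = (x \<bullet> a) * dir_deriv b \<psi> x - (x \<bullet> b) * dir_deriv a \<psi> x" for x
  have "a \<bullet> a = 1" "b \<bullet> b = 1" "a \<bullet> b = 0"
    using ab False by (auto simp: inner_Basis)
  note R = orthonormal_plane_rotation[OF this, folded R_def]
  have d: "((\<lambda>\<theta>. \<psi> (R \<theta> x)) has_real_derivative L (R \<theta> x)) (at \<theta>)" for \<theta> x
  proof -
    have "((\<lambda>\<theta>. \<psi> (R \<theta> x)) has_derivative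
        (\<lambda>h. dir_deriv (h *\<^sub>R ((R \<theta> x \<bullet> a) *\<^sub>R b - (R \<theta> x \<bullet> b) *\<^sub>R a)) \<psi> (R \<theta> x))) (at \<theta>)"
      by (rule has_derivative_compose[OF _ dir_deriv_has_derivative[OF \<psi>]])
        (use R(2)[where \<theta>=\<theta> and x=x] in \<open>simp add: has_vector_derivative_def\<close>)
    then show ?thesis
      by (simp add: has_field_derivative_def L_def linear_scale[OF dir_deriv_linear[OF \<psi>]]
          linear_diff[OF dir_deriv_linear[OF \<psi>]] mult_commute_abs)
  qed
  have L: "continuous_on (sphere 0 1) L"
    unfolding L_def by (intro continuous_intros continuous_on_dir_deriv \<psi>)
  then have "bounded (L ` sphere 0 1)"
    using compact_continuous_image compact_imp_bounded compact_sphere by blast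
  then obtain B where B: "\<And>x. x \<in> sphere 0 1 \<Longrightarrow> norm (L x) \<le> B"
    unfolding bounded_iff by blast
  define t where "t n = 1 / real (Suc n)" for n
  have t: "t n > 0" for n by (simp add: t_def)
  define f where "f n x = (\<psi> (R (t n) x) - \<psi> x) / t n" for n x
  have \<psi>R: "continuous_on (sphere 0 1) (\<lambda>x. \<psi> (R \<theta> x))" for \<theta>
    by (rule continuous_on_compose2[OF continuous_on_rpf[OF \<psi>, of UNIV]])
      (auto simp: R_def intro!: continuous_intros)
  have int: "surface_integral (f n) = 0" for n
    unfolding f_def
    using integral_surface_measure_orthogonal[OF R(1) continuous_on_rpf[OF \<psi>], of "t n"]
    by (simp add: integrable_surface_measure \<psi>R continuous_on_rpf \<psi>)
  have "(\<lambda>n. surface_integral (f n)) \<longlonglongrightarrow> surface_integral L"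
  proof (rule integral_dominated_convergence[where w="\<lambda>_. B"])
    show "L \<in> borel_measurable surface_measure"
      by (rule continuous_on_measurable_surface_measure[OF L])
    show "f n \<in> borel_measurable surface_measure" for n
      unfolding f_def using t[of n]
      by (intro continuous_on_measurable_surface_measure continuous_intros \<psi>R continuous_on_rpf \<psi>) auto
    show "AE x in surface_measure. (\<lambda>n. f n x) \<longlonglongrightarrow> L x"
    proof (rule AE_I2)
      fix x :: 'a
      have "((\<lambda>h. (\<psi> (R (0 + h) x) - \<psi> (R 0 x)) / h) \<longlongrightarrow> L x) (at 0)"
        using d[of x 0] R(3) unfolding DERIV_def by simp
      moreover have "filterlim t (at 0) sequentially"
        unfolding filterlim_at t_def
        using LIMSEQ_inverse_real_of_nat by (auto simp: inverse_eq_divide)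
      ultimately have "(\<lambda>n. (\<psi> (R (0 + t n) x) - \<psi> (R 0 x)) / t n) \<longlonglongrightarrow> L x"
        by (rule filterlim_compose)
      then show "(\<lambda>n. f n x) \<longlonglongrightarrow> L x" by (simp add: f_def R(3))
    qed
    show "AE x in surface_measure. norm (f n x) \<le> B" for n
    proof (rule AE_I2)
      fix x :: 'a assume "x \<in> space surface_measure"
      then have x: "norm x = 1" by simp
      obtain z where z: "\<psi> (R (t n) x) - \<psi> (R 0 x) = (t n - 0) * L (R z x)"
        using MVT2[OF t[of n], of "\<lambda>\<theta>. \<psi> (R \<theta> x)" "\<lambda>\<theta>. L (R \<theta> x)"] d by blast
      have "R z x \<in> sphere 0 1"
        using orthogonal_transformation_norm[OF R(1)[of z], of x] x by simp
      then show "norm (f n x) \<le> B"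
        using z t[of n] B by (simp add: f_def R(3))
    qed
  qed simp
  then have "surface_integral L = 0"
    using int LIMSEQ_unique[of "\<lambda>n. 0::real"] by auto
  then show ?thesis by (simp add: L_def[abs_def])
qed simp

text \<open>Integration by parts on the sphere. Summing the identity for the rotation fields in the planes of
  \<open>a\<close> and \<open>b\<close>, applied to \<open>(x \<bullet> a) * \<phi> x\<close>, over all \<open>a\<close> leaves \<open>\<partial>\<^sub>b \<phi>\<close> and multiples of
  \<open>(x \<bullet> b) * \<phi> x\<close>, by Euler's relation.\<close>

lemma surface_integral_dir_deriv:
  fixes \<phi> :: "'a::euclidean_space \<Rightarrow> real"
  assumes \<phi>: "\<phi> \<in> homogeneous c" and b: "b \<in> Basis"
  shows "surface_integral (dir_deriv b \<phi>) =
    (real c + real DIM('a) - 1) * surface_integral (\<lambda>x. (x \<bullet> b) * \<phi> x)"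
proof -
  note p = homogeneousD(1)[OF \<phi>]
  note i = homogeneousD(1)[OF homogeneous_inner]
  define F where "F a x = (x \<bullet> a) * dir_deriv b (\<lambda>x. (x \<bullet> a) * \<phi> x) x - (x \<bullet> b) * dir_deriv a (\<lambda>x. (x \<bullet> a) * \<phi> x) x"
    for a x :: 'a
  have rp: "real_polynomial_function (\<lambda>x. (x \<bullet> a) * \<phi> x)" for a
    by (intro real_polynomial_function.intros(4) i p)
  have F: "real_polynomial_function (F a)" for a
    unfolding F_def
    by (intro real_polynomial_function_diff real_polynomial_function.intros(4) i p real_polynomial_function_dir_deriv)
  have "0 = (\<Sum>a\<in>Basis. surface_integral (F a))"
    unfolding F_def using surface_integral_rotation_field[OF rp _ b] by simp
  also have "\<dots> = surface_integral (\<lambda>x. \<Sum>a\<in>Basis. F a x)"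
    using integrable_rpf[OF F] by (intro Bochner_Integration.integral_sum[symmetric]) auto
  also have "\<dots> = surface_integral
      (\<lambda>x. dir_deriv b \<phi> x - (real c + real DIM('a) - 1) * ((x \<bullet> b) * \<phi> x))"
  proof (rule Bochner_Integration.integral_cong[OF refl])
    fix x :: 'a assume "x \<in> space surface_measure"
    then have x: "x \<bullet> x = 1" by (simp add: dot_square_norm)
    have "F a x = (x \<bullet> a) * (x \<bullet> a) * dir_deriv b \<phi> x + (x \<bullet> a) * (b \<bullet> a) * \<phi> x
        - (x \<bullet> b) * ((x \<bullet> a) * dir_deriv a \<phi> x) - (x \<bullet> b) * \<phi> x" if "a \<in> Basis" for a
      unfolding F_def using that
      unfolding dir_deriv_mult[OF i p] dir_deriv_inner by (simp add: algebra_simps)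
    then have "(\<Sum>a\<in>Basis. F a x) = (\<Sum>a\<in>Basis. (x \<bullet> a) * (x \<bullet> a) * dir_deriv b \<phi> x + (x \<bullet> a) * (b \<bullet> a) * \<phi> x
        - (x \<bullet> b) * ((x \<bullet> a) * dir_deriv a \<phi> x) - (x \<bullet> b) * \<phi> x)"
      by (intro sum.cong) auto
    moreover have "(\<Sum>a\<in>Basis. (x \<bullet> a) * (x \<bullet> a) * dir_deriv b \<phi> x) = dir_deriv b \<phi> x"
      using x euclidean_inner[of x x] by (simp only: sum_distrib_right[symmetric] mult_1)
    moreover have "(\<Sum>a\<in>Basis. (x \<bullet> a) * (b \<bullet> a) * \<phi> x) = (x \<bullet> b) * \<phi> x"
      by (simp only: sum_distrib_right[symmetric] euclidean_inner[of x b, symmetric])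
    moreover have "(\<Sum>a\<in>Basis. (x \<bullet> b) * ((x \<bullet> a) * dir_deriv a \<phi> x)) = (x \<bullet> b) * (real c * \<phi> x)"
      by (simp only: sum_distrib_left[symmetric] dir_deriv_expand[OF p, of x x, symmetric]
          euler_homogeneous[OF \<phi>, of x])
    ultimately show "(\<Sum>a\<in>Basis. F a x) = dir_deriv b \<phi> x - (real c + real DIM('a) - 1) * ((x \<bullet> b) * \<phi> x)"
      unfolding sum.distrib sum_subtractf by (simp add: algebra_simps)
  qed
  also have "\<dots> = surface_integral (dir_deriv b \<phi>)
      - (real c + real DIM('a) - 1) * surface_integral (\<lambda>x. (x \<bullet> b) * \<phi> x)"
    using integrable_rpf[OF rp] integrable_rpf[OF real_polynomial_function_dir_deriv[OF p]] by simp
  finally show ?thesis by simp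
qed

text \<open>The eigenvalue of the positive Laplace-Beltrami operator for the spherical harmonics of degree
  \<open>k\<close>, in terms of the dimension \<open>D\<close> of the ambient space.\<close>

definition lb_eigenvalue :: "nat \<Rightarrow> nat \<Rightarrow> real" where
  "lb_eigenvalue D k = real k * (real k + real D - 2)"

text \<open>On the sphere, \<open>lb_eigenvalue DIM('a) m * p - laplacian p\<close> is the positive Laplace-Beltrami
  operator applied to \<open>p\<close>, and the right-hand side is its Dirichlet form: the integral of the product
  of the full gradients minus the product of the radial derivatives.\<close>

lemma green_dirichlet_form:
  fixes p q :: "'a::euclidean_space \<Rightarrow> real"
  assumes p: "p \<in> homogeneous m" and q: "q \<in> homogeneous n"
  shows "surface_integral (\<lambda>x. (lb_eigenvalue DIM('a) m * p x - laplacian p x) * q x) =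
    surface_integral (\<lambda>x. \<Sum>b\<in>Basis. dir_deriv b p x * dir_deriv b q x)
    - real m * real n * surface_integral (\<lambda>x. p x * q x)"
proof -
  note pp = homogeneousD(1)[OF p] and qq = homogeneousD(1)[OF q]
  note i = homogeneousD(1)[OF homogeneous_inner]
  note rp = real_polynomial_function.intros(4) pp qq i real_polynomial_function_dir_deriv real_polynomial_function_laplacian
  have [simp]: "integrable surface_measure (\<lambda>x. dir_deriv b (dir_deriv b p) x * q x)"
    "integrable surface_measure (\<lambda>x. dir_deriv b p x * dir_deriv b q x)"
    "integrable surface_measure (\<lambda>x. (x \<bullet> b) * (dir_deriv b p x * q x))"
    "integrable surface_measure (\<lambda>x. laplacian p x * q x)"
    "integrable surface_measure (\<lambda>x. p x * q x)" for b
    by (intro integrable_rpf rp)+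
  have *: "surface_integral (\<lambda>x. dir_deriv b (dir_deriv b p) x * q x + dir_deriv b p x * dir_deriv b q x) =
    (real m + real n + real DIM('a) - 2) * surface_integral (\<lambda>x. (x \<bullet> b) * (dir_deriv b p x * q x))"
    if b: "b \<in> Basis" for b
  proof (cases m)
    case 0
    then have "dir_deriv b p = (\<lambda>x. 0)" using dir_deriv_homogeneous_0 p by blast
    then show ?thesis by simp
  next
    case (Suc k)
    have "(\<lambda>x. dir_deriv b p x * q x) \<in> homogeneous (k + n)"
      using p q dir_deriv_homogeneous homogeneous_mult Suc by blast
    from surface_integral_dir_deriv[OF this b]
    have "surface_integral (dir_deriv b (\<lambda>x. dir_deriv b p x * q x)) =
      (real m + real n + real DIM('a) - 2) * surface_integral (\<lambda>x. (x \<bullet> b) * (dir_deriv b p x * q x))"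
      using Suc by simp
    moreover have "dir_deriv b (\<lambda>x. dir_deriv b p x * q x) = (\<lambda>x. dir_deriv b (dir_deriv b p) x * q x + dir_deriv b p x * dir_deriv b q x)"
      by (rule ext) (simp add: dir_deriv_mult[OF real_polynomial_function_dir_deriv[OF pp] qq])
    ultimately show ?thesis by simp
  qed
  have "surface_integral (\<lambda>x. laplacian p x * q x) +
      surface_integral (\<lambda>x. \<Sum>b\<in>Basis. dir_deriv b p x * dir_deriv b q x) =
      surface_integral (\<lambda>x. \<Sum>b\<in>Basis. dir_deriv b (dir_deriv b p) x * q x + dir_deriv b p x * dir_deriv b q x)"
    by (simp add: laplacian_eq[OF pp] sum.distrib sum_distrib_right)
  also have "\<dots> = (\<Sum>b\<in>Basis. surface_integral (\<lambda>x. dir_deriv b (dir_deriv b p) x * q x + dir_deriv b p x * dir_deriv b q x))"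
    by (intro Bochner_Integration.integral_sum) simp
  also have "\<dots> = (\<Sum>b\<in>Basis. (real m + real n + real DIM('a) - 2) *
      surface_integral (\<lambda>x. (x \<bullet> b) * (dir_deriv b p x * q x)))"
    by (intro sum.cong refl *)
  also have "\<dots> = (real m + real n + real DIM('a) - 2) *
      surface_integral (\<lambda>x. \<Sum>b\<in>Basis. (x \<bullet> b) * (dir_deriv b p x * q x))"
    by (subst Bochner_Integration.integral_sum) (simp_all add: sum_distrib_left)
  also have "(\<lambda>x. \<Sum>b\<in>Basis. (x \<bullet> b) * (dir_deriv b p x * q x)) = (\<lambda>x. real m * (p x * q x))"
  proof
    fix x :: 'a
    have "(\<Sum>b\<in>Basis. (x \<bullet> b) * (dir_deriv b p x * q x)) = dir_deriv x p x * q x"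
      unfolding dir_deriv_expand[OF pp, of x x] sum_distrib_right by (simp only: mult.assoc)
    then show "(\<Sum>b\<in>Basis. (x \<bullet> b) * (dir_deriv b p x * q x)) = real m * (p x * q x)"
      by (simp add: euler_homogeneous[OF p])
  qed
  finally have 1: "surface_integral (\<lambda>x. laplacian p x * q x) +
      surface_integral (\<lambda>x. \<Sum>b\<in>Basis. dir_deriv b p x * dir_deriv b q x) =
      (real m + real n + real DIM('a) - 2) * (real m * surface_integral (\<lambda>x. p x * q x))"
    by simp
  have "surface_integral (\<lambda>x. (lb_eigenvalue DIM('a) m * p x - laplacian p x) * q x) =
      surface_integral (\<lambda>x. lb_eigenvalue DIM('a) m * (p x * q x) - laplacian p x * q x)"
    by (intro Bochner_Integration.integral_cong) (auto simp: algebra_simps)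
  also have "\<dots> = lb_eigenvalue DIM('a) m * surface_integral (\<lambda>x. p x * q x) -
      surface_integral (\<lambda>x. laplacian p x * q x)"
    by simp
  finally show ?thesis using 1 by (simp add: lb_eigenvalue_def algebra_simps)
qed

lemma green_symmetric:
  fixes p q :: "'a::euclidean_space \<Rightarrow> real"
  assumes p: "p \<in> homogeneous m" and q: "q \<in> homogeneous n"
  shows "surface_integral (\<lambda>x. (lb_eigenvalue DIM('a) m * p x - laplacian p x) * q x) =
    surface_integral (\<lambda>x. p x * (lb_eigenvalue DIM('a) n * q x - laplacian q x))"
  using green_dirichlet_form[OF p q] green_dirichlet_form[OF q p]
  by (simp add: mult.commute)

abbreviation harmonics :: "nat \<Rightarrow> ('a::euclidean_space \<Rightarrow> real) set" where
  "harmonics \<equiv> harmonic_homogeneous_polynomials"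

lemma harmonicD:
  assumes "p \<in> harmonics k"
  shows "p \<in> homogeneous k" "laplacian p x = 0" "real_polynomial_function p"
  using assms by (auto simp: harmonic_homogeneous_polynomials_def homogeneous_def)

lemma lb_eigenvalue_strict_mono: "2 \<le> D \<Longrightarrow> k < l \<Longrightarrow> lb_eigenvalue D k < lb_eigenvalue D l"
  unfolding lb_eigenvalue_def
  by (rule mult_strict_mono') auto

lemma lb_eigenvalue_inj: "2 \<le> D \<Longrightarrow> lb_eigenvalue D k = lb_eigenvalue D l \<Longrightarrow> k = l"
  using lb_eigenvalue_strict_mono[of D] by (metis less_irrefl linorder_neqE_nat)

text \<open>Eigenfunctions of a symmetric operator for different eigenvalues are orthogonal. The assumption on
  the dimension makes the eigenvalues strictly increasing: for dimension one, degrees zero and one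
  share the eigenvalue zero.\<close>

lemma harmonic_orthogonal:
  fixes p q :: "'a::euclidean_space \<Rightarrow> real"
  assumes "2 \<le> DIM('a)" "k \<noteq> l"
    and p: "p \<in> harmonics k" and q: "q \<in> harmonics l"
  shows "surface_integral (\<lambda>x. p x * q x) = 0"
proof -
  have "lb_eigenvalue DIM('a) k * surface_integral (\<lambda>x. p x * q x) =
      lb_eigenvalue DIM('a) l * surface_integral (\<lambda>x. p x * q x)"
    using green_symmetric[OF harmonicD(1)[OF p] harmonicD(1)[OF q]]
    unfolding harmonicD(2)[OF p] harmonicD(2)[OF q]
    by (simp add: mult.assoc mult.left_commute[of "p _"])
  then show ?thesis using lb_eigenvalue_inj[OF assms(1)] assms(2) by auto
qed

section \<open>Polynomials of bounded degree\<close>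

interpretation fun_space: vector_space "\<lambda>(c::real) (f::'a \<Rightarrow> real) x. c * f x"
  by standard (auto simp: fun_eq_iff algebra_simps)

lemma sum_fun_apply: "(\<Sum>i\<in>I. g i) x = (\<Sum>i\<in>I. (g i x :: real))"
  by (induction I rule: infinite_finite_induct) auto

definition monomial :: "('a::euclidean_space \<Rightarrow> nat) \<Rightarrow> 'a \<Rightarrow> real" where
  "monomial \<beta> x = (\<Prod>b\<in>Basis. (x \<bullet> b) ^ \<beta> b)"

lemma monomial_mult: "monomial \<beta> x * monomial \<gamma> x = monomial (\<lambda>b. \<beta> b + \<gamma> b) x"
  by (simp add: monomial_def power_add prod.distrib)

lemma monomial_scale: "monomial \<beta> (t *\<^sub>R x) = t ^ (\<Sum>b\<in>Basis. \<beta> b) * monomial \<beta> x"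
  by (simp add: monomial_def power_mult_distrib prod.distrib power_sum)

lemma span_monomial_mult:
  assumes p: "p \<in> fun_space.span (range monomial)" and q: "q \<in> fun_space.span (range monomial)"
  shows "(\<lambda>x. p x * q x) \<in> fun_space.span (range (monomial :: ('a::euclidean_space \<Rightarrow> nat) \<Rightarrow> _))"
proof -
  have sub: "fun_space.subspace {q. (\<lambda>x. m x * q x) \<in> fun_space.span R}"
    for R and m :: "'a \<Rightarrow> real"
  proof (rule fun_space.subspaceI)
    show "0 \<in> {q. (\<lambda>x. m x * q x) \<in> fun_space.span R}"
      using fun_space.span_zero[of R] by (simp add: zero_fun_def)
  next
    fix f g assume "f \<in> {q. (\<lambda>x. m x * q x) \<in> fun_space.span R}"
      "g \<in> {q. (\<lambda>x. m x * q x) \<in> fun_space.span R}"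
    then show "f + g \<in> {q. (\<lambda>x. m x * q x) \<in> fun_space.span R}"
      using fun_space.span_add[of "\<lambda>x. m x * f x" R "\<lambda>x. m x * g x"]
      by (simp add: plus_fun_def distrib_left)
  next
    fix c f assume "f \<in> {q. (\<lambda>x. m x * q x) \<in> fun_space.span R}"
    then show "(\<lambda>x. c * f x) \<in> {q. (\<lambda>x. m x * q x) \<in> fun_space.span R}"
      using fun_space.span_scale[of "\<lambda>x. m x * f x" R c] by (simp add: mult.left_commute)
  qed
  have 1: "(\<lambda>x. monomial \<beta> x * q x) \<in> fun_space.span (range monomial)"
    if "q \<in> fun_space.span (range monomial)" for q and \<beta> :: "'a \<Rightarrow> nat"
    using that
  proof (induction q rule: fun_space.span_induct)
    case base
    show ?case by (rule sub)
  next
    case (step q)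
    then obtain \<gamma> where "q = monomial \<gamma>" by auto
    then show ?case by (auto simp: monomial_mult intro: fun_space.span_base)
  qed
  show ?thesis
    using p
  proof (induction p rule: fun_space.span_induct)
    case base
    show ?case using sub[of q] by (simp add: mult.commute)
  next
    case (step p)
    then show ?case using 1[OF q] by auto
  qed
qed

lemma rpf_in_span_monomial:
  fixes p :: "'a::euclidean_space \<Rightarrow> real"
  assumes "real_polynomial_function p"
  shows "p \<in> fun_space.span (range monomial)"
  using assms
proof (induction p)
  case (linear f)
  have m: "monomial (\<lambda>c. if c = b then 1 else 0) x = x \<bullet> b" if "b \<in> Basis" for b x :: 'a
  proof -
    have "monomial (\<lambda>c. if c = b then 1 else 0) x = (\<Prod>c\<in>Basis. if c = b then x \<bullet> c else 1)"
      unfolding monomial_def by (intro prod.cong) auto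
    then show ?thesis using that by (simp add: prod.delta)
  qed
  have "f = (\<Sum>b\<in>Basis. (\<lambda>x. f b * monomial (\<lambda>c. if c = b then 1 else 0) x))"
  proof
    fix x
    have "f x = (\<Sum>b\<in>Basis. (x \<bullet> b) * f b)"
      using dir_deriv_expand[OF real_polynomial_function.intros(1)[OF linear], of x 0]
      by (simp add: dir_deriv_bounded_linear[OF linear])
    also have "\<dots> = (\<Sum>b\<in>Basis. f b * monomial (\<lambda>c. if c = b then 1 else 0) x)"
      by (intro sum.cong) (auto simp: m)
    finally show "f x = (\<Sum>b\<in>Basis. (\<lambda>x. f b * monomial (\<lambda>c. if c = b then 1 else 0) x)) x"
      by (simp add: sum_fun_apply)
  qed
  also have "\<dots> \<in> fun_space.span (range monomial)"
    by (intro fun_space.span_sum fun_space.span_scale fun_space.span_base rangeI)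
  finally show ?case .
next
  case (const c)
  have "(\<lambda>x::'a. c) = (\<lambda>x. c * monomial (\<lambda>_. 0) x)" by (simp add: monomial_def)
  also have "\<dots> \<in> fun_space.span (range monomial)"
    by (intro fun_space.span_scale fun_space.span_base rangeI)
  finally show ?case .
next
  case (add f g)
  then show ?case using fun_space.span_add[of f "range monomial" g] by (simp add: plus_fun_def)
next
  case (mult f g)
  then show ?case by (intro span_monomial_mult)
qed

text \<open>Total degree at most \<open>M\<close>, expressed by the degrees of the restrictions to the lines through the
  origin. In this form, stability under linear changes of variables and under products is
  immediate.\<close>

definition polynomials_le :: "nat \<Rightarrow> ('a::euclidean_space \<Rightarrow> real) set" where
  "polynomials_le M = {p. real_polynomial_function p \<and>
     (\<forall>x. \<exists>u. degree u \<le> M \<and> (\<forall>t. p (t *\<^sub>R x) = poly u t))}"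

lemma polynomials_leD: "p \<in> polynomials_le M \<Longrightarrow> real_polynomial_function p"
  by (simp add: polynomials_le_def)

lemma homogeneous_polynomials_le:
  assumes "p \<in> homogeneous k" "k \<le> M"
  shows "p \<in> polynomials_le M"
  using assms
  by (auto simp: polynomials_le_def homogeneous_def
      intro!: exI[of _ "monom (p _) k"] simp: poly_monom degree_monom_eq
      intro: order.trans[OF degree_monom_le])

lemma polynomials_le_add:
  assumes "p \<in> polynomials_le M" "q \<in> polynomials_le M"
  shows "(\<lambda>x. p x + q x) \<in> polynomials_le M"
  unfolding polynomials_le_def
proof (intro CollectI conjI allI)
  show "real_polynomial_function (\<lambda>x. p x + q x)"
    using assms by (auto simp: polynomials_le_def intro: real_polynomial_function.intros)
  fix x
  obtain u v where "degree u \<le> M" "degree v \<le> M"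
    "\<forall>t. p (t *\<^sub>R x) = poly u t" "\<forall>t. q (t *\<^sub>R x) = poly v t"
    using assms by (auto simp: polynomials_le_def) metis
  then show "\<exists>u. degree u \<le> M \<and> (\<forall>t. p (t *\<^sub>R x) + q (t *\<^sub>R x) = poly u t)"
    by (intro exI[of _ "u + v"]) (auto intro: degree_add_le)
qed

lemma polynomials_le_mult:
  assumes "p \<in> polynomials_le M" "q \<in> polynomials_le N"
  shows "(\<lambda>x. p x * q x) \<in> polynomials_le (M + N)"
  unfolding polynomials_le_def
proof (intro CollectI conjI allI)
  show "real_polynomial_function (\<lambda>x. p x * q x)"
    using assms by (auto simp: polynomials_le_def intro: real_polynomial_function.intros)
  fix x
  obtain u v where "degree u \<le> M" "degree v \<le> N"
    "\<forall>t. p (t *\<^sub>R x) = poly u t" "\<forall>t. q (t *\<^sub>R x) = poly v t"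
    using assms by (auto simp: polynomials_le_def) metis
  then show "\<exists>u. degree u \<le> M + N \<and> (\<forall>t. p (t *\<^sub>R x) * q (t *\<^sub>R x) = poly u t)"
    by (intro exI[of _ "u * v"]) (auto intro: order.trans[OF degree_mult_le])
qed

lemma polynomials_le_const: "(\<lambda>x. c) \<in> polynomials_le M"
  by (auto simp: polynomials_le_def intro!: real_polynomial_function.intros(2) exI[of _ "[:c:]"])

lemma polynomials_le_cmult:
  assumes "p \<in> polynomials_le M"
  shows "(\<lambda>x. c * p x) \<in> polynomials_le M"
  using polynomials_le_mult[OF polynomials_le_const[of c 0] assms] by simp

lemma polynomials_le_power:
  assumes "p \<in> polynomials_le M"
  shows "(\<lambda>x. p x ^ n) \<in> polynomials_le (n * M)"
proof (induction n)
  case (Suc n)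
  from polynomials_le_mult[OF assms Suc] show ?case by simp
qed (simp add: polynomials_le_const)

lemma polynomials_le_sum:
  assumes "finite I" "\<And>i. i \<in> I \<Longrightarrow> p i \<in> polynomials_le M"
  shows "(\<lambda>x. \<Sum>i\<in>I. p i x) \<in> polynomials_le M"
  using assms by (induction I rule: finite_induct) (auto simp: polynomials_le_const polynomials_le_add)

lemma polynomials_le_compose:
  assumes "p \<in> polynomials_le M" "linear T"
  shows "(\<lambda>x. p (T x)) \<in> polynomials_le M"
proof -
  have "polynomial_function T"
    using assms(2) by (simp add: linear_conv_bounded_linear polynomial_function_bounded_linear)
  then have "real_polynomial_function (p \<circ> T)"
    using assms(1) real_polynomial_function_compose by (auto simp: polynomials_le_def)
  then show ?thesis
    using assms by (auto simp: polynomials_le_def o_def linear_scale)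
qed

lemma subspace_polynomials_le: "fun_space.subspace (polynomials_le M)"
  by (rule fun_space.subspaceI)
    (auto simp: plus_fun_def zero_fun_def polynomials_le_const polynomials_le_add polynomials_le_cmult)

text \<open>A polynomial function is a linear combination of monomials. Comparing the coefficients of the powers
  of \<open>t\<close> in \<open>p (t *\<^sub>R x)\<close> shows that the terms of degree above \<open>M\<close> cancel. The remaining monomials have
  all exponents at most \<open>M\<close>, which makes them easy to count.\<close>

lemma polynomials_le_span:
  fixes p :: "'a::euclidean_space \<Rightarrow> real"
  assumes "p \<in> polynomials_le M"
  shows "p \<in> fun_space.span (monomial ` (PiE Basis (\<lambda>_. {..M})))"
proof -
  obtain S r where S: "finite S" "S \<subseteq> range monomial" and p: "p = (\<Sum>m\<in>S. (\<lambda>x. r m * m x))"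
    using rpf_in_span_monomial[OF polynomials_leD[OF assms]]
    unfolding fun_space.span_explicit by auto
  define \<beta> where "\<beta> m = (SOME \<beta>. m = monomial \<beta>)" for m :: "'a \<Rightarrow> real"
  have \<beta>: "monomial (\<beta> m) = m" if "m \<in> S" for m
    using that S(2) someI_ex[of "\<lambda>\<beta>. m = monomial \<beta>"] unfolding \<beta>_def by (metis (mono_tags, lifting) imageE subsetD)
  define d where "d m = (\<Sum>b\<in>Basis. \<beta> m b)" for m
  have px: "p x = (\<Sum>m\<in>S. if d m \<le> M then r m * m x else 0)" for x
  proof -
    define w where "w = (\<Sum>m\<in>S. Polynomial.monom (r m * m x) (d m))"
    obtain u where u: "degree u \<le> M" "\<And>t. p (t *\<^sub>R x) = poly u t"
      using assms by (auto simp: polynomials_le_def)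
    have "poly u t = poly w t" for t
    proof -
      have "poly u t = (\<Sum>m\<in>S. r m * m (t *\<^sub>R x))"
        unfolding u(2)[symmetric] by (subst p) (rule sum_fun_apply)
      also have "\<dots> = (\<Sum>m\<in>S. r m * (t ^ d m * m x))"
      proof (intro sum.cong refl)
        fix m assume "m \<in> S"
        then show "r m * m (t *\<^sub>R x) = r m * (t ^ d m * m x)"
          using monomial_scale[of "\<beta> m" t x] \<beta>[of m] by (simp add: d_def)
      qed
      finally show ?thesis by (simp add: w_def poly_sum poly_monom mult_ac)
    qed
    then have "poly u = poly w" by (rule ext)
    then have "u = w" by (simp only: poly_eq_poly_eq_iff)
    have "p x = poly w 1" using u(2)[of 1] \<open>u = w\<close> by simp
    also have "poly w 1 = poly (\<Sum>i\<le>M. Polynomial.monom (coeff w i) i) 1"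
      using u(1) \<open>u = w\<close> by (simp only: poly_as_sum_of_monoms')
    also have "\<dots> = (\<Sum>i\<le>M. coeff w i)" by (simp add: poly_sum poly_monom)
    also have "\<dots> = (\<Sum>i\<le>M. \<Sum>m\<in>S. if d m = i then r m * m x else 0)"
      by (simp add: w_def coeff_sum)
    also have "\<dots> = (\<Sum>m\<in>S. \<Sum>i\<le>M. if d m = i then r m * m x else 0)"
      by (rule sum.swap)
    also have "\<dots> = (\<Sum>m\<in>S. if d m \<le> M then r m * m x else 0)"
      by (intro sum.cong refl) (simp add: sum.delta)
    finally show ?thesis .
  qed
  have "p = (\<Sum>m\<in>{m\<in>S. d m \<le> M}. (\<lambda>x. r m * m x))"
  proof
    fix x
    show "p x = (\<Sum>m\<in>{m\<in>S. d m \<le> M}. (\<lambda>x. r m * m x)) x"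
      unfolding px[of x] sum_fun_apply using S(1) by (simp add: sum.inter_filter)
  qed
  also have "\<dots> \<in> fun_space.span (monomial ` (PiE Basis (\<lambda>_. {..M})))"
  proof (intro fun_space.span_sum fun_space.span_scale fun_space.span_base)
    fix m assume m: "m \<in> {m\<in>S. d m \<le> M}"
    have le: "\<beta> m b \<le> M" if "b \<in> Basis" for b
      using member_le_sum[OF that, of "\<beta> m"] m by (auto simp: d_def)
    have "monomial (restrict (\<beta> m) Basis) = monomial (\<beta> m)"
      by (simp add: monomial_def fun_eq_iff)
    then have "m = monomial (restrict (\<beta> m) Basis)"
      using \<beta>[of m] m by simp
    moreover have "restrict (\<beta> m) Basis \<in> PiE Basis (\<lambda>_. {..M})"
      using le by auto
    ultimately show "m \<in> monomial ` (PiE Basis (\<lambda>_. {..M}))" by blast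
  qed
  finally show ?thesis .
qed

section \<open>Orthonormal families and a Nikolskii inequality\<close>

definition sphere_inner :: "('a::euclidean_space \<Rightarrow> real) \<Rightarrow> ('a \<Rightarrow> real) \<Rightarrow> real" where
  "sphere_inner p q = surface_integral (\<lambda>x. p x * q x)"

definition orthonormal_family :: "nat \<Rightarrow> (nat \<Rightarrow> 'a::euclidean_space \<Rightarrow> real) \<Rightarrow> bool" where
  "orthonormal_family r e \<longleftrightarrow> (\<forall>i<r. real_polynomial_function (e i)) \<and>
     (\<forall>i<r. \<forall>j<r. sphere_inner (e i) (e j) = (if i = j then 1 else 0))"

lemma sphere_inner_commute: "sphere_inner p q = sphere_inner q p"
  by (simp add: sphere_inner_def mult.commute)

lemma sphere_inner_sum_left:
  assumes "\<And>i. i \<in> I \<Longrightarrow> continuous_on (sphere 0 1) (p i)" "continuous_on (sphere 0 1) q"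
  shows "sphere_inner (\<lambda>x. \<Sum>i\<in>I. c i * p i x) q = (\<Sum>i\<in>I. c i * sphere_inner (p i) q)"
proof -
  have "sphere_inner (\<lambda>x. \<Sum>i\<in>I. c i * p i x) q =
      surface_integral (\<lambda>x. \<Sum>i\<in>I. c i * (p i x * q x))"
    by (simp add: sphere_inner_def sum_distrib_right mult.assoc)
  also have "\<dots> = (\<Sum>i\<in>I. surface_integral (\<lambda>x. c i * (p i x * q x)))"
    using assms
    by (intro Bochner_Integration.integral_sum integrable_surface_measure continuous_intros) auto
  finally show ?thesis by (simp add: sphere_inner_def)
qed

lemma sphere_inner_diff_left:
  assumes "continuous_on (sphere 0 1) p" "continuous_on (sphere 0 1) p'" "continuous_on (sphere 0 1) q"
  shows "sphere_inner (\<lambda>x. p x - p' x) q = sphere_inner p q - sphere_inner p' q"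
  unfolding sphere_inner_def left_diff_distrib
  using assms by (intro Bochner_Integration.integral_diff integrable_surface_measure continuous_intros) auto

lemma sphere_inner_cmult_left: "sphere_inner (\<lambda>x. c * p x) q = c * sphere_inner p q"
  by (simp add: sphere_inner_def mult.assoc)

lemma sphere_inner_self_nonneg: "0 \<le> sphere_inner p p"
  by (simp add: sphere_inner_def)

lemma sphere_inner_self_0:
  assumes "continuous_on (sphere 0 1) p" "sphere_inner p p = 0" "x \<in> sphere 0 1"
  shows "p x = 0"
  using continuous_surface_integral_0_imp_0[of "\<lambda>x. p x * p x" x] assms
  by (auto simp: sphere_inner_def intro!: continuous_intros)

text \<open>Orthonormal functions are linearly independent, and there are at most \<open>(M + 1) ^ DIM('a)\<close>
  monomials with exponents up to \<open>M\<close>.\<close>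

lemma orthonormal_family_card_le:
  fixes e :: "nat \<Rightarrow> 'a::euclidean_space \<Rightarrow> real"
  assumes e: "orthonormal_family r e" and V: "\<And>i. i < r \<Longrightarrow> e i \<in> polynomials_le M"
  shows "r \<le> (M + 1) ^ DIM('a)"
proof -
  have on: "sphere_inner (e i) (e j) = (if i = j then 1 else 0)" if "i < r" "j < r" for i j
    using e that by (auto simp: orthonormal_family_def)
  have cont: "continuous_on (sphere 0 1) (e i)" if "i < r" for i
    using e that by (auto simp: orthonormal_family_def intro: continuous_on_rpf)
  have inj: "inj_on e {..<r}"
    by (rule inj_onI) (metis lessThan_iff on zero_neq_one)
  have "fun_space.independent (e ` {..<r})"
  proof (rule fun_space.independent_if_scalars_zero)
    fix f x assume s: "(\<Sum>x\<in>e ` {..<r}. (\<lambda>y. f x * x y)) = 0" and "x \<in> e ` {..<r}"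
    then obtain j where j: "j < r" "x = e j" by auto
    have "(\<lambda>y. \<Sum>i<r. f (e i) * e i y) = (\<lambda>y. 0)"
    proof
      fix y
      have "(\<Sum>i<r. f (e i) * e i y) = (\<Sum>x\<in>e ` {..<r}. (\<lambda>y. f x * x y)) y"
        by (simp add: sum_fun_apply sum.reindex[OF inj])
      then show "(\<Sum>i<r. f (e i) * e i y) = 0" by (simp add: s)
    qed
    then have "0 = sphere_inner (\<lambda>y. \<Sum>i<r. f (e i) * e i y) (e j)"
      by (simp add: sphere_inner_def)
    also have "\<dots> = (\<Sum>i<r. f (e i) * sphere_inner (e i) (e j))"
      using j by (intro sphere_inner_sum_left cont) auto
    also have "\<dots> = (\<Sum>i<r. if i = j then f (e i) else 0)"
      using j by (intro sum.cong refl) (auto simp: on)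
    also have "\<dots> = f x" using j by simp
    finally show "f x = 0" by simp
  qed simp
  moreover have "e ` {..<r} \<subseteq> fun_space.span (monomial ` (PiE Basis (\<lambda>_. {..M})))"
    using V polynomials_le_span by blast
  moreover have "finite (monomial ` (PiE Basis (\<lambda>_::'a. {..M})))"
    by (intro finite_imageI finite_PiE) auto
  ultimately have "card (e ` {..<r}) \<le> card (monomial ` (PiE Basis (\<lambda>_::'a. {..M})))"
    using fun_space.independent_span_bound by blast
  also have "\<dots> \<le> card (PiE Basis (\<lambda>_::'a. {..M}))"
    by (intro card_image_le finite_PiE) auto
  also have "\<dots> = (M + 1) ^ DIM('a)" by (simp add: card_PiE)
  finally show ?thesis by (simp add: card_image[OF inj])
qed

text \<open>An orthonormal family of maximal length in \<open>V\<close>; it exists because the lengths are bounded.\<close>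

lemma exists_orthonormal_basis:
  fixes V :: "('a::euclidean_space \<Rightarrow> real) set"
  assumes sub: "fun_space.subspace V" and V: "V \<subseteq> polynomials_le M"
  obtains r e where "r \<le> (M + 1) ^ DIM('a)" "orthonormal_family r e" "\<And>i. i < r \<Longrightarrow> e i \<in> V"
    "\<And>p x. p \<in> V \<Longrightarrow> x \<in> sphere 0 1 \<Longrightarrow> p x = (\<Sum>i<r. sphere_inner p (e i) * e i x)"
proof -
  define P where "P r \<longleftrightarrow> (\<exists>e. orthonormal_family r e \<and> (\<forall>i<r. e i \<in> V))" for r
  have b: "r \<le> (M + 1) ^ DIM('a)" if Pr: "P r" for r
  proof -
    obtain e where e: "orthonormal_family r e" "\<forall>i<r. e i \<in> V" using Pr by (auto simp: P_def)
    show ?thesis by (rule orthonormal_family_card_le[OF e(1)]) (use e(2) V in blast)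
  qed
  have "P 0" by (simp add: P_def orthonormal_family_def)
  define r where "r = Greatest P"
  have r: "P r" "\<And>s. P s \<Longrightarrow> s \<le> r"
    unfolding r_def using GreatestI_nat[where P=P, OF \<open>P 0\<close> b] Greatest_le_nat[where P=P, OF _ b]
    by simp_all
  then obtain e where e: "orthonormal_family r e" "\<And>i. i < r \<Longrightarrow> e i \<in> V" by (auto simp: P_def)
  have poly: "real_polynomial_function p" if "p \<in> V" for p
    using V that polynomials_leD by blast
  have cont: "continuous_on (sphere 0 1) p" if "p \<in> V" for p
    using poly that continuous_on_rpf by blast
  have on: "sphere_inner (e i) (e j) = (if i = j then 1 else 0)" if "i < r" "j < r" for i j
    using e that by (auto simp: orthonormal_family_def)
  have exp: "\<And>p x. p \<in> V \<Longrightarrow> x \<in> sphere 0 1 \<Longrightarrow> p x = (\<Sum>i<r. sphere_inner p (e i) * e i x)"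
  proof -
    fix p and x :: 'a assume p: "p \<in> V" and x: "x \<in> sphere 0 1"
    define s where "s x = (\<Sum>i<r. sphere_inner p (e i) * e i x)" for x
    define q where "q x = p x - s x" for x
    have "s = (\<Sum>i<r. (\<lambda>x. sphere_inner p (e i) * e i x))"
      by (simp add: fun_eq_iff sum_fun_apply s_def)
    moreover have "(\<Sum>i<r. (\<lambda>x. sphere_inner p (e i) * e i x)) \<in> V"
      using e by (intro fun_space.subspace_sum[OF sub] fun_space.subspace_scale[OF sub]) auto
    ultimately have s: "s \<in> V" by simp
    then have q: "q \<in> V"
      using fun_space.subspace_diff[OF sub p s] by (simp add: q_def[abs_def] fun_diff_def)
    have orth: "sphere_inner q (e j) = 0" if j: "j < r" for j
    proof -
      have "sphere_inner s (e j) = (\<Sum>i<r. sphere_inner p (e i) * sphere_inner (e i) (e j))"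
        unfolding s_def[abs_def] using j e cont by (intro sphere_inner_sum_left) auto
      also have "\<dots> = (\<Sum>i<r. if i = j then sphere_inner p (e i) else 0)"
        using j by (intro sum.cong refl) (auto simp: on)
      also have "\<dots> = sphere_inner p (e j)" using j by simp
      finally show ?thesis
        using sphere_inner_diff_left[OF cont[OF p] cont[OF s] cont[OF e(2)[OF j]]]
        by (simp add: q_def[abs_def])
    qed
    have "sphere_inner q q = 0"
    proof (rule ccontr)
      \<comment> \<open>Otherwise the normalized residual would extend the maximal family.\<close>
      assume "sphere_inner q q \<noteq> 0"
      then have pos: "0 < sphere_inner q q" using sphere_inner_self_nonneg[of q] by linarith
      define c where "c = 1 / sqrt (sphere_inner q q)"
      have c: "c * (c * sphere_inner q q) = 1"
        using pos by (simp add: c_def power2_eq_square[symmetric] field_simps)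
      define e' where "e' i = (if i < r then e i else (\<lambda>x. c * q x))" for i
      have "(\<lambda>x. c * q x) \<in> V" using fun_space.subspace_scale[OF sub q] .
      then have V': "e' i \<in> V" for i by (simp add: e'_def e)
      have 1: "sphere_inner (\<lambda>x. c * q x) (e j) = 0" if "j < r" for j
        using orth that by (simp add: sphere_inner_cmult_left)
      have 2: "sphere_inner (\<lambda>x. c * q x) (\<lambda>x. c * q x) = 1"
        using c by (simp add: sphere_inner_cmult_left sphere_inner_commute[of q "\<lambda>x. c * q x"])
      have "orthonormal_family (Suc r) e'"
        unfolding orthonormal_family_def
      proof (intro conjI allI impI)
        show "real_polynomial_function (e' i)" for i by (rule poly[OF V'])
        show "sphere_inner (e' i) (e' j) = (if i = j then 1 else 0)" if "i < Suc r" "j < Suc r" for i j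
        proof (cases "i < r"; cases "j < r")
          assume "i < r" "\<not> j < r"
          then show ?thesis using 1[of i] that sphere_inner_commute[of "e i" "\<lambda>x. c * q x"]
            by (simp add: e'_def)
        qed (use that on 1 2 in \<open>auto simp: e'_def\<close>)
      qed
      then have "P (Suc r)" using V' by (auto simp: P_def)
      then show False using r(2) by fastforce
    qed
    from sphere_inner_self_0[OF cont[OF q] this x]
    show "p x = (\<Sum>i<r. sphere_inner p (e i) * e i x)" by (simp add: q_def s_def)
  qed
  show ?thesis by (rule that[OF b[OF r(1)] e(1)]) (fact e(2), fact exp)
qed

lemma parseval:
  fixes e :: "nat \<Rightarrow> 'a::euclidean_space \<Rightarrow> real"
  assumes e: "orthonormal_family r e"
    and p: "\<And>x. x \<in> sphere 0 1 \<Longrightarrow> p x = (\<Sum>i<r. c i * e i x)"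
  shows "sphere_inner p p = (\<Sum>i<r. (c i)\<^sup>2)"
proof -
  have cont: "continuous_on (sphere 0 1) (e i)" if "i < r" for i
    using e that by (auto simp: orthonormal_family_def intro: continuous_on_rpf)
  let ?s = "\<lambda>x. \<Sum>i<r. c i * e i x"
  have "sphere_inner p p = sphere_inner ?s ?s"
    unfolding sphere_inner_def using p by (intro Bochner_Integration.integral_cong) auto
  also have "\<dots> = (\<Sum>i<r. c i * sphere_inner (e i) ?s)"
    using cont by (intro sphere_inner_sum_left continuous_intros) auto
  also have "\<dots> = (\<Sum>i<r. c i * (\<Sum>j<r. c j * sphere_inner (e j) (e i)))"
    using cont
    by (intro sum.cong refl, subst sphere_inner_commute, subst sphere_inner_sum_left) auto
  also have "\<dots> = (\<Sum>i<r. c i * (\<Sum>j<r. if j = i then c j else 0))"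
    using e by (intro sum.cong refl arg_cong2[of _ _ _ _ "(*)"]) (auto simp: orthonormal_family_def)
  also have "\<dots> = (\<Sum>i<r. (c i)\<^sup>2)"
    by (intro sum.cong refl) (simp add: power2_eq_square)
  finally show ?thesis .
qed

text \<open>Let \<open>s x\<close> be the diagonal of the reproducing kernel of the space of polynomials of degree at most
  \<open>M\<close>; it is the best constant in \<open>(p x)\<^sup>2 \<le> s x * sphere_inner p p\<close>. The space is invariant under
  orthogonal transformations, which act transitively on the sphere, so \<open>s\<close> is constant; and the
  integral of \<open>s\<close> is the dimension of the space, which grows only polynomially in \<open>M\<close>.\<close>

lemma nikolskii_L2:
  fixes p :: "'a::euclidean_space \<Rightarrow> real"
  assumes p: "p \<in> polynomials_le M" and x: "x \<in> sphere 0 1"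
  shows "(p x)\<^sup>2 * measure (surface_measure :: 'a measure) (sphere 0 1) \<le>
    real ((M + 1) ^ DIM('a)) * sphere_inner p p"
proof -
  obtain r e where r: "r \<le> (M + 1) ^ DIM('a)" and e: "orthonormal_family r e"
    and eV: "\<And>i. i < r \<Longrightarrow> e i \<in> polynomials_le M"
    and exp: "\<And>p (x::'a). p \<in> polynomials_le M \<Longrightarrow> x \<in> sphere 0 1 \<Longrightarrow> p x = (\<Sum>i<r. sphere_inner p (e i) * e i x)"
    using exists_orthonormal_basis[OF subspace_polynomials_le order.refl, of M] by blast
  have cont: "continuous_on (sphere 0 1) (e i)" if "i < r" for i
    using eV that polynomials_leD continuous_on_rpf by blast
  define s where "s x = (\<Sum>i<r. (e i x)\<^sup>2)" for x
  have s0: "0 \<le> s x" for x by (simp add: s_def sum_nonneg)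
  have cs: "(p x)\<^sup>2 \<le> s x * sphere_inner p p" if "p \<in> polynomials_le M" "x \<in> sphere 0 1" for p x
  proof -
    have "(p x)\<^sup>2 = (\<Sum>i<r. sphere_inner p (e i) * e i x)\<^sup>2" using exp[OF that] by simp
    also have "\<dots> \<le> (\<Sum>i<r. (sphere_inner p (e i))\<^sup>2) * s x"
      unfolding s_def by (rule Cauchy_Schwarz_ineq_sum)
    also have "(\<Sum>i<r. (sphere_inner p (e i))\<^sup>2) = sphere_inner p p"
      by (rule parseval[OF e exp[OF that(1)], symmetric])
    finally show ?thesis by (simp add: mult.commute)
  qed
  have mono: "s z \<le> s y" if z: "z \<in> sphere 0 1" and y: "y \<in> sphere 0 1" for y z
  proof -
    obtain T where T: "orthogonal_transformation T" "T y = z"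
      using orthogonal_transformation_transitive[of y z] y z by auto
    \<comment> \<open>The reproducing kernel at \<open>z\<close> is extremal there; its rotation is a competitor at \<open>y\<close>.\<close>
    define k where "k u = (\<Sum>i<r. e i z * e i u)" for u
    have k: "k \<in> polynomials_le M"
      unfolding k_def[abs_def] using eV by (intro polynomials_le_sum polynomials_le_cmult) auto
    have kk: "sphere_inner k k = s z"
      unfolding s_def by (rule parseval[OF e]) (simp add: k_def)
    have "(\<lambda>u. k (T u)) \<in> polynomials_le M"
      using polynomials_le_compose[OF k] T orthogonal_transformation_linear by blast
    from cs[OF this y] have "(k z)\<^sup>2 \<le> s y * sphere_inner (\<lambda>u. k (T u)) (\<lambda>u. k (T u))"
      by (simp add: T)
    also have "sphere_inner (\<lambda>u. k (T u)) (\<lambda>u. k (T u)) = sphere_inner k k"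
      unfolding sphere_inner_def
      by (rule integral_surface_measure_orthogonal[OF T(1)])
        (intro continuous_on_mult continuous_on_rpf polynomials_leD[OF k])
    also have "k z = s z" by (simp add: k_def s_def power2_eq_square)
    finally have "s z * s z \<le> s y * s z" by (simp add: kk power2_eq_square)
    then show ?thesis using s0[of z] s0[of y] mult_right_le_imp_le[of "s z" "s z" "s y"] by fastforce
  qed
  have si: "integrable surface_measure s"
    unfolding s_def[abs_def] using cont by (intro integrable_surface_measure continuous_intros) auto
  have "s x * measure (surface_measure :: 'a measure) (sphere 0 1) =
      surface_integral (\<lambda>y::'a. s x)" by simp
  also have "\<dots> \<le> surface_integral s"
    using mono[OF x] by (intro integral_mono si) auto
  also have "\<dots> = (\<Sum>i<r. sphere_inner (e i) (e i))"
    unfolding s_def[abs_def] sphere_inner_def power2_eq_square using cont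
    by (intro Bochner_Integration.integral_sum integrable_surface_measure continuous_intros) auto
  also have "\<dots> = real r" using e by (simp add: orthonormal_family_def)
  finally have 1: "s x * measure (surface_measure :: 'a measure) (sphere 0 1) \<le> real r" .
  have "(p x)\<^sup>2 * measure (surface_measure :: 'a measure) (sphere 0 1) \<le>
      s x * sphere_inner p p * measure (surface_measure :: 'a measure) (sphere 0 1)"
    using cs[OF p x] by (rule mult_right_mono) simp
  also have "\<dots> = s x * measure (surface_measure :: 'a measure) (sphere 0 1) * sphere_inner p p"
    by (simp only: mult.assoc mult.commute[of "sphere_inner p p"])
  also have "\<dots> \<le> real r * sphere_inner p p"
    using 1 by (rule mult_right_mono) (rule sphere_inner_self_nonneg)
  also have "\<dots> \<le> real ((M + 1) ^ DIM('a)) * sphere_inner p p"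
    using r by (intro mult_right_mono sphere_inner_self_nonneg) (simp only: of_nat_le_iff)
  finally show ?thesis .
qed

section \<open>Decomposition into spherical harmonics\<close>

lemma harmonicI:
  "p \<in> homogeneous k \<Longrightarrow> (\<And>x. laplacian p x = 0) \<Longrightarrow> p \<in> harmonics k"
  by (simp add: harmonic_homogeneous_polynomials_def homogeneous_def)

lemma subspace_harmonic: "fun_space.subspace (harmonics k)"
proof (rule fun_space.subspaceI)
  have "laplacian (\<lambda>x::'a. 0 * 0) x = 0 * laplacian (\<lambda>x. 0) x" for x
    by (rule laplacian_cmult) (rule real_polynomial_function.intros)
  then show "(0 :: 'a \<Rightarrow> real) \<in> harmonics k"
    by (auto intro!: harmonicI homogeneousI real_polynomial_function.intros(2)
        simp: zero_fun_def)
next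
  fix p q :: "'a \<Rightarrow> real"
  assume "p \<in> harmonics k" "q \<in> harmonics k"
  note p = harmonicD[OF this(1)] and q = harmonicD[OF this(2)]
  show "p + q \<in> harmonics k"
    unfolding plus_fun_def
    by (intro harmonicI homogeneous_add p q) (simp add: laplacian_add p q)
next
  fix c and p :: "'a \<Rightarrow> real"
  assume "p \<in> harmonics k"
  note p = harmonicD[OF this(1)]
  show "(\<lambda>x. c * p x) \<in> harmonics k"
    by (intro harmonicI homogeneous_cmult p) (simp add: laplacian_cmult p)
qed

lemma harmonic_cmult:
  "p \<in> harmonics k \<Longrightarrow> (\<lambda>x. c * p x) \<in> harmonics k"
  by (rule fun_space.subspace_scale[OF subspace_harmonic])

lemma harmonic_zero: "(\<lambda>x. 0) \<in> harmonics k"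
  using fun_space.subspace_0[OF subspace_harmonic] by (simp add: zero_fun_def)

lemma harmonic_sum:
  assumes "\<And>i. i \<in> I \<Longrightarrow> p i \<in> harmonics k"
  shows "(\<lambda>x. \<Sum>i\<in>I. p i x) \<in> harmonics k"
proof -
  have "(\<lambda>x. \<Sum>i\<in>I. p i x) = (\<Sum>i\<in>I. p i)" by (simp add: fun_eq_iff sum_fun_apply)
  then show ?thesis using fun_space.subspace_sum[OF subspace_harmonic] assms by metis
qed

lemma harmonic_le_polynomials_le: "harmonics k \<subseteq> polynomials_le k"
  using homogeneous_polynomials_le[OF _ order.refl] harmonicD(1) by blast

lemma continuous_on_harmonic: "p \<in> harmonics k \<Longrightarrow> continuous_on S p"
  by (rule continuous_on_rpf[OF harmonicD(3)])

text \<open>The Laplacian lowers the power of the squared norm by one and contributes a positive factor. It can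
  therefore be inverted on sums of such products.\<close>

lemma laplacian_norm_power_harmonic:
  fixes h :: "'a::euclidean_space \<Rightarrow> real"
  assumes h: "h \<in> harmonics m"
  obtains c where "0 < c" "\<And>x. laplacian (\<lambda>x. (x \<bullet> x) ^ Suc j * h x) x = c * ((x \<bullet> x) ^ j * h x)"
proof -
  have hom: "(\<lambda>x. (x \<bullet> x) ^ j * h x) \<in> homogeneous (2 * j + m)" for j
    using homogeneous_mult[OF homogeneous_power[OF homogeneous_inner_self] harmonicD(1)[OF h]] .
  have "\<exists>c>0. \<forall>x. laplacian (\<lambda>x. (x \<bullet> x) ^ Suc j * h x) x = c * ((x \<bullet> x) ^ j * h x)" for j
  proof (induction j)
    case 0
    show ?case
      using laplacian_norm_sq_mult[OF harmonicD(1)[OF h]] harmonicD(2)[OF h]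
      by (intro exI[of _ "4 * real m + 2 * DIM('a)"]) (simp add: add_nonneg_pos)
  next
    case (Suc j)
    then obtain c where c: "0 < c"
      "\<And>x. laplacian (\<lambda>x. (x \<bullet> x) ^ Suc j * h x) x = c * ((x \<bullet> x) ^ j * h x)" by blast
    define C where "C = c + (4 * real (2 * Suc j + m) + 2 * DIM('a))"
    have "laplacian (\<lambda>x. (x \<bullet> x) ^ Suc (Suc j) * h x) x = C * ((x \<bullet> x) ^ Suc j * h x)" for x
    proof -
      have "(\<lambda>x. (x \<bullet> x) ^ Suc (Suc j) * h x) = (\<lambda>x. (x \<bullet> x) * ((x \<bullet> x) ^ Suc j * h x))"
        by (simp add: mult.assoc)
      then show ?thesis
        unfolding C_def
        by (simp only: laplacian_norm_sq_mult[OF hom[of "Suc j"]] c(2)) (simp add: algebra_simps)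
    qed
    moreover have "0 < C" using c(1) by (simp add: C_def add_pos_nonneg)
    ultimately show ?case by blast
  qed
  then show ?thesis using that by blast
qed

text \<open>Induction on the degree in steps of two. The decomposition of \<open>laplacian p\<close> yields a polynomial
  \<open>g\<close>, divisible by \<open>x \<bullet> x\<close>, with the same Laplacian as \<open>p\<close>, and \<open>p - g\<close> is the harmonic term of top
  degree. The parity condition makes the exponents \<open>(n - k) div 2\<close> exact, so that all terms are
  homogeneous of degree \<open>n\<close>.\<close>

lemma harmonic_decomposition:
  fixes p :: "'a::euclidean_space \<Rightarrow> real"
  assumes "p \<in> homogeneous n"
  shows "\<exists>h. (\<forall>k. h k \<in> harmonics k) \<and>
    (\<forall>k\<le>n. odd (n - k) \<longrightarrow> h k = (\<lambda>x. 0)) \<and>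
    (\<forall>x. p x = (\<Sum>k\<le>n. (x \<bullet> x) ^ ((n - k) div 2) * h k x))"
  using assms
proof (induction n arbitrary: p rule: less_induct)
  case (less n)
  show ?case
  proof (cases "n < 2")
    case True
    have p: "p \<in> harmonics n"
      by (intro harmonicI less.prems laplacian_homogeneous_low[OF less.prems True])
    define h where "h k = (if k = n then p else (\<lambda>x. 0))" for k
    have "p x = (\<Sum>k\<le>n. (x \<bullet> x) ^ ((n - k) div 2) * h k x)" for x
    proof -
      have "(\<Sum>k\<le>n. (x \<bullet> x) ^ ((n - k) div 2) * h k x) = (\<Sum>k\<le>n. if k = n then p x else 0)"
        by (intro sum.cong refl) (simp add: h_def)
      then show ?thesis by simp
    qed
    then show ?thesis
      using p by (intro exI[of _ h]) (auto simp: h_def harmonic_zero)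
  next
    case False
    then obtain m where n: "n = Suc (Suc m)" using le_Suc_ex[of 2 n] by auto
    have Lp: "laplacian p \<in> homogeneous m"
      by (rule laplacian_homogeneous) (use less.prems n in simp)
    have "\<exists>h. (\<forall>k. h k \<in> harmonics k) \<and>
        (\<forall>k\<le>m. odd (m - k) \<longrightarrow> h k = (\<lambda>x. 0)) \<and>
        (\<forall>x. laplacian p x = (\<Sum>k\<le>m. (x \<bullet> x) ^ ((m - k) div 2) * h k x))"
      by (rule less.IH[OF _ Lp]) (simp add: n)
    then obtain h where h: "\<And>k. h k \<in> harmonics k"
      "\<And>k. k \<le> m \<Longrightarrow> odd (m - k) \<Longrightarrow> h k = (\<lambda>x. 0)"
      "\<And>x. laplacian p x = (\<Sum>k\<le>m. (x \<bullet> x) ^ ((m - k) div 2) * h k x)"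
      by blast
    have "\<exists>c>0. \<forall>x. laplacian (\<lambda>x. (x \<bullet> x) ^ Suc ((m - k) div 2) * h k x) x =
        c * ((x \<bullet> x) ^ ((m - k) div 2) * h k x)" for k
      by (rule laplacian_norm_power_harmonic[OF h(1)[of k], of "(m - k) div 2"]) blast
    then obtain c where "\<forall>k. 0 < c k \<and> (\<forall>x.
        laplacian (\<lambda>x. (x \<bullet> x) ^ Suc ((m - k) div 2) * h k x) x =
        c k * ((x \<bullet> x) ^ ((m - k) div 2) * h k x))"
      by (rule choice[OF allI, THEN exE])
    then have c: "\<And>k. 0 < c k"
      "\<And>k x. laplacian (\<lambda>x. (x \<bullet> x) ^ Suc ((m - k) div 2) * h k x) x =
        c k * ((x \<bullet> x) ^ ((m - k) div 2) * h k x)" by blast+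
    \<comment> \<open>Inverts the Laplacian on each term of the decomposition of \<open>laplacian p\<close>.\<close>
    define g where "g k x = (1 / c k) * ((x \<bullet> x) ^ Suc ((m - k) div 2) * h k x)" for k x
    have N: "(\<lambda>x. (x \<bullet> x) ^ Suc ((m - k) div 2) * h k x) \<in> homogeneous n" if "k \<le> m" for k
    proof (cases "odd (m - k)")
      case True
      then show ?thesis
        using h(2)[OF that] by (auto intro!: homogeneousI real_polynomial_function.intros(2))
    next
      case False
      then have "2 * Suc ((m - k) div 2) + k = n" using that n by auto
      then show ?thesis
        using homogeneous_mult[OF homogeneous_power[OF homogeneous_inner_self, of "Suc ((m - k) div 2)"]
            harmonicD(1)[OF h(1)[of k]]] by simp
    qed
    have ghom: "g k \<in> homogeneous n" if "k \<le> m" for k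
      unfolding g_def[abs_def] by (rule homogeneous_cmult[OF N[OF that]])
    define G where "G x = (\<Sum>k\<le>m. g k x)" for x
    have Ghom: "G \<in> homogeneous n"
      unfolding G_def[abs_def] using ghom by (intro homogeneous_sum) auto
    have "laplacian (g k) x = (x \<bullet> x) ^ ((m - k) div 2) * h k x" if "k \<le> m" for k x
      unfolding g_def[abs_def] laplacian_cmult[OF homogeneousD(1)[OF N[OF that]]] c(2)
      using c(1)[of k] by simp
    then have LG: "laplacian G x = laplacian p x" for x
      unfolding G_def[abs_def] h(3)
      by (subst laplacian_sum) (auto intro!: sum.cong homogeneousD(1)[OF ghom])
    define f where "f x = p x + (-1) * G x" for x
    have fhom: "f \<in> homogeneous n"
      unfolding f_def[abs_def] by (intro homogeneous_add less.prems homogeneous_cmult Ghom)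
    have "laplacian f x = 0" for x
      unfolding f_def[abs_def]
      by (subst laplacian_add, rule homogeneousD(1)[OF less.prems],
          rule homogeneousD(1)[OF homogeneous_cmult[OF Ghom]],
          subst laplacian_cmult, rule homogeneousD(1)[OF Ghom]) (simp add: LG)
    then have f: "f \<in> harmonics n" by (rule harmonicI[OF fhom])
    define H where "H k = (if k \<le> m then (\<lambda>x. (1 / c k) * h k x) else if k = n then f else (\<lambda>x. 0))" for k
    have "H k \<in> harmonics k" for k
      by (cases "k \<le> m"; cases "k = n")
        (simp_all only: H_def simp_thms if_True if_False f h(1) harmonic_zero harmonic_cmult)
    moreover have "H k = (\<lambda>x. 0)" if "k \<le> n" "odd (n - k)" for k
    proof (cases "k \<le> m")
      case True
      then have "odd (m - k)" using that n by (simp add: Suc_diff_le)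
      then show ?thesis using h(2) True by (simp add: H_def)
    next
      case False
      then have "k = Suc m" using that n by (cases "k = n") auto
      then show ?thesis by (simp add: H_def n)
    qed
    moreover have "p x = (\<Sum>k\<le>n. (x \<bullet> x) ^ ((n - k) div 2) * H k x)" for x
    proof -
      have "(\<Sum>k\<le>n. (x \<bullet> x) ^ ((n - k) div 2) * H k x) =
          (\<Sum>k\<le>m. (x \<bullet> x) ^ ((n - k) div 2) * H k x) + f x"
        by (simp add: n H_def)
      also have "(\<Sum>k\<le>m. (x \<bullet> x) ^ ((n - k) div 2) * H k x) = G x"
        unfolding G_def
      proof (intro sum.cong refl)
        fix k assume "k \<in> {..m}"
        then have "(n - k) div 2 = Suc ((m - k) div 2)" "k \<le> m" by (auto simp: n Suc_diff_le)
        then show "(x \<bullet> x) ^ ((n - k) div 2) * H k x = g k x" by (simp add: H_def g_def)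
      qed
      finally show ?thesis by (simp add: f_def)
    qed
    ultimately show ?thesis by (intro exI[of _ H]) simp
  qed
qed

lemma harmonic_decomposition_sphere:
  fixes p :: "'a::euclidean_space \<Rightarrow> real"
  assumes "p \<in> homogeneous n"
  obtains h where "\<And>k. h k \<in> harmonics k"
    "\<And>x. x \<in> sphere 0 1 \<Longrightarrow> p x = (\<Sum>k\<le>n. h k x)"
proof -
  obtain h where h: "\<And>k. h k \<in> harmonics k"
    "\<And>x. p x = (\<Sum>k\<le>n. (x \<bullet> x) ^ ((n - k) div 2) * h k x)"
    using harmonic_decomposition[OF assms] by blast
  have "p x = (\<Sum>k\<le>n. h k x)" if "x \<in> sphere 0 1" for x
  proof -
    have "x \<bullet> x = 1" using that by (simp add: dot_square_norm)
    then show ?thesis using h(2)[of x] by simp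
  qed
  then show ?thesis using that h(1) by blast
qed

section \<open>Reproducing kernels of the spherical harmonics\<close>

text \<open>A finite family with \<open>p = (\<Sum>e. sphere_inner p e * e)\<close> on the sphere for all harmonics \<open>p\<close> of degree
  \<open>k\<close>, that is, a Parseval frame. Fixing one choice lets the reproducing kernels and the random
  components of the process refer to the same functions.\<close>

definition harmonic_frame :: "nat \<Rightarrow> ('a::euclidean_space \<Rightarrow> real) set" where
  "harmonic_frame k = (SOME E. finite E \<and> E \<subseteq> harmonics k \<and>
     (\<forall>p\<in>harmonics k. \<forall>x\<in>sphere 0 1.
        p x = (\<Sum>e\<in>E. sphere_inner p e * e x)))"

lemma harmonic_frame:
  shows finite_harmonic_frame: "finite (harmonic_frame k :: ('a::euclidean_space \<Rightarrow> real) set)"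
    and harmonic_frame_subset: "(harmonic_frame k :: ('a \<Rightarrow> real) set) \<subseteq> harmonics k"
    and harmonic_frame_expand: "p \<in> harmonics k \<Longrightarrow> x \<in> sphere 0 1 \<Longrightarrow>
      p (x::'a) = (\<Sum>e\<in>harmonic_frame k. sphere_inner p e * e x)"
proof -
  obtain r e where e: "orthonormal_family r e" "\<And>i. i < r \<Longrightarrow> e i \<in> harmonics k"
    and exp: "\<And>p (x::'a). p \<in> harmonics k \<Longrightarrow> x \<in> sphere 0 1 \<Longrightarrow>
      p x = (\<Sum>i<r. sphere_inner p (e i) * e i x)"
    by (rule exists_orthonormal_basis[OF subspace_harmonic[of k] harmonic_le_polynomials_le]) (rule that)
  have inj: "inj_on e {..<r}"
  proof (rule inj_onI)
    fix i j assume ij: "i \<in> {..<r}" "j \<in> {..<r}" "e i = e j"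
    have "sphere_inner (e i) (e i) = 1" "sphere_inner (e i) (e j) = (if i = j then 1 else 0)"
      using e(1) ij(1,2) by (simp_all add: orthonormal_family_def)
    then show "i = j" using ij(3) by (simp split: if_splits)
  qed
  have "\<exists>E. finite E \<and> E \<subseteq> harmonics k \<and>
     (\<forall>p\<in>harmonics k. \<forall>x\<in>sphere 0 1.
        p (x::'a) = (\<Sum>e\<in>E. sphere_inner p e * e x))"
    using e(2) exp by (intro exI[of _ "e ` {..<r}"]) (auto simp: sum.reindex[OF inj])
  note E = someI_ex[OF this, folded harmonic_frame_def]
  show "finite (harmonic_frame k :: ('a \<Rightarrow> real) set)" "(harmonic_frame k :: ('a \<Rightarrow> real) set) \<subseteq> harmonics k"
    "p \<in> harmonics k \<Longrightarrow> x \<in> sphere 0 1 \<Longrightarrow>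
      p (x::'a) = (\<Sum>e\<in>harmonic_frame k. sphere_inner p e * e x)"
    using E by simp_all
qed

text \<open>The reproducing kernel of the spherical harmonics of degree \<open>k\<close>.\<close>

definition zonal :: "nat \<Rightarrow> 'a::euclidean_space \<Rightarrow> 'a \<Rightarrow> real" where
  "zonal k x y = (\<Sum>e\<in>harmonic_frame k. e x * e y)"

lemma zonal_harmonic: "zonal k x \<in> harmonics k"
  unfolding zonal_def[abs_def] using harmonic_frame_subset by (intro harmonic_sum harmonic_cmult) auto

lemma zonal_reproducing:
  assumes "p \<in> harmonics k" "x \<in> sphere 0 1"
  shows "sphere_inner p (zonal k x) = p x"
proof -
  have "sphere_inner p (zonal k x) = (\<Sum>e\<in>harmonic_frame k. e x * sphere_inner e p)"
    unfolding zonal_def[abs_def]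
    by (subst sphere_inner_commute, rule sphere_inner_sum_left)
      (use harmonic_frame_subset continuous_on_harmonic assms(1) in blast)+
  then show ?thesis
    by (simp add: harmonic_frame_expand[OF assms] mult.commute sphere_inner_commute[of p])
qed

lemma harmonic_orthogonal_inner:
  fixes p q :: "'a::euclidean_space \<Rightarrow> real"
  assumes "2 \<le> DIM('a)" "k \<noteq> l"
    and "p \<in> harmonics k" "q \<in> harmonics l"
  shows "sphere_inner p q = 0"
  using harmonic_orthogonal[OF assms] by (simp add: sphere_inner_def)

section \<open>The powers of the inner product\<close>

lemma inner_power_homogeneous: "(\<lambda>y. (x \<bullet> y) ^ n) \<in> homogeneous n"
  using homogeneous_power[OF homogeneous_inner[of x], of n] by (simp add: inner_commute)

text \<open>Multiplying out the power of the coordinate expansion of \<open>x \<bullet> y\<close> gives one summand for each word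
  of length \<open>n\<close> in the basis vectors, which is why the index set consists of lists.\<close>

lemma inner_power_tensor:
  "\<exists>(I :: 'a::euclidean_space list set) (m :: 'a list \<Rightarrow> 'a \<Rightarrow> real). finite I \<and> (\<forall>i\<in>I. m i \<in> homogeneous n) \<and>
     (\<forall>x y. (x \<bullet> y) ^ n = (\<Sum>i\<in>I. m i x * m i y))"
proof (induction n)
  case 0
  show ?case
    by (intro exI[of _ "{[]}"] exI[of _ "\<lambda>_ _. 1"])
      (auto intro!: homogeneousI real_polynomial_function.intros(2))
next
  case (Suc n)
  then obtain I :: "'a list set" and m :: "'a list \<Rightarrow> 'a \<Rightarrow> real" where I: "finite I"
    "\<And>i. i \<in> I \<Longrightarrow> m i \<in> homogeneous n"
    "\<And>x y. (x \<bullet> y) ^ n = (\<Sum>i\<in>I. m i x * m i y)" by blast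
  define J where "J = (\<lambda>(b, i). b # i) ` (Basis \<times> I)"
  define M :: "'a list \<Rightarrow> 'a \<Rightarrow> real" where "M i x = (x \<bullet> hd i) * m (tl i) x" for i x
  have "M i \<in> homogeneous (Suc n)" if "i \<in> J" for i
    using homogeneous_mult[OF homogeneous_inner I(2), of "tl i" "hd i"] that
    by (auto simp: J_def M_def[abs_def])
  moreover have "(x \<bullet> y) ^ Suc n = (\<Sum>i\<in>J. M i x * M i y)" for x y
  proof -
    have "inj_on (\<lambda>(b, i). b # i) (Basis \<times> I)" by (auto simp: inj_on_def)
    then have "(\<Sum>i\<in>J. M i x * M i y) =
        (\<Sum>(b, i)\<in>Basis \<times> I. ((x \<bullet> b) * (y \<bullet> b)) * (m i x * m i y))"
      unfolding J_def by (subst sum.reindex) (auto simp: M_def intro!: sum.cong)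
    also have "\<dots> = (\<Sum>b\<in>Basis. (x \<bullet> b) * (y \<bullet> b)) * (\<Sum>i\<in>I. m i x * m i y)"
      by (simp only: sum_product sum.cartesian_product)
    also have "\<dots> = (x \<bullet> y) * (x \<bullet> y) ^ n" 
      by (simp only: I(3)[symmetric] euclidean_inner[of x y, symmetric])
    finally show ?thesis by simp
  qed
  moreover have "finite J" using I(1) by (simp add: J_def)
  ultimately show ?case by blast
qed

text \<open>The integral operator with kernel \<open>(x \<bullet> y) ^ n\<close>.\<close>

definition power_convolution :: "nat \<Rightarrow> ('a::euclidean_space \<Rightarrow> real) \<Rightarrow> 'a \<Rightarrow> real" where
  "power_convolution n h x = sphere_inner (\<lambda>y. (x \<bullet> y) ^ n) h"

lemma power_convolution_expand:
  fixes m :: "'i \<Rightarrow> 'a::euclidean_space \<Rightarrow> real"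
  assumes "\<And>i. i \<in> I \<Longrightarrow> m i \<in> homogeneous n"
    and "\<And>x y. (x \<bullet> y) ^ n = (\<Sum>i\<in>I. m i x * m i y)"
    and h: "continuous_on (sphere 0 1) h"
  shows "power_convolution n h x = (\<Sum>i\<in>I. m i x * sphere_inner (m i) h)"
  unfolding power_convolution_def assms(2)
  by (rule sphere_inner_sum_left[OF continuous_on_rpf[OF homogeneousD(1)[OF assms(1)]] h])

lemma power_convolution_homogeneous:
  assumes h: "continuous_on (sphere 0 1) h"
  shows "power_convolution n h \<in> homogeneous n"
proof -
  obtain I :: "'a list set" and m :: "'a list \<Rightarrow> 'a \<Rightarrow> real" where I: "finite I"
    "\<And>i. i \<in> I \<Longrightarrow> m i \<in> homogeneous n"
    "\<And>x y. (x \<bullet> y) ^ n = (\<Sum>i\<in>I. m i x * m i y)"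
    using inner_power_tensor[where 'a='a and n=n] by blast
  have "power_convolution n h = (\<lambda>x. \<Sum>i\<in>I. sphere_inner (m i) h * m i x)"
    using power_convolution_expand[OF I(2,3) h] by (simp add: fun_eq_iff mult.commute)
  then show ?thesis using I(1,2) by (auto intro!: homogeneous_sum homogeneous_cmult)
qed

lemma power_convolution_form:
  fixes g h :: "'a::euclidean_space \<Rightarrow> real"
  assumes g: "continuous_on (sphere 0 1) g" and h: "continuous_on (sphere 0 1) h"
  shows "sphere_inner (power_convolution n g) h = sphere_inner (power_convolution n h) g"
    and "0 \<le> sphere_inner (power_convolution n g) g"
proof -
  obtain I :: "'a list set" and m :: "'a list \<Rightarrow> 'a \<Rightarrow> real" where I: "finite I"
    "\<And>i. i \<in> I \<Longrightarrow> m i \<in> homogeneous n"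
    "\<And>x y. (x \<bullet> y) ^ n = (\<Sum>i\<in>I. m i x * m i y)"
    using inner_power_tensor[where 'a='a and n=n] by blast
  have *: "sphere_inner (power_convolution n g) h = (\<Sum>i\<in>I. sphere_inner (m i) g * sphere_inner (m i) h)"
    if g: "continuous_on (sphere 0 1) g" and h: "continuous_on (sphere 0 1) h" for g h
  proof -
    have "power_convolution n g = (\<lambda>x. \<Sum>i\<in>I. sphere_inner (m i) g * m i x)"
      using power_convolution_expand[OF I(2,3) g] by (simp add: fun_eq_iff mult.commute)
    then show ?thesis
      using sphere_inner_sum_left[OF continuous_on_rpf[OF homogeneousD(1)[OF I(2)]] h]
      by simp
  qed
  show "sphere_inner (power_convolution n g) h = sphere_inner (power_convolution n h) g"
    by (simp add: *[OF g h] *[OF h g] mult.commute)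
  show "0 \<le> sphere_inner (power_convolution n g) g"
    by (simp add: *[OF g g] sum_nonneg)
qed

lemma laplacian_inner_power:
  fixes x :: "'a::euclidean_space"
  shows "laplacian (\<lambda>y. (x \<bullet> y) ^ n) y = real n * (real n - 1) * (x \<bullet> x) * (x \<bullet> y) ^ (n - 2)"
proof -
  have rp: "real_polynomial_function (\<lambda>y. (x \<bullet> y) ^ n)" for n
    by (rule homogeneousD(1)[OF inner_power_homogeneous])
  have d: "dir_deriv b (\<lambda>y. (x \<bullet> y) ^ n) y = real n * (x \<bullet> b) * (x \<bullet> y) ^ (n - 1)" for n b y
    by (rule dir_deriv_eq) (auto intro!: derivative_eq_intros)
  have "dir_deriv b (dir_deriv b (\<lambda>y. (x \<bullet> y) ^ n)) y =
      real n * (real n - 1) * (x \<bullet> y) ^ (n - 2) * ((x \<bullet> b) * (x \<bullet> b))" for b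
  proof -
    have "dir_deriv b (\<lambda>y. (x \<bullet> y) ^ n) = (\<lambda>y. real n * (x \<bullet> b) * (x \<bullet> y) ^ (n - 1))"
      by (rule ext) (rule d)
    then have "dir_deriv b (dir_deriv b (\<lambda>y. (x \<bullet> y) ^ n)) y = real n * (x \<bullet> b) * dir_deriv b (\<lambda>y. (x \<bullet> y) ^ (n - 1)) y"
      by (simp only: dir_deriv_cmult[OF rp])
    also have "\<dots> = real n * (real n - 1) * (x \<bullet> y) ^ (n - 2) * ((x \<bullet> b) * (x \<bullet> b))"
    proof (cases "n = 0")
      case False
      then have "real (n - 1) = real n - 1" "n - 1 - 1 = n - 2" by auto
      then show ?thesis unfolding d by (simp only: mult_ac)
    qed simp
    finally show ?thesis .
  qed
  then have "laplacian (\<lambda>y. (x \<bullet> y) ^ n) y =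
      (\<Sum>b\<in>Basis. real n * (real n - 1) * (x \<bullet> y) ^ (n - 2) * ((x \<bullet> b) * (x \<bullet> b)))"
    by (simp only: laplacian_eq[OF rp])
  also have "\<dots> = real n * (real n - 1) * (x \<bullet> y) ^ (n - 2) * (x \<bullet> x)"
    by (simp only: sum_distrib_left[symmetric] euclidean_inner[of x x])
  finally show ?thesis by (simp only: mult_ac)
qed

text \<open>Green's identity between \<open>(x \<bullet> y) ^ n\<close>, as a function of \<open>y\<close>, and \<open>p\<close>: the Laplacian of the power
  is \<open>n * (n - 1) * (x \<bullet> y) ^ (n - 2)\<close> for unit \<open>x\<close>. For \<open>n < 2\<close> the truncated exponent is harmless,
  because its coefficient vanishes.\<close>

lemma power_convolution_eigen:
  fixes p :: "'a::euclidean_space \<Rightarrow> real"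
  assumes p: "p \<in> harmonics k" and x: "x \<in> sphere 0 1"
  shows "lb_eigenvalue DIM('a) k * power_convolution n p x =
    lb_eigenvalue DIM('a) n * power_convolution n p x
    - real n * (real n - 1) * power_convolution (n - 2) p x"
proof -
  have xx: "x \<bullet> x = 1" using x by (simp add: dot_square_norm)
  have int: "integrable surface_measure (\<lambda>y. (x \<bullet> y) ^ n * p y)" for n
    by (intro integrable_surface_measure continuous_intros continuous_on_harmonic[OF p])
  have "surface_integral (\<lambda>y. (lb_eigenvalue DIM('a) n * (x \<bullet> y) ^ n
        - laplacian (\<lambda>y. (x \<bullet> y) ^ n) y) * p y) =
      surface_integral (\<lambda>y. lb_eigenvalue DIM('a) n * ((x \<bullet> y) ^ n * p y)
        - real n * (real n - 1) * ((x \<bullet> y) ^ (n - 2) * p y))"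
    by (simp add: laplacian_inner_power xx left_diff_distrib mult.assoc)
  also have "\<dots> = lb_eigenvalue DIM('a) n * power_convolution n p x
      - real n * (real n - 1) * power_convolution (n - 2) p x"
    using int by (simp add: power_convolution_def sphere_inner_def)
  finally have 1: "surface_integral (\<lambda>y. (lb_eigenvalue DIM('a) n * (x \<bullet> y) ^ n
        - laplacian (\<lambda>y. (x \<bullet> y) ^ n) y) * p y) = \<dots>" .
  have "surface_integral (\<lambda>y. (x \<bullet> y) ^ n * (lb_eigenvalue DIM('a) k * p y - laplacian p y)) =
      lb_eigenvalue DIM('a) k * power_convolution n p x"
    unfolding harmonicD(2)[OF p]
    by (simp add: power_convolution_def sphere_inner_def mult.left_commute[of "(x \<bullet> _) ^ n"])
  then show ?thesis
    using green_symmetric[OF inner_power_homogeneous[of x n] harmonicD(1)[OF p]] 1 by simp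
qed

text \<open>The bilinear form is symmetric, so the relation \<open>power_convolution_eigen\<close> can be used for either
  argument. Both versions have the same right-hand side, hence the difference of the two eigenvalues
  annihilates the form.\<close>

lemma power_convolution_orthogonal:
  fixes p q :: "'a::euclidean_space \<Rightarrow> real"
  assumes D: "2 \<le> DIM('a)" and kl: "k \<noteq> l"
    and p: "p \<in> harmonics k" and q: "q \<in> harmonics l"
  shows "sphere_inner (power_convolution n p) q = 0"
proof -
  let ?L = "lb_eigenvalue DIM('a)"
  have *: "?L k * sphere_inner (power_convolution n p) q =
      ?L n * sphere_inner (power_convolution n p) q
      - real n * (real n - 1) * sphere_inner (power_convolution (n - 2) p) q"
    if p: "p \<in> harmonics k" and q: "q \<in> harmonics l"
    for p q :: "'a \<Rightarrow> real" and k l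
  proof -
    have cont: "continuous_on (sphere 0 1) (power_convolution n p)" for n
      by (rule continuous_on_rpf[OF homogeneousD(1)[OF
            power_convolution_homogeneous[OF continuous_on_harmonic[OF p]]]])
    have int: "integrable surface_measure (\<lambda>x. power_convolution n p x * q x)" for n
      by (intro integrable_surface_measure continuous_intros continuous_on_harmonic[OF q] cont)
    have "?L k * sphere_inner (power_convolution n p) q =
        surface_integral (\<lambda>x. (?L k * power_convolution n p x) * q x)"
      by (simp add: sphere_inner_def mult.assoc)
    also have "\<dots> = surface_integral (\<lambda>x. ?L n * (power_convolution n p x * q x)
        - real n * (real n - 1) * (power_convolution (n - 2) p x * q x))"
    proof (rule Bochner_Integration.integral_cong[OF refl])
      fix x :: 'a assume "x \<in> space surface_measure"
      then have x: "x \<in> sphere 0 1" by (simp only: space_surface_measure)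
      show "(?L k * power_convolution n p x) * q x = ?L n * (power_convolution n p x * q x)
          - real n * (real n - 1) * (power_convolution (n - 2) p x * q x)"
        unfolding power_convolution_eigen[OF p x] by (simp only: left_diff_distrib mult.assoc)
    qed
    also have "\<dots> = ?L n * sphere_inner (power_convolution n p) q
        - real n * (real n - 1) * sphere_inner (power_convolution (n - 2) p) q"
      using int by (simp add: sphere_inner_def)
    finally show ?thesis .
  qed
  note sym = power_convolution_form(1)[OF continuous_on_harmonic[OF p] continuous_on_harmonic[OF q]]
  have "?L k * sphere_inner (power_convolution n p) q = ?L l * sphere_inner (power_convolution n p) q"
    using *[OF p q] *[OF q p] by (simp add: sym)
  then show ?thesis using lb_eigenvalue_inj[OF D, of k l] kl by auto
qed

text \<open>Among the harmonic components of \<open>power_convolution n p\<close>, only that of degree \<open>k\<close> can be nonzero: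
  the squared norm of the component of degree \<open>l\<close> is the value of the form on \<open>p\<close> and that
  component.\<close>

lemma power_convolution_harmonic:
  fixes p :: "'a::euclidean_space \<Rightarrow> real"
  assumes D: "2 \<le> DIM('a)" and p: "p \<in> harmonics k"
  obtains q where "q \<in> harmonics k"
    "\<And>x. x \<in> sphere 0 1 \<Longrightarrow> power_convolution n p x = q x"
proof -
  have hom: "power_convolution n p \<in> homogeneous n"
    by (rule power_convolution_homogeneous[OF continuous_on_harmonic[OF p]])
  obtain h where h: "\<And>k. h k \<in> harmonics k"
    "\<And>x. x \<in> sphere 0 1 \<Longrightarrow> power_convolution n p x = (\<Sum>l\<le>n. h l x)"
    by (rule harmonic_decomposition_sphere[OF hom]) (rule that)
  have 0: "h l x = 0" if l: "l \<le> n" "l \<noteq> k" and x: "x \<in> sphere 0 1" for l x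
  proof -
    have "sphere_inner (power_convolution n p) (h l) = sphere_inner (\<lambda>x. \<Sum>j\<le>n. 1 * h j x) (h l)"
      unfolding sphere_inner_def by (intro Bochner_Integration.integral_cong) (simp_all add: h(2))
    also have "\<dots> = (\<Sum>j\<le>n. 1 * sphere_inner (h j) (h l))"
      by (intro sphere_inner_sum_left continuous_on_harmonic[OF h(1)])
    also have "\<dots> = (\<Sum>j\<le>n. if j = l then sphere_inner (h l) (h l) else 0)"
      using harmonic_orthogonal_inner[OF D _ h(1) h(1)] by (intro sum.cong) auto
    also have "\<dots> = sphere_inner (h l) (h l)" using l by simp
    finally have "sphere_inner (h l) (h l) = 0"
      using power_convolution_orthogonal[OF D _ p h(1)[of l]] l by simp
    then show ?thesis by (rule sphere_inner_self_0[OF continuous_on_harmonic[OF h(1)] _ x])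
  qed
  show ?thesis
  proof (cases "k \<le> n")
    case True
    have "power_convolution n p x = h k x" if x: "x \<in> sphere 0 1" for x
    proof -
      have "(\<Sum>l\<le>n. h l x) = (\<Sum>l\<le>n. if l = k then h k x else 0)"
        using 0[OF _ _ x] by (intro sum.cong) auto
      then show ?thesis using h(2)[OF x] True by simp
    qed
    then show ?thesis by (rule that[OF h(1)])
  next
    case False
    have "power_convolution n p x = 0" if x: "x \<in> sphere 0 1" for x
      unfolding h(2)[OF x] using 0[OF _ _ x] False by (intro sum.neutral) auto
    then show ?thesis by (rule that[OF harmonic_zero])
  qed
qed

section \<open>Spectral weights of the powers\<close>

text \<open>The value at \<open>(x, x)\<close> of the component of degree \<open>k\<close> of the kernel \<open>(x \<bullet> y) ^ n\<close>.\<close>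

definition spectral_weight :: "nat \<Rightarrow> nat \<Rightarrow> 'a::euclidean_space \<Rightarrow> real" where
  "spectral_weight n k x = power_convolution n (zonal k x) x"

lemma power_convolution_zonal:
  fixes x :: "'a::euclidean_space"
  assumes D: "2 \<le> DIM('a)" and x: "x \<in> sphere 0 1"
  shows "sphere_inner (power_convolution n (zonal k x)) (zonal l x) =
    (if k = l then spectral_weight n k x else 0)"
proof (cases "k = l")
  case True
  obtain q where q: "q \<in> harmonics k"
    "\<And>u. u \<in> sphere 0 1 \<Longrightarrow> power_convolution n (zonal k x) u = q u"
    by (rule power_convolution_harmonic[OF D zonal_harmonic]) (rule that)
  have "sphere_inner (power_convolution n (zonal k x)) (zonal k x) = sphere_inner q (zonal k x)"
    unfolding sphere_inner_def by (intro Bochner_Integration.integral_cong) (simp_all add: q(2))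
  also have "\<dots> = spectral_weight n k x"
    unfolding spectral_weight_def q(2)[OF x] by (rule zonal_reproducing[OF q(1) x])
  finally show ?thesis using True by simp
next
  case False
  then show ?thesis using power_convolution_orthogonal[OF D False zonal_harmonic zonal_harmonic] by simp
qed

lemma spectral_weight_nonneg:
  fixes x :: "'a::euclidean_space"
  assumes "2 \<le> DIM('a)" "x \<in> sphere 0 1"
  shows "0 \<le> spectral_weight n k x"
proof -
  have "continuous_on (sphere 0 1) (zonal k x)" by (rule continuous_on_harmonic[OF zonal_harmonic])
  then show ?thesis
    using power_convolution_form(2)[of "zonal k x" "zonal k x" n] power_convolution_zonal[OF assms, of n k k]
    by simp
qed

text \<open>The weight is the value at \<open>x\<close> of the degree \<open>k\<close> component of \<open>\<lambda>y. (x \<bullet> y) ^ n\<close>; the components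
  add up to the value \<open>(x \<bullet> x) ^ n = 1\<close>.\<close>

lemma spectral_weight_sums:
  fixes x :: "'a::euclidean_space"
  assumes D: "2 \<le> DIM('a)" and x: "x \<in> sphere 0 1"
  shows "n < k \<Longrightarrow> spectral_weight n k x = 0"
    and "n \<le> N \<Longrightarrow> (\<Sum>k\<le>N. spectral_weight n k x) = 1"
proof -
  obtain h where h: "\<And>k. h k \<in> harmonics k"
    "\<And>y. y \<in> sphere 0 1 \<Longrightarrow> (x \<bullet> y) ^ n = (\<Sum>k\<le>n. h k y)"
    by (rule harmonic_decomposition_sphere[OF inner_power_homogeneous]) (rule that)
  have w: "spectral_weight n k x = (if k \<le> n then h k x else 0)" for k
  proof -
    have "spectral_weight n k x = sphere_inner (\<lambda>y. \<Sum>j\<le>n. 1 * h j y) (zonal k x)"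
      unfolding spectral_weight_def power_convolution_def sphere_inner_def
      by (intro Bochner_Integration.integral_cong) (simp_all add: h(2))
    also have "\<dots> = (\<Sum>j\<le>n. 1 * sphere_inner (h j) (zonal k x))"
      by (intro sphere_inner_sum_left continuous_on_harmonic[OF h(1)] continuous_on_harmonic[OF zonal_harmonic])
    also have "\<dots> = (\<Sum>j\<le>n. if j = k then h k x else 0)"
      using harmonic_orthogonal_inner[OF D _ h(1) zonal_harmonic] zonal_reproducing[OF h(1) x]
      by (intro sum.cong) auto
    finally show ?thesis by simp
  qed
  show "n < k \<Longrightarrow> spectral_weight n k x = 0" by (simp add: w)
  assume N: "n \<le> N"
  have "(\<Sum>k\<le>N. spectral_weight n k x) = (\<Sum>k\<le>n. h k x)"
    using N by (intro sum.mono_neutral_cong_right) (auto simp: w)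
  also have "\<dots> = (x \<bullet> x) ^ n" using h(2)[OF x] by simp
  also have "\<dots> = 1" using x by (simp add: dot_square_norm)
  finally show "(\<Sum>k\<le>N. spectral_weight n k x) = 1" .
qed

lemma spectral_weight_rec:
  fixes x :: "'a::euclidean_space"
  assumes "x \<in> sphere 0 1"
  shows "lb_eigenvalue DIM('a) k * spectral_weight n k x =
    lb_eigenvalue DIM('a) n * spectral_weight n k x - real n * (real n - 1) * spectral_weight (n - 2) k x"
  unfolding spectral_weight_def by (rule power_convolution_eigen[OF zonal_harmonic assms])

section \<open>Frequencies present in a power\<close>

lemma lb_eigenvalue_nonneg: "2 \<le> D \<Longrightarrow> 0 \<le> lb_eigenvalue D k"
  by (simp add: lb_eigenvalue_def)

text \<open>The product \<open>t * (t - 2) * \<dots> * (t - 2 * (i - 1))\<close>. These polynomials are adapted to a recursion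
  that relates the arguments \<open>t\<close> and \<open>t - 2\<close>.\<close>

definition even_falling :: "nat \<Rightarrow> real \<Rightarrow> real" where
  "even_falling i t = (\<Prod>j<i. t - 2 * real j)"

lemma even_falling_shift: "t * even_falling i (t - 2) = even_falling i t * (t - 2 * real i)"
proof -
  have "t * even_falling i (t - 2) = even_falling (Suc i) t"
    unfolding even_falling_def prod.lessThan_Suc_shift by (simp add: algebra_simps)
  then show ?thesis by (simp add: even_falling_def)
qed

text \<open>Although both terms on the left have degree \<open>i + 2\<close>, the operator raises the degree by one
  only. This is the reason why the eigenvalue, which is quadratic in the frequency, contributes only one
  power of \<open>n\<close> to the moments.\<close>

lemma even_falling_eigen:
  "t * (t + D - 2) * even_falling i t - t * (t - 1) * even_falling i (t - 2) =
   (2 * real i + D - 1) * even_falling (Suc i) t + 2 * real i * (2 * real i + D - 2) * even_falling i t"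
proof -
  have "t * (t - 1) * even_falling i (t - 2) = (t - 1) * (even_falling i t * (t - 2 * real i))"
    using even_falling_shift[of t i] by (simp add: mult_ac)
  moreover have "even_falling (Suc i) t = even_falling i t * (t - 2 * real i)"
    by (simp add: even_falling_def)
  ultimately show ?thesis by (simp only:) (simp add: algebra_simps)
qed

text \<open>By \<open>spectral_weight_rec\<close>, passing from the \<open>m\<close>-th to the next moment applies the operator of
  \<open>even_falling_eigen\<close> to the moment as a function of \<open>n\<close>.\<close>

lemma spectral_weight_moment_eq:
  assumes D: "2 \<le> DIM('a::euclidean_space)"
  shows "\<exists>c. \<forall>n N (x::'a). x \<in> sphere 0 1 \<longrightarrow> n \<le> N \<longrightarrow>
    (\<Sum>k\<le>N. lb_eigenvalue DIM('a) k ^ m * spectral_weight n k x) =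
    (\<Sum>i\<le>m. c i * even_falling i (real n))"
proof (induction m)
  case 0
  show ?case
    by (intro exI[of _ "\<lambda>_. 1"]) (simp add: spectral_weight_sums(2)[OF D] even_falling_def)
next
  case (Suc m)
  let ?L = "lb_eigenvalue DIM('a)"
  let ?D = "real DIM('a)"
  obtain c where c: "\<And>n N (x::'a). x \<in> sphere 0 1 \<Longrightarrow> n \<le> N \<Longrightarrow>
    (\<Sum>k\<le>N. ?L k ^ m * spectral_weight n k x) = (\<Sum>i\<le>m. c i * even_falling i (real n))"
    using Suc by blast
  define d where "d j = (if j = 0 then 0 else (2 * real (j - 1) + ?D - 1) * c (j - 1)) +
    (if j \<le> m then 2 * real j * (2 * real j + ?D - 2) * c j else 0)" for j
  have "(\<Sum>k\<le>N. ?L k ^ Suc m * spectral_weight n k x) = (\<Sum>j\<le>Suc m. d j * even_falling j (real n))"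
    if x: "x \<in> sphere 0 1" and N: "n \<le> N" for n N and x :: 'a
  proof -
    let ?t = "real n"
    have "(\<Sum>k\<le>N. ?L k ^ Suc m * spectral_weight n k x) =
        (\<Sum>k\<le>N. ?L k ^ m * (?L k * spectral_weight n k x))"
      by (simp add: mult_ac)
    also have "\<dots> = (\<Sum>k\<le>N. ?L n * (?L k ^ m * spectral_weight n k x)
        - ?t * (?t - 1) * (?L k ^ m * spectral_weight (n - 2) k x))"
      unfolding spectral_weight_rec[OF x] by (intro sum.cong refl) (simp add: algebra_simps)
    also have "\<dots> = ?L n * (\<Sum>k\<le>N. ?L k ^ m * spectral_weight n k x)
        - ?t * (?t - 1) * (\<Sum>k\<le>N. ?L k ^ m * spectral_weight (n - 2) k x)"
      by (simp only: sum_subtractf sum_distrib_left)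
    also have "\<dots> = ?L n * (\<Sum>i\<le>m. c i * even_falling i ?t)
        - ?t * (?t - 1) * (\<Sum>i\<le>m. c i * even_falling i (?t - 2))"
    proof (cases "n < 2")
      case True
      then have "n = 0 \<or> n = 1" by auto
      then have "?t * (?t - 1) = 0" by auto
      then show ?thesis using c[OF x N] by (simp only: mult_zero_left)
    next
      case False
      then show ?thesis using c[OF x N] c[OF x, of "n - 2" N] N by (simp add: of_nat_diff)
    qed
    also have "\<dots> = (\<Sum>i\<le>m. c i * (?t * (?t + ?D - 2) * even_falling i ?t
        - ?t * (?t - 1) * even_falling i (?t - 2)))"
      unfolding lb_eigenvalue_def sum_distrib_left sum_subtractf[symmetric]
      by (intro sum.cong refl) (simp add: algebra_simps)
    also have "\<dots> = (\<Sum>i\<le>m. (2 * real i + ?D - 1) * c i * even_falling (Suc i) ?t)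
        + (\<Sum>i\<le>m. 2 * real i * (2 * real i + ?D - 2) * c i * even_falling i ?t)"
      unfolding even_falling_eigen sum.distrib[symmetric] by (intro sum.cong refl) (simp add: algebra_simps)
    also have "\<dots> = (\<Sum>j\<le>Suc m. d j * even_falling j ?t)"
    proof -
      have "(\<Sum>j\<le>Suc m. (if j = 0 then 0 else (2 * real (j - 1) + ?D - 1) * c (j - 1)) * even_falling j ?t) =
          (\<Sum>i\<le>m. (2 * real i + ?D - 1) * c i * even_falling (Suc i) ?t)"
        unfolding sum.atMost_Suc_shift by simp
      moreover have "(\<Sum>j\<le>Suc m. (if j \<le> m then 2 * real j * (2 * real j + ?D - 2) * c j else 0) * even_falling j ?t) =
          (\<Sum>i\<le>m. 2 * real i * (2 * real i + ?D - 2) * c i * even_falling i ?t)"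
        by simp
      ultimately show ?thesis
        unfolding d_def distrib_right sum.distrib by (simp only:)
    qed
    finally show ?thesis .
  qed
  then show ?case by blast
qed

lemma abs_even_falling_le: "\<exists>C\<ge>0. \<forall>n. \<bar>even_falling i (real n)\<bar> \<le> C * (real n + 1) ^ i"
proof (induction i)
  case 0
  show ?case by (intro exI[of _ 1]) (simp add: even_falling_def)
next
  case (Suc i)
  then obtain C where C: "0 \<le> C" "\<And>n. \<bar>even_falling i (real n)\<bar> \<le> C * (real n + 1) ^ i" by blast
  have "\<bar>even_falling (Suc i) (real n)\<bar> \<le> (C * (2 * real i + 1)) * (real n + 1) ^ Suc i" for n
  proof -
    have "\<bar>real n - 2 * real i\<bar> \<le> real n + 2 * real i" by simp
    also have "\<dots> \<le> (2 * real i + 1) * (real n + 1)" by (simp add: algebra_simps)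
    finally have "\<bar>even_falling i (real n)\<bar> * \<bar>real n - 2 * real i\<bar> \<le>
        (C * (real n + 1) ^ i) * ((2 * real i + 1) * (real n + 1))"
      using C by (intro mult_mono) auto
    then show ?thesis by (simp add: even_falling_def abs_mult mult_ac)
  qed
  then show ?case using C(1) by (intro exI[of _ "C * (2 * real i + 1)"]) simp
qed

text \<open>The eigenvalue has size \<open>O(n)\<close> under the weights of the power \<open>n\<close>, that is, the frequencies
  present in the power have order \<open>sqrt n\<close>.\<close>

lemma spectral_weight_moment_le:
  assumes D: "2 \<le> DIM('a::euclidean_space)"
  obtains C where "1 \<le> C" "\<And>n N (x::'a). x \<in> sphere 0 1 \<Longrightarrow>
    (\<Sum>k\<le>N. lb_eigenvalue DIM('a) k ^ m * spectral_weight n k x) \<le> C * (real n + 1) ^ m"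
proof -
  let ?L = "lb_eigenvalue DIM('a)"
  obtain c where c: "\<And>n N (x::'a). x \<in> sphere 0 1 \<Longrightarrow> n \<le> N \<Longrightarrow>
    (\<Sum>k\<le>N. ?L k ^ m * spectral_weight n k x) = (\<Sum>i\<le>m. c i * even_falling i (real n))"
    using spectral_weight_moment_eq[OF D] by blast
  obtain B where B: "\<And>i. 0 \<le> B i" "\<And>i n. \<bar>even_falling i (real n)\<bar> \<le> B i * (real n + 1) ^ i"
    using abs_even_falling_le by metis
  define C where "C = max 1 (\<Sum>i\<le>m. \<bar>c i\<bar> * B i)"
  have "(\<Sum>k\<le>N. ?L k ^ m * spectral_weight n k x) \<le> C * (real n + 1) ^ m"
    if x: "x \<in> sphere 0 1" for n N and x :: 'a
  proof -
    have "(\<Sum>k\<le>N. ?L k ^ m * spectral_weight n k x) \<le> (\<Sum>k\<le>max n N. ?L k ^ m * spectral_weight n k x)"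
      using spectral_weight_nonneg[OF D x] lb_eigenvalue_nonneg[OF D]
      by (intro sum_mono2) auto
    also have "\<dots> = (\<Sum>i\<le>m. c i * even_falling i (real n))" by (rule c[OF x]) simp
    also have "\<dots> \<le> (\<Sum>i\<le>m. \<bar>c i\<bar> * B i * (real n + 1) ^ m)"
    proof (rule sum_mono)
      fix i assume i: "i \<in> {..m}"
      have "c i * even_falling i (real n) \<le> \<bar>c i\<bar> * \<bar>even_falling i (real n)\<bar>"
        by (metis abs_ge_self abs_mult)
      also have "\<dots> \<le> \<bar>c i\<bar> * (B i * (real n + 1) ^ i)"
        by (intro mult_left_mono B(2)) simp
      also have "\<dots> \<le> \<bar>c i\<bar> * (B i * (real n + 1) ^ m)"
        using i B(1) by (intro mult_left_mono power_increasing) auto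
      finally show "c i * even_falling i (real n) \<le> \<bar>c i\<bar> * B i * (real n + 1) ^ m" by (simp only: mult.assoc)
    qed
    also have "\<dots> = (\<Sum>i\<le>m. \<bar>c i\<bar> * B i) * (real n + 1) ^ m" by (rule sum_distrib_right[symmetric])
    also have "\<dots> \<le> C * (real n + 1) ^ m" unfolding C_def by (intro mult_right_mono) auto
    finally show ?thesis .
  qed
  then show ?thesis by (intro that[of C]) (simp_all add: C_def)
qed

lemma spectral_weight_sum_le_1:
  fixes x :: "'a::euclidean_space"
  assumes D: "2 \<le> DIM('a)" and x: "x \<in> sphere 0 1"
  shows "(\<Sum>k\<le>N. spectral_weight n k x) \<le> 1"
proof -
  have "(\<Sum>k\<le>N. spectral_weight n k x) \<le> (\<Sum>k\<le>max n N. spectral_weight n k x)"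
    using spectral_weight_nonneg[OF D x] by (intro sum_mono2) auto
  then show ?thesis using spectral_weight_sums(2)[OF D x, of n "max n N"] by simp
qed

lemma summable_coefficients:
  fixes a :: "nat \<Rightarrow> real"
  assumes a: "a \<in> O(\<lambda>n. 1 / real n powr (1 + \<alpha>))" and "\<beta> < \<alpha>"
  shows "summable (\<lambda>n. a n * (real n + 1) powr \<beta>)"
proof (rule summable_comparison_test_bigo)
  show "summable (\<lambda>n. norm (real n powr (\<beta> - (1 + \<alpha>))))"
    using assms(2) by (simp add: summable_real_powr_iff)
  have "(\<lambda>n. (real n + 1) powr \<beta>) \<in> O(\<lambda>n. real n powr \<beta>)" by real_asymp
  from landau_o.big.mult[OF a this]
  show "(\<lambda>n. a n * (real n + 1) powr \<beta>) \<in> O(\<lambda>n. real n powr (\<beta> - (1 + \<alpha>)))"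
    by (simp add: powr_diff)
qed

text \<open>Geometric interpolation between the bounds \<open>1\<close> and \<open>y\<close>.\<close>

lemma powr_min_bound:
  fixes s y :: real
  assumes "s \<le> 1" "s \<le> y" "0 \<le> s" "0 < \<theta>" "\<theta> \<le> 1"
  shows "s \<le> y powr \<theta>"
proof (cases "s = 0")
  case False
  then have s: "0 < s" using assms by simp
  have "s = s powr 1" using s by simp
  also have "\<dots> \<le> s powr \<theta>" using s assms by (intro powr_mono') auto
  also have "\<dots> \<le> y powr \<theta>" using s assms by (intro powr_mono2) auto
  finally show ?thesis .
qed simp

text \<open>The multiplier \<open>\<psi>\<close> stands for the \<open>j\<close>-th dyadic window, which vanishes for frequencies below half of
  \<open>2 ^ j\<close>. By Markov's inequality for the \<open>m\<close>-th moment, it retains a share of the power \<open>n\<close> that is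
  bounded by one and by a multiple of \<open>((n + 1) / 4 ^ j) ^ m\<close>, hence also by a multiple of
  \<open>((n + 1) / 4 ^ j) powr \<beta>\<close> once \<open>m \<ge> \<beta>\<close>. The sum of \<open>a n * (n + 1) powr \<beta>\<close> converges since
  \<open>\<beta> < \<alpha>\<close>.\<close>

lemma dyadic_block_variance:
  fixes a :: "nat \<Rightarrow> real"
  assumes D: "2 \<le> DIM('a::euclidean_space)"
    and a: "a \<in> O(\<lambda>n. 1 / real n powr (1 + \<alpha>))" and a0: "\<And>n. 0 \<le> a n"
    and \<beta>: "0 < \<beta>" "\<beta> < \<alpha>"
  obtains C where "0 \<le> C" "\<And>j N \<psi> (x::'a). x \<in> sphere 0 1 \<Longrightarrow> (\<And>k. \<bar>\<psi> k\<bar> \<le> 1) \<Longrightarrow>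
      (\<And>k. \<psi> k \<noteq> 0 \<Longrightarrow> 4 ^ j \<le> 4 * lb_eigenvalue DIM('a) k) \<Longrightarrow>
      (\<Sum>n. a n * (\<Sum>k\<le>N. (\<psi> k)\<^sup>2 * spectral_weight n k x)) \<le> C * (2 powr (- \<beta> * real j))\<^sup>2"
proof -
  let ?L = "lb_eigenvalue DIM('a)"
  define m where "m = Suc (nat \<lceil>\<beta>\<rceil>)"
  define \<theta> where "\<theta> = \<beta> / real m"
  have m: "0 < m" "\<beta> \<le> real m" unfolding m_def by linarith+
  have \<theta>: "0 < \<theta>" "\<theta> \<le> 1" "real m * \<theta> = \<beta>" using m \<beta> by (auto simp: \<theta>_def)
  obtain B where B: "1 \<le> B" "\<And>n N (x::'a). x \<in> sphere 0 1 \<Longrightarrow>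
    (\<Sum>k\<le>N. ?L k ^ m * spectral_weight n k x) \<le> B * (real n + 1) ^ m"
    using spectral_weight_moment_le[OF D, of m] by blast
  define C where "C = (B * 4 ^ m) powr \<theta> * (\<Sum>n. a n * (real n + 1) powr \<beta>)"
  note sm = summable_coefficients[OF a \<beta>(2)]
  have "0 \<le> C" unfolding C_def using a0 by (intro mult_nonneg_nonneg suminf_nonneg sm) auto
  moreover have "(\<Sum>n. a n * (\<Sum>k\<le>N. (\<psi> k)\<^sup>2 * spectral_weight n k x)) \<le> C * (2 powr (- \<beta> * real j))\<^sup>2"
    if x: "x \<in> sphere 0 1" and \<psi>: "\<And>k. \<bar>\<psi> k\<bar> \<le> 1"
      "\<And>k. \<psi> k \<noteq> 0 \<Longrightarrow> 4 ^ j \<le> 4 * ?L k" for j N \<psi> and x :: 'a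
  proof -
    note w = spectral_weight_nonneg[OF D x] and L = lb_eigenvalue_nonneg[OF D]
    define s where "s n = (\<Sum>k\<le>N. (\<psi> k)\<^sup>2 * spectral_weight n k x)" for n
    have \<psi>2: "(\<psi> k)\<^sup>2 \<le> 1" for k using \<psi>(1)[of k] by (simp add: abs_square_le_1)
    have s0: "0 \<le> s n" for n unfolding s_def using w by (intro sum_nonneg) auto
    have s1: "s n \<le> 1" for n
    proof -
      have "s n \<le> (\<Sum>k\<le>N. 1 * spectral_weight n k x)"
        unfolding s_def by (intro sum_mono mult_right_mono \<psi>2 w)
      also have "\<dots> \<le> 1" using spectral_weight_sum_le_1[OF D x] by simp
      finally show ?thesis .
    qed
    have s2: "s n \<le> B * 4 ^ m * ((real n + 1) / 4 ^ j) ^ m" for n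
    proof -
      have "(\<psi> k)\<^sup>2 \<le> (4 * ?L k / 4 ^ j) ^ m" for k
      proof (cases "\<psi> k = 0")
        case False
        have "1 \<le> 4 * ?L k / 4 ^ j" using \<psi>(2)[OF False] by simp
        then have "1 \<le> (4 * ?L k / 4 ^ j) ^ m" by (rule one_le_power)
        then show ?thesis using \<psi>2[of k] by linarith
      qed (use L[of k] in simp)
      then have "s n \<le> (\<Sum>k\<le>N. (4 * ?L k / 4 ^ j) ^ m * spectral_weight n k x)"
        unfolding s_def by (intro sum_mono mult_right_mono w)
      also have "\<dots> = (4 / 4 ^ j) ^ m * (\<Sum>k\<le>N. ?L k ^ m * spectral_weight n k x)"
        unfolding sum_distrib_left
        by (intro sum.cong refl) (simp add: power_mult_distrib power_divide)
      also have "\<dots> \<le> (4 / 4 ^ j) ^ m * (B * (real n + 1) ^ m)"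
        by (intro mult_left_mono B(2)[OF x]) simp
      also have "\<dots> = B * 4 ^ m * ((real n + 1) / 4 ^ j) ^ m"
        by (simp add: power_divide)
      finally show ?thesis .
    qed
    have s3: "s n \<le> (B * 4 ^ m) powr \<theta> * (2 powr (- \<beta> * real j))\<^sup>2 * (real n + 1) powr \<beta>" for n
    proof -
      have "s n \<le> (B * 4 ^ m * ((real n + 1) / 4 ^ j) ^ m) powr \<theta>"
        by (rule powr_min_bound[OF s1 s2 s0 \<theta>(1,2)])
      also have "\<dots> = (B * 4 ^ m) powr \<theta> * (((real n + 1) / 4 ^ j) ^ m) powr \<theta>"
        by (rule powr_mult)
      also have "(((real n + 1) / 4 ^ j) ^ m) powr \<theta> = ((real n + 1) / 4 ^ j) powr \<beta>"
        using \<theta>(3) by (simp add: powr_realpow[symmetric] powr_powr del: powr_realpow)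
      also have "\<dots> = (real n + 1) powr \<beta> / (4 ^ j) powr \<beta>"
        by (rule powr_divide)
      also have "(4 ^ j :: real) powr \<beta> = inverse ((2 powr (- \<beta> * real j))\<^sup>2)"
      proof -
        have "(4 ^ j :: real) = 2 powr (2 * real j)"
          by (simp add: powr_powr[symmetric] powr_realpow)
        then have "(4 ^ j :: real) powr \<beta> = 2 powr (2 * real j * \<beta>)" by (simp only: powr_powr)
        moreover have "(2 powr (- \<beta> * real j))\<^sup>2 = 2 powr (- (2 * real j * \<beta>))"
          by (simp add: power2_eq_square powr_add[symmetric] mult_ac)
        ultimately show ?thesis by (simp only: powr_minus inverse_inverse_eq)
      qed
      finally show ?thesis by (simp add: divide_inverse mult_ac)
    qed
    let ?c = "(B * 4 ^ m) powr \<theta> * (2 powr (- \<beta> * real j))\<^sup>2"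
    have le: "a n * s n \<le> ?c * (a n * (real n + 1) powr \<beta>)" for n
      using mult_left_mono[OF s3[of n] a0[of n]] by (simp only: mult_ac)
    have "summable (\<lambda>n. a n * s n)"
      by (rule summable_comparison_test'[OF summable_mult[OF sm, of ?c], of 0])
        (use le a0 s0 in \<open>simp add: abs_mult\<close>)
    then have "(\<Sum>n. a n * s n) \<le> (\<Sum>n. ?c * (a n * (real n + 1) powr \<beta>))"
      by (rule suminf_le[OF le _ summable_mult[OF sm]])
    also have "\<dots> = C * (2 powr (- \<beta> * real j))\<^sup>2"
      unfolding suminf_mult[OF sm] C_def by (simp only: mult_ac)
    finally show ?thesis by (simp only: s_def)
  qed
  ultimately show ?thesis using that by blast
qed

section \<open>Moments of Gaussian variables\<close>

text \<open>The moment of order \<open>2 * m\<close> of the standard normal distribution.\<close>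

definition gaussian_moment :: "nat \<Rightarrow> real" where
  "gaussian_moment m = fact (2 * m) / (2 ^ m * fact m)"

lemma gaussian_moment_nonneg: "0 \<le> gaussian_moment m"
  by (simp add: gaussian_moment_def)

lemma gaussian_variable_moments:
  assumes M: "prob_space M" and X: "gaussian_variable M X" and mean: "integral\<^sup>L M X = 0"
  shows "integrable M (\<lambda>w. X w ^ (2 * m))"
    and "integral\<^sup>L M (\<lambda>w. X w ^ (2 * m)) = gaussian_moment m * (integral\<^sup>L M (\<lambda>w. (X w)\<^sup>2)) ^ m"
proof -
  interpret prob_space M by fact
  have Xm [measurable]: "X \<in> borel_measurable M" using X by (simp add: gaussian_variable_def)
  have "integrable M (\<lambda>w. X w ^ (2 * m)) \<and>
    integral\<^sup>L M (\<lambda>w. X w ^ (2 * m)) = gaussian_moment m * (integral\<^sup>L M (\<lambda>w. (X w)\<^sup>2)) ^ m"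
  proof (cases "\<exists>c. AE w in M. X w = c")
    case True
    then obtain c where c: "AE w in M. X w = c" by blast
    have "integral\<^sup>L M X = integral\<^sup>L M (\<lambda>w. c)"
      by (rule integral_cong_AE) (use c in auto)
    then have "c = 0" using mean by (simp add: prob_space)
    then have p: "AE w in M. X w ^ n = 0 ^ n" for n using c by auto
    have i: "integral\<^sup>L M (\<lambda>w. X w ^ n) = 0 ^ n" for n
    proof -
      have "integral\<^sup>L M (\<lambda>w. X w ^ n) = integral\<^sup>L M (\<lambda>w. 0 ^ n)"
        by (rule integral_cong_AE) (use p[of n] in auto)
      then show ?thesis by (simp add: prob_space)
    qed
    have "integrable M (\<lambda>w. X w ^ (2 * m)) \<longleftrightarrow> integrable M (\<lambda>w. (0::real) ^ (2 * m))"
      by (rule integrable_cong_AE) (use p[of "2 * m"] in auto)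
    then show ?thesis
      using i[of "2 * m"] i[of 2] by (cases "m = 0") (simp_all add: gaussian_moment_def zero_power)
  next
    case False
    then obtain \<mu> \<sigma> where \<sigma>: "0 < \<sigma>" and d: "distributed M lborel X (\<lambda>t. ennreal (normal_density \<mu> \<sigma> t))"
      using X by (auto simp: gaussian_variable_def)
    have "integral\<^sup>L M X = \<mu>"
      using distributed_integral[OF d, of "\<lambda>t. t"] integral_normal_moment_nz_1[OF \<sigma>] by simp
    then have \<mu>: "\<mu> = 0" using mean by simp
    have e: "integrable M (\<lambda>w. X w ^ (2 * n)) \<and>
        integral\<^sup>L M (\<lambda>w. X w ^ (2 * n)) = fact (2 * n) / ((2 / \<sigma>\<^sup>2) ^ n * fact n)" for n
    proof -
      have "has_bochner_integral lborel (\<lambda>x. normal_density \<mu> \<sigma> x * (x - \<mu>) ^ (2 * n))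
          (fact (2 * n) / ((2 / \<sigma>\<^sup>2) ^ n * fact n))" by (rule normal_moment_even[OF \<sigma>])
      then have "integrable lborel (\<lambda>x. normal_density \<mu> \<sigma> x * x ^ (2 * n))"
        "integral\<^sup>L lborel (\<lambda>x. normal_density \<mu> \<sigma> x * x ^ (2 * n)) = fact (2 * n) / ((2 / \<sigma>\<^sup>2) ^ n * fact n)"
        using \<mu> by (auto simp: has_bochner_integral_iff)
      then show ?thesis
        using distributed_integral[OF d, of "\<lambda>t. t ^ (2 * n)"] distributed_integrable[OF d, of "\<lambda>t. t ^ (2 * n)"]
        by simp
    qed
    have "integral\<^sup>L M (\<lambda>w. (X w)\<^sup>2) = \<sigma>\<^sup>2" using e[of 1] by simp
    then show ?thesis using e[of m] by (simp add: gaussian_moment_def power_divide)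
  qed
  then show "integrable M (\<lambda>w. X w ^ (2 * m))"
    "integral\<^sup>L M (\<lambda>w. X w ^ (2 * m)) = gaussian_moment m * (integral\<^sup>L M (\<lambda>w. (X w)\<^sup>2)) ^ m"
    by auto
qed

lemma gaussian_process_combination:
  fixes x :: "nat \<Rightarrow> 'a" and a :: "nat \<Rightarrow> real"
  assumes M: "prob_space M" and Z: "centered_gaussian_process M T K Z" and x: "\<And>i. i < r \<Longrightarrow> x i \<in> T"
  defines "G \<equiv> (\<lambda>w. \<Sum>i<r. a i * Z (x i) w)"
  shows "G \<in> borel_measurable M"
    and "integrable M (\<lambda>w. (G w)\<^sup>2)"
    and "integral\<^sup>L M (\<lambda>w. (G w)\<^sup>2) = (\<Sum>i<r. \<Sum>j<r. a i * a j * K (x i) (x j))"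
    and "(\<integral>\<^sup>+w. ennreal (G w ^ (2 * m)) \<partial>M) =
      ennreal (gaussian_moment m * (\<Sum>i<r. \<Sum>j<r. a i * a j * K (x i) (x j)) ^ m)"
proof -
  interpret prob_space M by fact
  have gauss: "gaussian_variable M (\<lambda>w. \<Sum>i<n. b i * Z (y i) w)"
    if "\<And>i. i < n \<Longrightarrow> y i \<in> T" for n and y :: "nat \<Rightarrow> 'a" and b :: "nat \<Rightarrow> real"
    using Z that by (simp add: centered_gaussian_process_def)
  have g1: "gaussian_variable M (Z t)" if "t \<in> T" for t
    using gauss[of 1 "\<lambda>_. t" "\<lambda>_. 1"] that by simp
  have mean: "integral\<^sup>L M (Z t) = 0" if "t \<in> T" for t
    using Z that by (simp add: centered_gaussian_process_def)
  have m [measurable]: "Z t \<in> borel_measurable M" if "t \<in> T" for t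
    using g1[OF that] by (simp add: gaussian_variable_def)
  have sq: "integrable M (\<lambda>w. (Z t w)\<^sup>2)" if "t \<in> T" for t
    using gaussian_variable_moments(1)[OF M g1[OF that] mean[OF that], of 1] by simp
  have int: "integrable M (Z t)" if "t \<in> T" for t
    by (rule square_integrable_imp_integrable[OF m[OF that] sq[OF that]])
  have prod: "integrable M (\<lambda>w. Z s w * Z t w)" if s: "s \<in> T" and t: "t \<in> T" for s t
  proof (rule Bochner_Integration.integrable_bound[OF Bochner_Integration.integrable_add[OF sq[OF s] sq[OF t]]])
    show "(\<lambda>w. Z s w * Z t w) \<in> borel_measurable M" using m[OF s] m[OF t] by measurable
    show "AE w in M. norm (Z s w * Z t w) \<le> norm ((Z s w)\<^sup>2 + (Z t w)\<^sup>2)"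
    proof (rule AE_I2)
      fix w
      have "2 * (\<bar>Z s w\<bar> * \<bar>Z t w\<bar>) \<le> (Z s w)\<^sup>2 + (Z t w)\<^sup>2"
        using sum_squares_bound[of "\<bar>Z s w\<bar>" "\<bar>Z t w\<bar>"] by simp
      moreover have "0 \<le> \<bar>Z s w\<bar> * \<bar>Z t w\<bar>" by simp
      ultimately show "norm (Z s w * Z t w) \<le> norm ((Z s w)\<^sup>2 + (Z t w)\<^sup>2)"
        unfolding real_norm_def abs_mult by linarith
    qed
  qed
  have cov: "integral\<^sup>L M (\<lambda>w. Z s w * Z t w) = K s t" if "s \<in> T" "t \<in> T" for s t
    using Z that by (simp add: centered_gaussian_process_def)
  have G: "gaussian_variable M G" unfolding G_def by (rule gauss[OF x])
  then show Gm: "G \<in> borel_measurable M" by (simp add: gaussian_variable_def)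
  have Gmean: "integral\<^sup>L M G = 0"
    unfolding G_def using x int by (subst Bochner_Integration.integral_sum) (auto simp: mean)
  show sqG: "integrable M (\<lambda>w. (G w)\<^sup>2)"
    using gaussian_variable_moments(1)[OF M G Gmean, of 1] by simp
  have "(\<lambda>w. (G w)\<^sup>2) = (\<lambda>w. \<Sum>i<r. \<Sum>j<r. (a i * a j) * (Z (x i) w * Z (x j) w))"
    by (simp add: G_def power2_eq_square sum_product mult_ac)
  then have "integral\<^sup>L M (\<lambda>w. (G w)\<^sup>2) =
      integral\<^sup>L M (\<lambda>w. \<Sum>i<r. \<Sum>j<r. (a i * a j) * (Z (x i) w * Z (x j) w))" by simp
  also have "\<dots> = (\<Sum>i<r. \<Sum>j<r. integral\<^sup>L M (\<lambda>w. (a i * a j) * (Z (x i) w * Z (x j) w)))"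
    using x prod by (subst Bochner_Integration.integral_sum, force,
        intro sum.cong refl Bochner_Integration.integral_sum) auto
  also have "\<dots> = (\<Sum>i<r. \<Sum>j<r. a i * a j * K (x i) (x j))"
    using x by (intro sum.cong refl) (simp add: cov)
  finally show v: "integral\<^sup>L M (\<lambda>w. (G w)\<^sup>2) = (\<Sum>i<r. \<Sum>j<r. a i * a j * K (x i) (x j))" .
  show "(\<integral>\<^sup>+w. ennreal (G w ^ (2 * m)) \<partial>M) =
      ennreal (gaussian_moment m * (\<Sum>i<r. \<Sum>j<r. a i * a j * K (x i) (x j)) ^ m)"
    using nn_integral_eq_integral[OF gaussian_variable_moments(1)[OF M G Gmean, of m]]
      gaussian_variable_moments(2)[OF M G Gmean, of m] v by simp
qed

lemma sum_lessThan_add: "(\<Sum>i<r + s. f i) = (\<Sum>i<r. f i) + (\<Sum>j<s. f (r + j :: nat) :: real)"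
  by (induction s) (simp_all add: add.assoc)

text \<open>A difference of two combinations is a combination over the concatenated index range. It serves both
  for comparing two Riemann sums and for comparing a Riemann sum with a value of the process.\<close>

lemma gaussian_process_difference:
  fixes x y :: "nat \<Rightarrow> 'a" and a b :: "nat \<Rightarrow> real"
  assumes M: "prob_space M" and Z: "centered_gaussian_process M T K Z"
    and x: "\<And>i. i < r \<Longrightarrow> x i \<in> T" and y: "\<And>i. i < s \<Longrightarrow> y i \<in> T"
  defines "G \<equiv> (\<lambda>w. (\<Sum>i<r. a i * Z (x i) w) - (\<Sum>j<s. b j * Z (y j) w))"
    and "Q \<equiv> (\<Sum>i<r. \<Sum>j<r. a i * a j * K (x i) (x j)) - 2 * (\<Sum>i<r. \<Sum>j<s. a i * b j * K (x i) (y j))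
      + (\<Sum>i<s. \<Sum>j<s. b i * b j * K (y i) (y j))"
  shows "G \<in> borel_measurable M"
    and "(\<integral>\<^sup>+w. ennreal (G w ^ (2 * m)) \<partial>M) = ennreal (gaussian_moment m * Q ^ m)"
proof -
  define X where "X i = (if i < r then x i else y (i - r))" for i
  define A where "A i = (if i < r then a i else - b (i - r))" for i
  have X: "X i \<in> T" if "i < r + s" for i using that x y by (auto simp: X_def)
  have G: "G = (\<lambda>w. \<Sum>i<r + s. A i * Z (X i) w)"
    unfolding G_def sum_lessThan_add by (simp add: A_def X_def sum_negf)
  have sym: "K u v = K v u" if "u \<in> T" "v \<in> T" for u v
  proof -
    have "K u v = integral\<^sup>L M (\<lambda>w. Z u w * Z v w)" "K v u = integral\<^sup>L M (\<lambda>w. Z v w * Z u w)"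
      using Z that by (auto simp: centered_gaussian_process_def)
    then show ?thesis by (simp add: mult.commute)
  qed
  have "(\<Sum>j<s. \<Sum>i<r. b j * a i * K (y j) (x i)) = (\<Sum>j<s. \<Sum>i<r. a i * b j * K (x i) (y j))"
    using x y sym by (intro sum.cong refl) (simp add: mult_ac)
  also have "\<dots> = (\<Sum>i<r. \<Sum>j<s. a i * b j * K (x i) (y j))" by (rule sum.swap)
  finally have Q: "(\<Sum>i<r + s. \<Sum>j<r + s. A i * A j * K (X i) (X j)) = Q"
    unfolding Q_def sum_lessThan_add sum.distrib by (simp add: A_def X_def sum_negf)
  show "G \<in> borel_measurable M" unfolding G by (rule gaussian_process_combination(1)[OF M Z X])
  show "(\<integral>\<^sup>+w. ennreal (G w ^ (2 * m)) \<partial>M) = ennreal (gaussian_moment m * Q ^ m)"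
    unfolding G Q[symmetric] by (rule gaussian_process_combination(4)[OF M Z X])
qed

section \<open>Quantization of the sphere\<close>

text \<open>A finite measurable partition of the sphere into the cells \<open>{u. idx u = i}\<close> with representatives
  \<open>y i\<close>, so fine that replacing a point by its representative changes the kernel by at most \<open>e\<close>.\<close>

definition quantizer ::
  "('a::euclidean_space \<Rightarrow> 'a \<Rightarrow> real) \<Rightarrow> real \<Rightarrow> nat \<Rightarrow> (nat \<Rightarrow> 'a) \<Rightarrow> ('a \<Rightarrow> nat) \<Rightarrow> bool" where
  "quantizer K e r y idx \<longleftrightarrow>
     (\<forall>i<r. y i \<in> sphere 0 1) \<and> idx \<in> surface_measure \<rightarrow>\<^sub>M count_space UNIV \<and>
     (\<forall>u\<in>sphere 0 1. idx u < r) \<and>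
     (\<forall>u\<in>sphere 0 1. \<forall>v\<in>sphere 0 1. \<bar>K (y (idx u)) v - K u v\<bar> \<le> e)"

text \<open>Finitely many small balls cover the sphere, and each point is sent to the first ball that contains
  it.\<close>

lemma exists_quantizer:
  fixes K :: "'a::euclidean_space \<Rightarrow> 'a \<Rightarrow> real"
  assumes K: "continuous_on (sphere 0 1 \<times> sphere 0 1) (\<lambda>p. K (fst p) (snd p))" and e: "0 < e"
  shows "\<exists>r y idx. quantizer K e r y idx"
proof -
  let ?S = "sphere 0 1 :: 'a set"
  have "uniformly_continuous_on (?S \<times> ?S) (\<lambda>p. K (fst p) (snd p))"
    by (intro compact_uniformly_continuous K compact_Times compact_sphere)
  then obtain \<delta> where \<delta>: "0 < \<delta>" "\<And>p q. p \<in> ?S \<times> ?S \<Longrightarrow> q \<in> ?S \<times> ?S \<Longrightarrow> dist q p < \<delta> \<Longrightarrow>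
      dist (K (fst q) (snd q)) (K (fst p) (snd p)) < e"
    using e unfolding uniformly_continuous_on_def by metis
  have "?S \<subseteq> (\<Union>x\<in>?S. ball x \<delta>)" using \<delta>(1) by auto
  then obtain D where D: "D \<subseteq> ?S" "finite D" "?S \<subseteq> (\<Union>x\<in>D. ball x \<delta>)"
    by (rule compactE_image[OF compact_sphere, rotated]) auto
  obtain r :: nat and y where y: "D = y ` {i. i < r}"
    using finite_imp_nat_seg_image_inj_on[OF D(2)] by blast
  define idx where "idx u = (LEAST i. i < r \<and> dist u (y i) < \<delta>)" for u
  have ex: "\<exists>i. i < r \<and> dist u (y i) < \<delta>" if "u \<in> ?S" for u
    using D(3) that unfolding y by (force simp: dist_commute)
  have idx: "idx u < r" "dist u (y (idx u)) < \<delta>" if "u \<in> ?S" for u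
    using LeastI_ex[OF ex[OF that]] by (auto simp: idx_def)
  have "idx \<in> surface_measure \<rightarrow>\<^sub>M count_space UNIV"
  proof -
    have "(\<lambda>u. dist u (y i)) \<in> borel_measurable surface_measure" for i
      by (intro continuous_on_measurable_surface_measure continuous_intros)
    then show ?thesis unfolding idx_def[abs_def] by measurable
  qed
  moreover have yS: "y i \<in> ?S" if "i < r" for i using D(1) y that by auto
  moreover have "\<bar>K (y (idx u)) v - K u v\<bar> \<le> e" if "u \<in> ?S" "v \<in> ?S" for u v
  proof -
    have "dist (y (idx u), v) (u, v) < \<delta>"
      using idx(2)[OF that(1)] by (simp add: dist_Pair_Pair dist_commute)
    then have "dist (K (y (idx u)) v) (K u v) < e"
      using \<delta>(2)[of "(u, v)" "(y (idx u), v)"] that yS[OF idx(1)[OF that(1)]] by simp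
    then show ?thesis by (simp add: dist_real_def)
  qed
  ultimately have "quantizer K e r y idx" using idx(1) by (simp add: quantizer_def)
  then show ?thesis by blast
qed

definition cell_weight :: "('a::euclidean_space \<Rightarrow> nat) \<Rightarrow> ('a \<Rightarrow> real) \<Rightarrow> nat \<Rightarrow> real" where
  "cell_weight idx h i = surface_integral (\<lambda>u. indicator {i} (idx u) * h u)"

lemma measurable_cell_function:
  assumes "idx \<in> surface_measure \<rightarrow>\<^sub>M count_space UNIV"
  shows "(\<lambda>u. \<phi> (idx u) :: real) \<in> borel_measurable surface_measure"
  by (rule measurable_compose[OF assms]) simp

lemma integrable_cell_function:
  fixes h :: "'a::euclidean_space \<Rightarrow> real"
  assumes q: "quantizer K e r y idx" and h: "continuous_on (sphere 0 1) h"
  shows "integrable surface_measure (\<lambda>u. \<phi> (idx u) * h u)"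
proof -
  have idx: "idx \<in> surface_measure \<rightarrow>\<^sub>M count_space UNIV" using q by (simp add: quantizer_def)
  define B where "B = (\<Sum>i<r. \<bar>\<phi> i\<bar>)"
  have B: "\<bar>\<phi> (idx u)\<bar> \<le> B" if "u \<in> sphere 0 1" for u
    unfolding B_def using q that by (intro member_le_sum) (auto simp: quantizer_def)
  show ?thesis
  proof (rule Bochner_Integration.integrable_bound)
    show "integrable surface_measure (\<lambda>u. B * h u)"
      by (intro integrable_mult_right integrable_surface_measure h)
    show "(\<lambda>u. \<phi> (idx u) * h u) \<in> borel_measurable surface_measure"
      by (intro borel_measurable_times measurable_cell_function[OF idx]
          continuous_on_measurable_surface_measure h)
    show "AE u in surface_measure. norm (\<phi> (idx u) * h u) \<le> norm (B * h u)"
    proof (rule AE_I2)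
      fix u :: 'a assume "u \<in> space surface_measure"
      then have "\<bar>\<phi> (idx u)\<bar> \<le> \<bar>B\<bar>" using B[of u] by (auto simp: space_surface_measure)
      then show "norm (\<phi> (idx u) * h u) \<le> norm (B * h u)"
        by (simp add: abs_mult mult_right_mono)
    qed
  qed
qed

lemma sum_cell_weight:
  fixes h :: "'a::euclidean_space \<Rightarrow> real"
  assumes q: "quantizer K e r y idx" and h: "continuous_on (sphere 0 1) h"
  shows "(\<Sum>i<r. \<phi> i * cell_weight idx h i) = surface_integral (\<lambda>u. \<phi> (idx u) * h u)"
proof -
  have int: "integrable surface_measure (\<lambda>u. indicator {i} (idx u) * h u)" for i
    by (rule integrable_cell_function[OF q h])
  have "(\<Sum>i<r. \<phi> i * cell_weight idx h i) =
      surface_integral (\<lambda>u. \<Sum>i<r. \<phi> i * (indicator {i} (idx u) * h u))"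
    unfolding cell_weight_def using int by (subst Bochner_Integration.integral_sum) auto
  also have "\<dots> = surface_integral (\<lambda>u. \<phi> (idx u) * h u)"
  proof (rule Bochner_Integration.integral_cong[OF refl])
    fix u :: 'a assume "u \<in> space surface_measure"
    then have "idx u < r" using q by (simp add: quantizer_def)
    have "(\<Sum>i<r. \<phi> i * (indicator {i} (idx u) * h u)) = (\<Sum>i<r. if i = idx u then \<phi> i * h u else 0)"
      by (intro sum.cong refl) (auto simp: indicator_def)
    then show "(\<Sum>i<r. \<phi> i * (indicator {i} (idx u) * h u)) = \<phi> (idx u) * h u"
      using \<open>idx u < r\<close> by simp
  qed
  finally show ?thesis .
qed

lemma cell_weight_sum:
  assumes q: "quantizer K e r y idx"
    and h: "\<And>i. i \<in> I \<Longrightarrow> continuous_on (sphere 0 1) (h i)"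
  shows "cell_weight idx (\<lambda>u. \<Sum>i\<in>I. c i * h i u) j = (\<Sum>i\<in>I. c i * cell_weight idx (h i) j)"
proof -
  have "cell_weight idx (\<lambda>u. \<Sum>i\<in>I. c i * h i u) j =
      surface_integral (\<lambda>u. \<Sum>i\<in>I. c i * (indicator {j} (idx u) * h i u))"
    unfolding cell_weight_def sum_distrib_left by (simp only: mult.left_commute)
  also have "\<dots> = (\<Sum>i\<in>I. surface_integral (\<lambda>u. c i * (indicator {j} (idx u) * h i u)))"
    by (intro Bochner_Integration.integral_sum integrable_mult_right integrable_cell_function[OF q h])
  finally show ?thesis by (simp add: cell_weight_def)
qed

lemma integral_diff_bound:
  fixes f g h :: "'a::euclidean_space \<Rightarrow> real"
  assumes "integrable surface_measure (\<lambda>u. f u * h u)" "integrable surface_measure (\<lambda>u. g u * h u)"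
    and h: "continuous_on (sphere 0 1) h"
    and "\<And>u. u \<in> sphere 0 1 \<Longrightarrow> \<bar>f u - g u\<bar> \<le> e"
  shows "\<bar>surface_integral (\<lambda>u. f u * h u) - surface_integral (\<lambda>u. g u * h u)\<bar>
    \<le> e * surface_integral (\<lambda>u. \<bar>h u\<bar>)"
proof -
  have "surface_integral (\<lambda>u. f u * h u) - surface_integral (\<lambda>u. g u * h u) =
      surface_integral (\<lambda>u. f u * h u - g u * h u)"
    using assms(1,2) by simp
  also have "\<bar>\<dots>\<bar> \<le> surface_integral (\<lambda>u. \<bar>f u * h u - g u * h u\<bar>)"
    by (rule integral_abs_bound)
  also have "\<dots> \<le> surface_integral (\<lambda>u. e * \<bar>h u\<bar>)"
  proof (rule integral_mono)
    show "integrable surface_measure (\<lambda>u. \<bar>f u * h u - g u * h u\<bar>)" using assms(1,2) by simp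
    show "integrable surface_measure (\<lambda>u. e * \<bar>h u\<bar>)"
      by (intro integrable_mult_right integrable_surface_measure continuous_intros h)
    show "\<bar>f u * h u - g u * h u\<bar> \<le> e * \<bar>h u\<bar>" if "u \<in> space surface_measure" for u
      unfolding left_diff_distrib[symmetric] abs_mult using that assms(4)[of u]
      by (intro mult_right_mono) auto
  qed
  finally show ?thesis by simp
qed

definition kernel_integral :: "('a::euclidean_space \<Rightarrow> 'a \<Rightarrow> real) \<Rightarrow> ('a \<Rightarrow> real) \<Rightarrow> 'a \<Rightarrow> real" where
  "kernel_integral K h u = surface_integral (\<lambda>v. K u v * h v)"

lemma kernel_section_continuous:
  assumes "continuous_on (sphere 0 1 \<times> sphere 0 1) (\<lambda>p. K (fst p) (snd p))" "u \<in> sphere 0 1"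
  shows "continuous_on (sphere 0 1) (\<lambda>v. K u v)"
proof -
  have "continuous_on (sphere 0 1) (\<lambda>v. K (fst (u, v)) (snd (u, v)))"
    by (rule continuous_on_compose2[OF assms(1)],
        intro continuous_on_Pair continuous_on_const continuous_on_id) (use assms(2) in auto)
  then show ?thesis by simp
qed

lemma kernel_integral_continuous:
  fixes K :: "'a::euclidean_space \<Rightarrow> 'a \<Rightarrow> real"
  assumes K: "continuous_on (sphere 0 1 \<times> sphere 0 1) (\<lambda>p. K (fst p) (snd p))"
    and h: "continuous_on (sphere 0 1) h"
  shows "continuous_on (sphere 0 1) (kernel_integral K h)"
proof -
  let ?S = "sphere 0 1 :: 'a set"
  let ?L = "surface_integral (\<lambda>u. \<bar>h u\<bar>)"
  have uc: "uniformly_continuous_on (?S \<times> ?S) (\<lambda>p. K (fst p) (snd p))"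
    by (intro compact_uniformly_continuous K compact_Times compact_sphere)
  show ?thesis
    unfolding continuous_on_iff
  proof (intro ballI allI impI)
    fix u :: 'a and e :: real assume u: "u \<in> ?S" and e: "0 < e"
    have "0 \<le> ?L" by simp
    then have L: "0 < ?L + 1" by linarith
    define e' where "e' = e / (?L + 1)"
    have "0 < e'" unfolding e'_def using e L by (rule divide_pos_pos)
    moreover have "e' * (?L + 1) = e" using L unfolding e'_def by simp
    ultimately have e': "0 < e'" "e' * ?L < e" by (simp_all add: distrib_left)
    obtain \<delta> where \<delta>: "0 < \<delta>" "\<And>p q. p \<in> ?S \<times> ?S \<Longrightarrow> q \<in> ?S \<times> ?S \<Longrightarrow> dist q p < \<delta> \<Longrightarrow>
        dist (K (fst q) (snd q)) (K (fst p) (snd p)) < e'"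
      using e'(1) uc unfolding uniformly_continuous_on_def by metis
    have "dist (kernel_integral K h v) (kernel_integral K h u) < e" if v: "v \<in> ?S" "dist v u < \<delta>" for v
    proof -
      have "\<bar>K v t - K u t\<bar> \<le> e'" if "t \<in> ?S" for t
        using \<delta>(2)[of "(u, t)" "(v, t)"] u v that by (simp add: dist_Pair_Pair dist_real_def)
      then have "\<bar>kernel_integral K h v - kernel_integral K h u\<bar> \<le> e' * ?L"
        unfolding kernel_integral_def using u v
        by (intro integral_diff_bound integrable_surface_measure continuous_on_mult
            kernel_section_continuous[OF K] h) auto
      then show ?thesis using e'(2) by (simp add: dist_real_def)
    qed
    then show "\<exists>d>0. \<forall>x'\<in>?S. dist x' u < d \<longrightarrow> dist (kernel_integral K h x') (kernel_integral K h u) < e"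
      using \<delta>(1) by blast
  qed
qed

lemma quantized_kernel_integral:
  fixes K :: "'a::euclidean_space \<Rightarrow> 'a \<Rightarrow> real"
  assumes K: "continuous_on (sphere 0 1 \<times> sphere 0 1) (\<lambda>p. K (fst p) (snd p))"
    and sym: "\<And>u v. u \<in> sphere 0 1 \<Longrightarrow> v \<in> sphere 0 1 \<Longrightarrow> K u v = K v u"
    and q: "quantizer K e r y idx" and h: "continuous_on (sphere 0 1) h" and x: "x \<in> sphere 0 1"
  shows "\<bar>(\<Sum>i<r. cell_weight idx h i * K x (y i)) - kernel_integral K h x\<bar>
    \<le> e * surface_integral (\<lambda>u. \<bar>h u\<bar>)"
proof -
  have "(\<Sum>i<r. cell_weight idx h i * K x (y i)) = surface_integral (\<lambda>u. K x (y (idx u)) * h u)"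
    using sum_cell_weight[OF q h, of "\<lambda>i. K x (y i)"] by (simp add: mult.commute)
  moreover have "\<bar>K x (y (idx u)) - K x u\<bar> \<le> e" if u: "u \<in> sphere 0 1" for u
    using q u x sym[OF x u] sym[OF x, of "y (idx u)"] by (auto simp: quantizer_def)
  ultimately show ?thesis
    unfolding kernel_integral_def
    using integral_diff_bound[OF integrable_cell_function[OF q h, of "\<lambda>i. K x (y i)"], of "K x" e]
    by (simp add: integrable_surface_measure continuous_on_mult kernel_section_continuous[OF K x] h)
qed

text \<open>The left sum is the covariance of two Riemann sums of the process. Both partitions give
  approximations of one and the same double integral, so Riemann sums along finer partitions form a
  Cauchy sequence in mean square.\<close>

lemma quantized_kernel_form:
  fixes K :: "'a::euclidean_space \<Rightarrow> 'a \<Rightarrow> real"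
  assumes K: "continuous_on (sphere 0 1 \<times> sphere 0 1) (\<lambda>p. K (fst p) (snd p))"
    and sym: "\<And>u v. u \<in> sphere 0 1 \<Longrightarrow> v \<in> sphere 0 1 \<Longrightarrow> K u v = K v u"
    and q: "quantizer K e r y idx" and q': "quantizer K e' r' y' idx'"
    and h: "continuous_on (sphere 0 1) h"
  shows "\<bar>(\<Sum>i<r. \<Sum>j<r'. cell_weight idx h i * cell_weight idx' h j * K (y i) (y' j))
      - sphere_inner (kernel_integral K h) h\<bar>
    \<le> (e + e') * (surface_integral (\<lambda>u. \<bar>h u\<bar>))\<^sup>2"
proof -
  let ?L = "surface_integral (\<lambda>u. \<bar>h u\<bar>)"
  define T where "T i = (\<Sum>j<r'. cell_weight idx' h j * K (y i) (y' j))" for i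
  have "(\<Sum>i<r. \<Sum>j<r'. cell_weight idx h i * cell_weight idx' h j * K (y i) (y' j)) =
      (\<Sum>i<r. T i * cell_weight idx h i)"
    by (simp add: T_def sum_distrib_left mult_ac)
  also have "\<dots> = surface_integral (\<lambda>u. T (idx u) * h u)" by (rule sum_cell_weight[OF q h])
  finally have 1: "(\<Sum>i<r. \<Sum>j<r'. cell_weight idx h i * cell_weight idx' h j * K (y i) (y' j)) = \<dots>" .
  have 2: "\<bar>T (idx u) - kernel_integral K h u\<bar> \<le> (e + e') * ?L" if u: "u \<in> sphere 0 1" for u
  proof -
    have yu: "y (idx u) \<in> sphere 0 1" using q u by (simp add: quantizer_def)
    have "\<bar>T (idx u) - kernel_integral K h (y (idx u))\<bar> \<le> e' * ?L"
      unfolding T_def by (rule quantized_kernel_integral[OF K sym q' h yu])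
    moreover have "\<bar>kernel_integral K h (y (idx u)) - kernel_integral K h u\<bar> \<le> e * ?L"
      unfolding kernel_integral_def using q u yu
      by (intro integral_diff_bound integrable_surface_measure continuous_on_mult
            kernel_section_continuous[OF K] h) (auto simp: quantizer_def)
    ultimately show ?thesis by (simp add: distrib_right)
  qed
  have "\<bar>surface_integral (\<lambda>u. T (idx u) * h u) -
      surface_integral (\<lambda>u. kernel_integral K h u * h u)\<bar> \<le> (e + e') * ?L * ?L"
    by (rule integral_diff_bound[where f="\<lambda>u. T (idx u)", OF integrable_cell_function[OF q h] _ h 2])
      (intro integrable_surface_measure continuous_on_mult kernel_integral_continuous[OF K h] h)
  then show ?thesis unfolding 1 sphere_inner_def by (simp add: power2_eq_square mult.assoc)
qed

section \<open>Integrals of the process against continuous functions\<close>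

text \<open>The random variable \<open>I h\<close> is the integral of the process against \<open>h\<close>: the almost sure limit of the
  Riemann sums \<open>J n h\<close>, in which the cells are weighted by the integrals of \<open>h\<close>. The Riemann sums are
  Gaussian, so their moments are known from their variances, and Fatou's lemma carries the moments over
  to the limit as upper bounds.\<close>

lemma gaussian_process_integral:
  fixes Z :: "'a::euclidean_space \<Rightarrow> 'w \<Rightarrow> real" and K :: "'a \<Rightarrow> 'a \<Rightarrow> real"
  assumes M: "prob_space M" and Z: "centered_gaussian_process M (sphere 0 1) K Z"
    and K: "continuous_on (sphere 0 1 \<times> sphere 0 1) (\<lambda>p. K (fst p) (snd p))"
  obtains I :: "('a \<Rightarrow> real) \<Rightarrow> 'w \<Rightarrow> real" where
    "\<And>h. continuous_on (sphere 0 1) h \<Longrightarrow> I h \<in> borel_measurable M"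
    "\<And>(A :: 'i set) c h b x m. finite A \<Longrightarrow> (\<And>i. i \<in> A \<Longrightarrow> continuous_on (sphere 0 1) (h i)) \<Longrightarrow>
      x \<in> sphere 0 1 \<Longrightarrow>
      (\<integral>\<^sup>+w. ennreal ((b * Z x w - (\<Sum>i\<in>A. c i * I (h i) w)) ^ (2 * m)) \<partial>M) \<le>
      ennreal (gaussian_moment m * (b\<^sup>2 * K x x
        - 2 * b * kernel_integral K (\<lambda>u. \<Sum>i\<in>A. c i * h i u) x
        + sphere_inner (kernel_integral K (\<lambda>u. \<Sum>i\<in>A. c i * h i u)) (\<lambda>u. \<Sum>i\<in>A. c i * h i u)) ^ m)"
proof -
  interpret prob_space M by fact
  have sym: "K u v = K v u" if "u \<in> sphere 0 1" "v \<in> sphere 0 1" for u v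
  proof -
    have "K u v = integral\<^sup>L M (\<lambda>w. Z u w * Z v w)" "K v u = integral\<^sup>L M (\<lambda>w. Z v w * Z u w)"
      using Z that by (auto simp: centered_gaussian_process_def)
    then show ?thesis by (simp add: mult.commute)
  qed
  \<comment> \<open>The second moments of consecutive differences are of order \<open>\<epsilon> n\<close>. With \<open>16 ^ n\<close>, they stay
    summable after multiplication by \<open>2 ^ n\<close>, which bounds the first moments below.\<close>
  define \<epsilon> where "\<epsilon> n = (1 / 16 :: real) ^ n" for n
  have \<epsilon>: "0 < \<epsilon> n" for n by (simp add: \<epsilon>_def)
  have "\<forall>n. \<exists>p. quantizer K (\<epsilon> n) (fst p) (fst (snd p)) (snd (snd p))"
    using exists_quantizer[OF K \<epsilon>] by simp
  then obtain p where p: "\<And>n. quantizer K (\<epsilon> n) (fst (p n)) (fst (snd (p n))) (snd (snd (p n)))"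
    by (rule choice[THEN exE]) blast
  define r where "r n = fst (p n)" for n
  define y where "y n = fst (snd (p n))" for n
  define idx where "idx n = snd (snd (p n))" for n
  have q: "quantizer K (\<epsilon> n) (r n) (y n) (idx n)" for n
    using p[of n] by (simp only: r_def y_def idx_def)
  have yS: "y n i \<in> sphere 0 1" if "i < r n" for n i using q[of n] that by (simp add: quantizer_def)
  define J where "J n h w = (\<Sum>i<r n. cell_weight (idx n) h i * Z (y n i) w)" for n h w
  define I where "I h w = lim (\<lambda>n. J n h w)" for h w
  have Jm [measurable]: "J n h \<in> borel_measurable M" for n h
    unfolding J_def by (rule gaussian_process_combination(1)[OF M Z yS])
  have Im: "I h \<in> borel_measurable M" for h unfolding I_def by measurable
  have conv: "AE w in M. (\<lambda>n. J n h w) \<longlonglongrightarrow> I h w" if h: "continuous_on (sphere 0 1) h" for h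
  proof -
    let ?L = "surface_integral (\<lambda>u. \<bar>h u\<bar>)"
    let ?F = "sphere_inner (kernel_integral K h) h"
    define \<Delta> where "\<Delta> n w = J n h w - J (Suc n) h w" for n w
    have \<Delta>m [measurable]: "\<Delta> n \<in> borel_measurable M" for n unfolding \<Delta>_def by measurable
    define C where "C = 1 + 8 * ?L\<^sup>2"
    have sq: "(\<integral>\<^sup>+w. ennreal ((\<Delta> n w)\<^sup>2) \<partial>M) \<le> ennreal (8 * (\<epsilon> n * ?L\<^sup>2))" for n
    proof -
      define f where "f m m' = (\<Sum>i<r m. \<Sum>j<r m'. cell_weight (idx m) h i * cell_weight (idx m') h j *
        K (y m i) (y m' j))" for m m'
      have f: "\<bar>f m m' - ?F\<bar> \<le> (\<epsilon> m + \<epsilon> m') * ?L\<^sup>2" for m m'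
        unfolding f_def by (rule quantized_kernel_form[OF K sym q q h])
      have "\<epsilon> (Suc n) \<le> \<epsilon> n" by (simp add: \<epsilon>_def)
      then have f': "\<bar>f m m' - ?F\<bar> \<le> 2 * (\<epsilon> n * ?L\<^sup>2)" if "m \<in> {n, Suc n}" "m' \<in> {n, Suc n}" for m m'
        using that f[of m m'] mult_right_mono[of "\<epsilon> m + \<epsilon> m'" "2 * \<epsilon> n" "?L\<^sup>2"] by auto
      have "f n n - 2 * f n (Suc n) + f (Suc n) (Suc n) \<le> 8 * (\<epsilon> n * ?L\<^sup>2)"
        using f'[of n n] f'[of n "Suc n"] f'[of "Suc n" "Suc n"] unfolding abs_le_iff by force
      moreover have "(\<integral>\<^sup>+w. ennreal ((\<Delta> n w) ^ (2 * 1)) \<partial>M) =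
          ennreal (gaussian_moment 1 * (f n n - 2 * f n (Suc n) + f (Suc n) (Suc n)) ^ 1)"
        unfolding \<Delta>_def J_def f_def by (rule gaussian_process_difference(2)[OF M Z yS yS])
      ultimately show ?thesis by (simp add: gaussian_moment_def ennreal_leI)
    qed
    have abs: "(\<integral>\<^sup>+w. ennreal \<bar>\<Delta> n w\<bar> \<partial>M) \<le> ennreal (C * (1 / 2) ^ n)" for n
    proof -
      have am: "\<bar>t\<bar> \<le> (1 / 2) ^ n + 2 ^ n * t\<^sup>2" for t :: real
      proof (cases "\<bar>t\<bar> \<le> (1 / 2) ^ n")
        case False
        then have "1 \<le> 2 ^ n * \<bar>t\<bar>" by (simp add: field_simps power_divide)
        then have "1 * \<bar>t\<bar> \<le> (2 ^ n * \<bar>t\<bar>) * \<bar>t\<bar>" by (intro mult_right_mono) auto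
        then show ?thesis by (simp add: power2_eq_square mult.assoc add_nonneg_nonneg add_increasing)
      qed (simp add: add_increasing2)
      have "(\<integral>\<^sup>+w. ennreal \<bar>\<Delta> n w\<bar> \<partial>M) \<le> (\<integral>\<^sup>+w. ennreal ((1 / 2) ^ n) + ennreal (2 ^ n) * ennreal ((\<Delta> n w)\<^sup>2) \<partial>M)"
        by (intro nn_integral_mono)
          (use am in \<open>simp add: ennreal_mult[symmetric] ennreal_plus[symmetric] ennreal_leI del: ennreal_plus\<close>)
      also have "\<dots> = ennreal ((1 / 2) ^ n) + ennreal (2 ^ n) * (\<integral>\<^sup>+w. ennreal ((\<Delta> n w)\<^sup>2) \<partial>M)"
        by (subst nn_integral_add) (auto simp: nn_integral_cmult emeasure_space_1)
      also have "\<dots> \<le> ennreal ((1 / 2) ^ n) + ennreal (2 ^ n) * ennreal (8 * (\<epsilon> n * ?L\<^sup>2))"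
        by (intro add_left_mono mult_left_mono sq) auto
      also have "\<dots> = ennreal ((1 / 2) ^ n + 2 ^ n * (8 * (\<epsilon> n * ?L\<^sup>2)))"
        using \<epsilon>[of n] by (simp add: ennreal_mult[symmetric] ennreal_plus[symmetric] del: ennreal_plus)
      also have "\<dots> \<le> ennreal (C * (1 / 2) ^ n)"
      proof (rule ennreal_leI)
        have "2 ^ n * \<epsilon> n = (1 / 8 :: real) ^ n"
          by (simp add: \<epsilon>_def power_mult_distrib[symmetric])
        also have "\<dots> \<le> (1 / 2) ^ n" by (intro power_mono) auto
        finally have "8 * ?L\<^sup>2 * (2 ^ n * \<epsilon> n) \<le> 8 * ?L\<^sup>2 * (1 / 2) ^ n"
          by (intro mult_left_mono) auto
        then show "(1 / 2) ^ n + 2 ^ n * (8 * (\<epsilon> n * ?L\<^sup>2)) \<le> C * (1 / 2) ^ n"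
          by (simp add: C_def algebra_simps)
      qed
      finally show ?thesis .
    qed
    have "(\<integral>\<^sup>+w. (\<Sum>n. ennreal \<bar>\<Delta> n w\<bar>) \<partial>M) = (\<Sum>n. \<integral>\<^sup>+w. ennreal \<bar>\<Delta> n w\<bar> \<partial>M)"
      by (rule nn_integral_suminf) measurable
    also have "\<dots> \<le> (\<Sum>n. ennreal (C * (1 / 2) ^ n))" by (intro suminf_le abs) auto
    also have "\<dots> = ennreal (\<Sum>n. C * (1 / 2) ^ n)"
      by (rule suminf_ennreal2) (auto simp: C_def intro!: summable_mult summable_geometric)
    also have "\<dots> < \<infinity>" by simp
    finally have "AE w in M. (\<Sum>n. ennreal \<bar>\<Delta> n w\<bar>) \<noteq> \<infinity>"
      by (intro nn_integral_noteq_infinite) auto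
    then show ?thesis
    proof (rule AE_mp, intro AE_I2 impI)
      fix w assume "(\<Sum>n. ennreal \<bar>\<Delta> n w\<bar>) \<noteq> \<infinity>"
      then have "summable (\<lambda>n. \<bar>\<Delta> n w\<bar>)" by (intro summable_suminf_not_top) auto
      then have "summable (\<lambda>n. \<Delta> n w)" by (rule summable_rabs_cancel)
      then have "(\<lambda>n. \<Sum>k<n. \<Delta> k w) \<longlonglongrightarrow> (\<Sum>n. \<Delta> n w)" by (rule summable_LIMSEQ)
      then have "(\<lambda>n. J 0 h w - (\<Sum>k<n. \<Delta> k w)) \<longlonglongrightarrow> J 0 h w - (\<Sum>n. \<Delta> n w)"
        by (intro tendsto_intros)
      moreover have "(\<Sum>k<n. \<Delta> k w) = J 0 h w - J n h w" for n
        unfolding \<Delta>_def by (rule sum_lessThan_telescope')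
      ultimately have "(\<lambda>n. J n h w) \<longlonglongrightarrow> J 0 h w - (\<Sum>n. \<Delta> n w)" by simp
      then show "(\<lambda>n. J n h w) \<longlonglongrightarrow> I h w" unfolding I_def by (simp add: limI)
    qed
  qed
  have mom: "(\<integral>\<^sup>+w. ennreal ((b * Z x w - (\<Sum>i\<in>A. c i * I (h i) w)) ^ (2 * m)) \<partial>M) \<le>
      ennreal (gaussian_moment m * (b\<^sup>2 * K x x
        - 2 * b * kernel_integral K (\<lambda>u. \<Sum>i\<in>A. c i * h i u) x
        + sphere_inner (kernel_integral K (\<lambda>u. \<Sum>i\<in>A. c i * h i u)) (\<lambda>u. \<Sum>i\<in>A. c i * h i u)) ^ m)"
    if A: "finite A" and h: "\<And>i. i \<in> A \<Longrightarrow> continuous_on (sphere 0 1) (h i)"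
      and x: "x \<in> sphere 0 1" for A :: "'i set" and c h b x m
  proof -
    define H where "H u = (\<Sum>i\<in>A. c i * h i u)" for u
    let ?L = "surface_integral (\<lambda>u. \<bar>H u\<bar>)"
    have Hc: "continuous_on (sphere 0 1) H" unfolding H_def[abs_def] by (intro continuous_intros h)
    define Q where "Q n = b\<^sup>2 * K x x - 2 * b * (\<Sum>i<r n. cell_weight (idx n) H i * K x (y n i))
      + (\<Sum>i<r n. \<Sum>j<r n. cell_weight (idx n) H i * cell_weight (idx n) H j * K (y n i) (y n j))" for n
    have \<epsilon>0: "\<epsilon> \<longlonglongrightarrow> 0" unfolding \<epsilon>_def by (rule LIMSEQ_realpow_zero) auto
    have "(\<lambda>n. \<Sum>i<r n. cell_weight (idx n) H i * K x (y n i)) \<longlonglongrightarrow> kernel_integral K H x"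
    proof (rule LIM_zero_cancel, rule Lim_null_comparison)
      show "\<forall>\<^sub>F n in sequentially. norm ((\<Sum>i<r n. cell_weight (idx n) H i * K x (y n i)) - kernel_integral K H x) \<le> \<epsilon> n * ?L"
        using quantized_kernel_integral[OF K sym q Hc x] by simp
      show "(\<lambda>n. \<epsilon> n * ?L) \<longlonglongrightarrow> 0" using tendsto_mult_left_zero[OF \<epsilon>0] .
    qed
    moreover have "(\<lambda>n. \<Sum>i<r n. \<Sum>j<r n. cell_weight (idx n) H i * cell_weight (idx n) H j * K (y n i) (y n j))
        \<longlonglongrightarrow> sphere_inner (kernel_integral K H) H"
    proof (rule LIM_zero_cancel, rule Lim_null_comparison)
      show "\<forall>\<^sub>F n in sequentially. norm ((\<Sum>i<r n. \<Sum>j<r n. cell_weight (idx n) H i * cell_weight (idx n) H j * K (y n i) (y n j))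
          - sphere_inner (kernel_integral K H) H) \<le> (\<epsilon> n + \<epsilon> n) * ?L\<^sup>2"
        unfolding real_norm_def by (intro always_eventually allI quantized_kernel_form[OF K sym q q Hc])
      show "(\<lambda>n. (\<epsilon> n + \<epsilon> n) * ?L\<^sup>2) \<longlonglongrightarrow> 0"
        using tendsto_mult_left_zero[OF tendsto_add_zero[OF \<epsilon>0 \<epsilon>0]] .
    qed
    ultimately have Q: "Q \<longlonglongrightarrow> b\<^sup>2 * K x x - 2 * b * kernel_integral K H x + sphere_inner (kernel_integral K H) H"
      unfolding Q_def by (intro tendsto_intros)
    define G where "G n w = b * Z x w - (\<Sum>i\<in>A. c i * J n (h i) w)" for n w
    have G: "G n = (\<lambda>w. (\<Sum>i<1::nat. b * Z x w) - (\<Sum>j<r n. cell_weight (idx n) H j * Z (y n j) w))" for n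
    proof
      fix w
      have "(\<Sum>i\<in>A. c i * J n (h i) w) = (\<Sum>i\<in>A. \<Sum>j<r n. c i * cell_weight (idx n) (h i) j * Z (y n j) w)"
        by (simp add: J_def sum_distrib_left mult.assoc)
      also have "\<dots> = (\<Sum>j<r n. \<Sum>i\<in>A. c i * cell_weight (idx n) (h i) j * Z (y n j) w)" by (rule sum.swap)
      also have "\<dots> = (\<Sum>j<r n. cell_weight (idx n) H j * Z (y n j) w)"
        unfolding H_def[abs_def]
        by (simp add: cell_weight_sum[where I=A and h=h and c=c, OF q h] sum_distrib_right)
      finally show "G n w = (\<Sum>i<1::nat. b * Z x w) - (\<Sum>j<r n. cell_weight (idx n) H j * Z (y n j) w)"
        by (simp add: G_def)
    qed
    have Gm: "(\<integral>\<^sup>+w. ennreal (G n w ^ (2 * m)) \<partial>M) = ennreal (gaussian_moment m * Q n ^ m)" for n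
    proof -
      have "Q n = (\<Sum>i<1::nat. \<Sum>j<1::nat. b * b * K x x) - 2 * (\<Sum>i<1::nat. \<Sum>j<r n. b * cell_weight (idx n) H j * K x (y n j))
          + (\<Sum>i<r n. \<Sum>j<r n. cell_weight (idx n) H i * cell_weight (idx n) H j * K (y n i) (y n j))"
        by (simp add: Q_def power2_eq_square sum_distrib_left mult.assoc)
      then show ?thesis
        unfolding G by (simp only:) (rule gaussian_process_difference(2)[OF M Z x yS])
    qed
    have Gmeas [measurable]: "G n \<in> borel_measurable M" for n
      unfolding G by (rule gaussian_process_difference(1)[OF M Z x yS])
    have "AE w in M. \<forall>i\<in>A. (\<lambda>n. J n (h i) w) \<longlonglongrightarrow> I (h i) w"
      using A by (rule AE_finite_allI) (rule conv[OF h])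
    then have "AE w in M. ennreal ((b * Z x w - (\<Sum>i\<in>A. c i * I (h i) w)) ^ (2 * m)) =
        liminf (\<lambda>n. ennreal (G n w ^ (2 * m)))"
    proof (rule AE_mp, intro AE_I2 impI)
      fix w assume "\<forall>i\<in>A. (\<lambda>n. J n (h i) w) \<longlonglongrightarrow> I (h i) w"
      then have "(\<lambda>n. G n w) \<longlonglongrightarrow> b * Z x w - (\<Sum>i\<in>A. c i * I (h i) w)"
        unfolding G_def by (intro tendsto_intros) auto
      then have "(\<lambda>n. ennreal (G n w ^ (2 * m))) \<longlonglongrightarrow> ennreal ((b * Z x w - (\<Sum>i\<in>A. c i * I (h i) w)) ^ (2 * m))"
        by (intro tendsto_intros)
      then show "ennreal ((b * Z x w - (\<Sum>i\<in>A. c i * I (h i) w)) ^ (2 * m)) =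
          liminf (\<lambda>n. ennreal (G n w ^ (2 * m)))"
        by (intro lim_imp_Liminf[symmetric]) auto
    qed
    then have "(\<integral>\<^sup>+w. ennreal ((b * Z x w - (\<Sum>i\<in>A. c i * I (h i) w)) ^ (2 * m)) \<partial>M) =
        (\<integral>\<^sup>+w. liminf (\<lambda>n. ennreal (G n w ^ (2 * m))) \<partial>M)"
      by (rule nn_integral_cong_AE)
    also have "\<dots> \<le> liminf (\<lambda>n. \<integral>\<^sup>+w. ennreal (G n w ^ (2 * m)) \<partial>M)"
      by (rule nn_integral_liminf) measurable
    also have "\<dots> = ennreal (gaussian_moment m * (b\<^sup>2 * K x x - 2 * b * kernel_integral K H x
        + sphere_inner (kernel_integral K H) H) ^ m)"
      unfolding Gm by (intro lim_imp_Liminf tendsto_intros Q) auto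
    finally show ?thesis unfolding H_def[abs_def] .
  qed
  show ?thesis by (rule that[OF Im mom])
qed

section \<open>Series of kernels\<close>

lemma integral_series_sums:
  fixes g :: "nat \<Rightarrow> 'a::euclidean_space \<Rightarrow> real"
  assumes g: "\<And>n. continuous_on (sphere 0 1) (g n)" and h: "continuous_on (sphere 0 1) h"
    and le: "\<And>n u. u \<in> sphere 0 1 \<Longrightarrow> \<bar>g n u\<bar> \<le> M n" and M: "summable M"
  shows "(\<lambda>n. sphere_inner (g n) h) sums sphere_inner (\<lambda>u. \<Sum>n. g n u) h"
proof -
  have M0: "0 \<le> M n" for n
  proof -
    obtain b :: 'a where "b \<in> Basis" using nonempty_Basis by blast
    then show ?thesis using le[of b n] by (auto intro: order.trans[OF abs_ge_zero])
  qed
  have int: "integrable surface_measure (\<lambda>u. g n u * h u)" for n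
    by (intro integrable_surface_measure continuous_on_mult g h)
  have sm: "summable (\<lambda>n. norm (g n u * h u))" if "u \<in> sphere 0 1" for u
  proof (rule summable_comparison_test'[OF summable_mult2[OF M, of "\<bar>h u\<bar>"], of 0])
    show "norm (norm (g n u * h u)) \<le> M n * \<bar>h u\<bar>" for n
      using mult_right_mono[OF le[OF that], of "\<bar>h u\<bar>" n] by (simp add: abs_mult)
  qed
  have "summable (\<lambda>n. surface_integral (\<lambda>u. norm (g n u * h u)))"
  proof (rule summable_comparison_test'[OF summable_mult2[OF M, of "surface_integral (\<lambda>u. \<bar>h u\<bar>)"], of 0])
    fix n
    have "surface_integral (\<lambda>u. norm (g n u * h u)) \<le> surface_integral (\<lambda>u. M n * \<bar>h u\<bar>)"
    proof (rule integral_mono)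
      show "integrable surface_measure (\<lambda>u. norm (g n u * h u))" using int by (rule integrable_norm)
      show "integrable surface_measure (\<lambda>u. M n * \<bar>h u\<bar>)"
        by (intro integrable_mult_right integrable_surface_measure continuous_intros h)
      show "norm (g n u * h u) \<le> M n * \<bar>h u\<bar>" if "u \<in> space surface_measure" for u
        using mult_right_mono[OF le[of u n], of "\<bar>h u\<bar>"] that by (simp add: abs_mult)
    qed
    then show "norm (surface_integral (\<lambda>u. norm (g n u * h u))) \<le>
        M n * surface_integral (\<lambda>u. \<bar>h u\<bar>)"
      by simp
  qed
  from sums_integral[OF int AE_I2 this] sm
  have "(\<lambda>n. surface_integral (\<lambda>u. g n u * h u)) sums
      surface_integral (\<lambda>u. \<Sum>n. g n u * h u)"
    by simp
  also have "surface_integral (\<lambda>u. \<Sum>n. g n u * h u) =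
      surface_integral (\<lambda>u. (\<Sum>n. g n u) * h u)"
  proof (rule Bochner_Integration.integral_cong[OF refl])
    fix u :: 'a assume "u \<in> space surface_measure"
    then have u: "u \<in> sphere 0 1" by (simp only: space_surface_measure)
    have "summable (\<lambda>n. g n u)"
      by (rule summable_comparison_test'[OF M, of 0]) (use le[OF u] in auto)
    then show "(\<Sum>n. g n u * h u) = (\<Sum>n. g n u) * h u" by (rule suminf_mult2[symmetric])
  qed
  finally show ?thesis by (simp add: sphere_inner_def)
qed

lemma continuous_on_series:
  fixes g :: "nat \<Rightarrow> 'b::topological_space \<Rightarrow> real"
  assumes "\<And>n. continuous_on S (g n)" "\<And>n u. u \<in> S \<Longrightarrow> \<bar>g n u\<bar> \<le> M n" "summable M"
  shows "continuous_on S (\<lambda>u. \<Sum>n. g n u)"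
proof (rule uniform_limit_theorem)
  show "uniform_limit S (\<lambda>n u. \<Sum>i<n. g i u) (\<lambda>u. \<Sum>i. g i u) sequentially"
    using assms by (intro Weierstrass_m_test) auto
qed (use assms in \<open>auto intro!: always_eventually continuous_on_sum\<close>)

lemma abs_inner_power_le_1:
  fixes u v :: "'a::euclidean_space"
  assumes "u \<in> sphere 0 1" "v \<in> sphere 0 1"
  shows "\<bar>(u \<bullet> v) ^ n\<bar> \<le> 1"
proof -
  have "\<bar>u \<bullet> v\<bar> \<le> 1" using Cauchy_Schwarz_ineq2[of u v] assms by simp
  then show ?thesis by (simp add: power_abs power_le_one)
qed

definition power_series_kernel :: "(nat \<Rightarrow> real) \<Rightarrow> 'a::euclidean_space \<Rightarrow> 'a \<Rightarrow> real" where
  "power_series_kernel a u v = (\<Sum>n. a n * (u \<bullet> v) ^ n)"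

lemma power_series_kernel_summable:
  fixes u v :: "'a::euclidean_space"
  assumes a: "summable a" and a0: "\<And>n. 0 \<le> a n"
    and "u \<in> sphere 0 1" "v \<in> sphere 0 1"
  shows "summable (\<lambda>n. a n * (u \<bullet> v) ^ n)"
proof (rule summable_comparison_test'[OF a, of 0])
  show "norm (a n * (u \<bullet> v) ^ n) \<le> a n" for n
    using mult_left_mono[OF abs_inner_power_le_1[OF assms(3,4), of n] a0[of n]] a0[of n]
    by (simp add: abs_mult)
qed

lemma power_series_kernel_continuous:
  fixes a :: "nat \<Rightarrow> real"
  assumes a: "summable a" and a0: "\<And>n. 0 \<le> a n"
  shows "continuous_on (sphere 0 1 \<times> sphere 0 1)
    (\<lambda>p :: 'a::euclidean_space \<times> 'a. power_series_kernel a (fst p) (snd p))"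
  unfolding power_series_kernel_def
proof (rule continuous_on_series[OF _ _ a])
  show "\<bar>a n * (fst p \<bullet> snd p) ^ n\<bar> \<le> a n" if "p \<in> sphere 0 1 \<times> sphere 0 1" for n and p :: "'a \<times> 'a"
    using mult_left_mono[OF abs_inner_power_le_1[of "fst p" "snd p" n] a0[of n]] a0[of n] that
    by (auto simp: abs_mult)
qed (intro continuous_intros)

text \<open>By \<open>inner_power_tensor\<close>, the quadratic form is a sum of squares.\<close>

lemma inner_power_positive_semidefinite:
  fixes x :: "nat \<Rightarrow> 'a::euclidean_space"
  shows "0 \<le> (\<Sum>i<m. \<Sum>j<m. c i * c j * (x i \<bullet> x j) ^ n)"
proof -
  obtain I :: "'a list set" and h :: "'a list \<Rightarrow> 'a \<Rightarrow> real" where I: "finite I"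
    "\<And>x y. (x \<bullet> y) ^ n = (\<Sum>i\<in>I. h i x * h i y)"
    using inner_power_tensor[where 'a='a and n=n] by blast
  have "(\<Sum>i<m. \<Sum>j<m. c i * c j * (x i \<bullet> x j) ^ n) =
      (\<Sum>i<m. \<Sum>j<m. \<Sum>k\<in>I. (c i * h k (x i)) * (c j * h k (x j)))"
    unfolding I(2) sum_distrib_left by (simp only: mult_ac)
  also have "\<dots> = (\<Sum>i<m. \<Sum>k\<in>I. \<Sum>j<m. (c i * h k (x i)) * (c j * h k (x j)))"
    by (intro sum.cong refl sum.swap)
  also have "\<dots> = (\<Sum>k\<in>I. \<Sum>i<m. \<Sum>j<m. (c i * h k (x i)) * (c j * h k (x j)))"
    by (rule sum.swap)
  also have "\<dots> = (\<Sum>k\<in>I. (\<Sum>i<m. c i * h k (x i))\<^sup>2)"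
    by (simp add: power2_eq_square sum_product)
  also have "0 \<le> \<dots>" by (intro sum_nonneg) simp
  finally show ?thesis .
qed

lemma power_series_kernel_positive_definite:
  assumes a: "summable a" and a0: "\<And>n. 0 \<le> a n"
  shows "positive_definite_on (sphere 0 1) (power_series_kernel a :: 'a::euclidean_space \<Rightarrow> _)"
  unfolding positive_definite_on_def
proof (intro conjI ballI allI impI)
  fix x y :: 'a
  show "power_series_kernel a x y = power_series_kernel a y x"
    by (simp add: power_series_kernel_def inner_commute)
next
  fix m :: nat and x :: "nat \<Rightarrow> 'a" and c :: "nat \<Rightarrow> real" assume x: "\<forall>i<m. x i \<in> sphere 0 1"
  have sums: "(\<lambda>n. \<Sum>i<m. \<Sum>j<m. c i * c j * (a n * (x i \<bullet> x j) ^ n)) sums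
      (\<Sum>i<m. \<Sum>j<m. c i * c j * power_series_kernel a (x i) (x j))"
    unfolding power_series_kernel_def using x
    by (intro sums_sum sums_mult summable_sums power_series_kernel_summable[OF a a0]) auto
  have "0 \<le> (\<Sum>i<m. \<Sum>j<m. c i * c j * (a n * (x i \<bullet> x j) ^ n))" for n
  proof -
    have "(\<Sum>i<m. \<Sum>j<m. c i * c j * (a n * (x i \<bullet> x j) ^ n)) =
        a n * (\<Sum>i<m. \<Sum>j<m. c i * c j * (x i \<bullet> x j) ^ n)"
      by (simp add: sum_distrib_left mult_ac)
    then show ?thesis using inner_power_positive_semidefinite[of c x n m] a0[of n] by simp
  qed
  then show "0 \<le> (\<Sum>i<m. \<Sum>j<m. c i * c j * power_series_kernel a (x i) (x j))"
    by (rule sums_le[OF _ sums_zero sums])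
qed

lemma kernel_integral_power_series:
  fixes h :: "'a::euclidean_space \<Rightarrow> real"
  assumes a: "summable a" and a0: "\<And>n. 0 \<le> a n" and h: "continuous_on (sphere 0 1) h"
    and x: "x \<in> sphere 0 1"
  shows "(\<lambda>n. a n * power_convolution n h x) sums kernel_integral (power_series_kernel a) h x"
proof -
  have "(\<lambda>n. sphere_inner (\<lambda>v. a n * (x \<bullet> v) ^ n) h) sums sphere_inner (\<lambda>v. \<Sum>n. a n * (x \<bullet> v) ^ n) h"
  proof (rule integral_series_sums[OF _ h _ a])
    show "\<bar>a n * (x \<bullet> v) ^ n\<bar> \<le> a n" if "v \<in> sphere 0 1" for n v
      using mult_left_mono[OF abs_inner_power_le_1[OF x that, of n] a0[of n]] a0[of n]
      by (simp add: abs_mult)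
  qed (intro continuous_intros)
  then show ?thesis
    by (simp add: sphere_inner_cmult_left power_convolution_def kernel_integral_def
        power_series_kernel_def sphere_inner_def)
qed

lemma kernel_form_power_series:
  fixes h :: "'a::euclidean_space \<Rightarrow> real"
  assumes a: "summable a" and a0: "\<And>n. 0 \<le> a n" and h: "continuous_on (sphere 0 1) h"
  shows "(\<lambda>n. a n * sphere_inner (power_convolution n h) h) sums
    sphere_inner (kernel_integral (power_series_kernel a) h) h"
proof -
  let ?L = "surface_integral (\<lambda>u. \<bar>h u\<bar>)"
  have cont: "continuous_on S (power_convolution n h)" for n S
    by (rule continuous_on_rpf[OF homogeneousD(1)[OF power_convolution_homogeneous[OF h]]])
  have le: "\<bar>power_convolution n h u\<bar> \<le> ?L" if u: "u \<in> sphere 0 1" for n u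
  proof -
    have "\<bar>power_convolution n h u\<bar> \<le> surface_integral (\<lambda>v. \<bar>(u \<bullet> v) ^ n * h v\<bar>)"
      unfolding power_convolution_def sphere_inner_def by (rule integral_abs_bound)
    also have "\<dots> \<le> ?L"
    proof (rule integral_mono)
      show "integrable surface_measure (\<lambda>v. \<bar>(u \<bullet> v) ^ n * h v\<bar>)" "integrable surface_measure (\<lambda>v. \<bar>h v\<bar>)"
        by (intro integrable_surface_measure continuous_intros h)+
      show "\<bar>(u \<bullet> v) ^ n * h v\<bar> \<le> \<bar>h v\<bar>" if "v \<in> space surface_measure" for v
        using mult_right_mono[OF abs_inner_power_le_1[OF u, of v n], of "\<bar>h v\<bar>"] that
        by (simp add: abs_mult)
    qed
    finally show ?thesis .
  qed
  have "(\<lambda>n. sphere_inner (\<lambda>u. a n * power_convolution n h u) h) sums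
      sphere_inner (\<lambda>u. \<Sum>n. a n * power_convolution n h u) h"
  proof (rule integral_series_sums[OF _ h _ summable_mult2[OF a, of ?L]])
    show "\<bar>a n * power_convolution n h u\<bar> \<le> a n * ?L" if "u \<in> sphere 0 1" for n u
      using mult_left_mono[OF le[OF that, of n] a0[of n]] a0[of n] by (simp add: abs_mult)
  qed (intro continuous_intros cont)
  also have "sphere_inner (\<lambda>u. \<Sum>n. a n * power_convolution n h u) h =
      sphere_inner (kernel_integral (power_series_kernel a) h) h"
    unfolding sphere_inner_def
  proof (rule Bochner_Integration.integral_cong[OF refl])
    fix u :: 'a assume "u \<in> space surface_measure"
    then have "u \<in> sphere 0 1" by (simp only: space_surface_measure)
    from sums_unique[OF kernel_integral_power_series[OF a a0 h this]]
    show "(\<Sum>n. a n * power_convolution n h u) * h u = kernel_integral (power_series_kernel a) h u * h u"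
      by simp
  qed
  finally show ?thesis by (simp add: sphere_inner_cmult_left)
qed

section \<open>Spectral components of the process\<close>

text \<open>With \<open>I e\<close> the integral of the process against \<open>e\<close>, this is the projection of the process to the
  spherical harmonics of degree \<open>k\<close>.\<close>

definition harmonic_component ::
  "(('a::euclidean_space \<Rightarrow> real) \<Rightarrow> 'w \<Rightarrow> real) \<Rightarrow> nat \<Rightarrow> 'a \<Rightarrow> 'w \<Rightarrow> real" where
  "harmonic_component I k x w = (\<Sum>e\<in>harmonic_frame k. e x * I e w)"

lemma harmonic_component_harmonic:
  "(\<lambda>x. harmonic_component I k x w) \<in> harmonics k"
  unfolding harmonic_component_def
  by (intro harmonic_sum, subst mult.commute, rule harmonic_cmult) (use harmonic_frame_subset in blast)

text \<open>The kernels \<open>zonal k x\<close> of different degrees are orthogonal for the form of the power \<open>n\<close>, which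
  leaves the diagonal terms.\<close>

lemma spectral_quadratic_form:
  fixes x :: "'a::euclidean_space" and c :: "nat \<Rightarrow> real" and N :: nat
  assumes D: "2 \<le> DIM('a)" and x: "x \<in> sphere 0 1"
  defines "H \<equiv> (\<lambda>u. \<Sum>k\<le>N. c k * zonal k x u)"
  shows "power_convolution n H x = (\<Sum>k\<le>N. c k * spectral_weight n k x)"
    and "sphere_inner (power_convolution n H) H = (\<Sum>k\<le>N. (c k)\<^sup>2 * spectral_weight n k x)"
proof -
  note zc = continuous_on_harmonic[OF zonal_harmonic]
  have pc: "power_convolution n H u = (\<Sum>k\<le>N. c k * power_convolution n (zonal k x) u)" for u
  proof -
    have "continuous_on (sphere 0 1) (\<lambda>y. (u \<bullet> y) ^ n)" by (intro continuous_intros)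
    then show ?thesis
      unfolding power_convolution_def H_def
      by (subst (1 2) sphere_inner_commute) (rule sphere_inner_sum_left[OF zc])
  qed
  show "power_convolution n H x = (\<Sum>k\<le>N. c k * spectral_weight n k x)"
    by (simp add: pc spectral_weight_def)
  have cont: "continuous_on (sphere 0 1) (power_convolution n (zonal k x))" for k
    by (rule continuous_on_rpf[OF homogeneousD(1)[OF power_convolution_homogeneous[OF zc]]])
  have Hc: "continuous_on (sphere 0 1) H" unfolding H_def by (intro continuous_intros zc)
  have "sphere_inner (power_convolution n H) H = (\<Sum>k\<le>N. c k * sphere_inner (power_convolution n (zonal k x)) H)"
    unfolding pc[abs_def] by (rule sphere_inner_sum_left[OF cont Hc])
  also have "\<dots> = (\<Sum>k\<le>N. c k * (\<Sum>l\<le>N. c l * sphere_inner (power_convolution n (zonal k x)) (zonal l x)))"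
    unfolding H_def
    by (intro sum.cong refl arg_cong2[of _ _ _ _ "(*)"], subst (1 2) sphere_inner_commute)
      (rule sphere_inner_sum_left[OF zc cont])
  also have "\<dots> = (\<Sum>k\<le>N. c k * (\<Sum>l\<le>N. if l = k then c l * spectral_weight n k x else 0))"
    unfolding power_convolution_zonal[OF D x]
    by (intro sum.cong refl arg_cong2[of _ _ _ _ "(*)"]) auto
  also have "\<dots> = (\<Sum>k\<le>N. (c k)\<^sup>2 * spectral_weight n k x)"
    by (intro sum.cong refl) (simp add: power2_eq_square mult.assoc)
  finally show "sphere_inner (power_convolution n H) H = (\<Sum>k\<le>N. (c k)\<^sup>2 * spectral_weight n k x)" .
qed

text \<open>The left-hand side is the variance of \<open>b * Z x\<close> minus the sum of the harmonic components of
  the process at \<open>x\<close> with coefficients \<open>c k\<close>.\<close>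

lemma spectral_variance:
  fixes x :: "'a::euclidean_space" and a c :: "nat \<Rightarrow> real" and N :: nat
  assumes D: "2 \<le> DIM('a)" and x: "x \<in> sphere 0 1"
    and a: "summable a" and a0: "\<And>n. 0 \<le> a n"
  defines "H \<equiv> (\<lambda>u. \<Sum>k\<le>N. c k * zonal k x u)" and "K \<equiv> power_series_kernel a"
  shows "b\<^sup>2 * K x x - 2 * b * kernel_integral K H x + sphere_inner (kernel_integral K H) H =
    (\<Sum>n. a n * (b\<^sup>2 - 2 * b * (\<Sum>k\<le>N. c k * spectral_weight n k x)
      + (\<Sum>k\<le>N. (c k)\<^sup>2 * spectral_weight n k x)))"
proof -
  have Hc: "continuous_on (sphere 0 1) H"
    unfolding H_def by (intro continuous_intros continuous_on_harmonic[OF zonal_harmonic])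
  have "x \<bullet> x = 1" using x by (simp add: dot_square_norm)
  then have 1: "a sums K x x" using summable_sums[OF a] by (simp add: K_def power_series_kernel_def)
  note q = spectral_quadratic_form[OF D x, of _ c N, folded H_def]
  note 2 = kernel_integral_power_series[OF a a0 Hc x, folded K_def, unfolded q(1)]
  note 3 = kernel_form_power_series[OF a a0 Hc, folded K_def, unfolded q(2)]
  have "(\<lambda>n. b\<^sup>2 * a n - 2 * b * (a n * (\<Sum>k\<le>N. c k * spectral_weight n k x))
      + a n * (\<Sum>k\<le>N. (c k)\<^sup>2 * spectral_weight n k x)) sums
    (b\<^sup>2 * K x x - 2 * b * kernel_integral K H x + sphere_inner (kernel_integral K H) H)"
    by (intro sums_add sums_diff sums_mult 1 2 3)
  then show ?thesis by (simp add: sums_iff algebra_simps)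
qed

text \<open>The linear combination of integrals is indexed by the pairs of a degree and a member of the frame of
  that degree; its integrand is the sum of \<open>c k * zonal k x\<close>.\<close>

lemma harmonic_components_of_process:
  fixes Z :: "'a::euclidean_space \<Rightarrow> 'w \<Rightarrow> real"
  assumes D: "2 \<le> DIM('a)" and M: "prob_space M"
    and a: "summable a" and a0: "\<And>n. 0 \<le> a n"
    and Z: "centered_gaussian_process M (sphere 0 1) (power_series_kernel a) Z"
  obtains I :: "('a \<Rightarrow> real) \<Rightarrow> 'w \<Rightarrow> real" where
    "\<And>k e. e \<in> harmonic_frame k \<Longrightarrow> I e \<in> borel_measurable M"
    "\<And>b c N x m. x \<in> sphere 0 1 \<Longrightarrow>
      (\<integral>\<^sup>+w. ennreal ((b * Z x w - (\<Sum>k\<le>N. c k * harmonic_component I k x w)) ^ (2 * m)) \<partial>M) \<le>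
      ennreal (gaussian_moment m * (\<Sum>n. a n * (b\<^sup>2 - 2 * b * (\<Sum>k\<le>N. c k * spectral_weight n k x)
        + (\<Sum>k\<le>N. (c k)\<^sup>2 * spectral_weight n k x))) ^ m)"
proof (rule gaussian_process_integral[OF M Z power_series_kernel_continuous[OF a a0]])
  fix I :: "('a \<Rightarrow> real) \<Rightarrow> 'w \<Rightarrow> real"
  assume I: "\<And>h. continuous_on (sphere 0 1) h \<Longrightarrow> I h \<in> borel_measurable M"
    and mom: "\<And>(A :: (nat \<times> ('a \<Rightarrow> real)) set) c h b x m. finite A \<Longrightarrow>
      (\<And>i. i \<in> A \<Longrightarrow> continuous_on (sphere 0 1) (h i)) \<Longrightarrow> x \<in> sphere 0 1 \<Longrightarrow>
      (\<integral>\<^sup>+w. ennreal ((b * Z x w - (\<Sum>i\<in>A. c i * I (h i) w)) ^ (2 * m)) \<partial>M) \<le>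
      ennreal (gaussian_moment m * (b\<^sup>2 * power_series_kernel a x x
        - 2 * b * kernel_integral (power_series_kernel a) (\<lambda>u. \<Sum>i\<in>A. c i * h i u) x
        + sphere_inner (kernel_integral (power_series_kernel a) (\<lambda>u. \<Sum>i\<in>A. c i * h i u))
          (\<lambda>u. \<Sum>i\<in>A. c i * h i u)) ^ m)"
  have ec: "continuous_on (sphere 0 1) e" if "e \<in> harmonic_frame k" for e :: "'a \<Rightarrow> real" and k
    using that harmonic_frame_subset continuous_on_harmonic by blast
  have "(\<integral>\<^sup>+w. ennreal ((b * Z x w - (\<Sum>k\<le>N. c k * harmonic_component I k x w)) ^ (2 * m)) \<partial>M) \<le>
      ennreal (gaussian_moment m * (\<Sum>n. a n * (b\<^sup>2 - 2 * b * (\<Sum>k\<le>N. c k * spectral_weight n k x)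
        + (\<Sum>k\<le>N. (c k)\<^sup>2 * spectral_weight n k x))) ^ m)"
    if x: "x \<in> sphere 0 1" for b c N x m
  proof -
    define A where "A = Sigma {..N} (harmonic_frame :: nat \<Rightarrow> ('a \<Rightarrow> real) set)"
    define C where "C p = c (fst p) * snd p x" for p :: "nat \<times> ('a \<Rightarrow> real)"
    have fin: "finite A" by (simp add: A_def finite_harmonic_frame)
    have 1: "(\<Sum>p\<in>A. C p * I (snd p) w) = (\<Sum>k\<le>N. c k * harmonic_component I k x w)" for w
      unfolding A_def C_def harmonic_component_def sum_distrib_left
      by (subst sum.Sigma) (auto simp: finite_harmonic_frame mult.assoc intro!: sum.cong)
    have 2: "(\<Sum>p\<in>A. C p * snd p u) = (\<Sum>k\<le>N. c k * zonal k x u)" for u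
      unfolding A_def C_def zonal_def sum_distrib_left
      by (subst sum.Sigma) (auto simp: finite_harmonic_frame mult.assoc intro!: sum.cong)
    have "continuous_on (sphere 0 1) (snd p)" if "p \<in> A" for p
      using that ec by (auto simp: A_def)
    from mom[where A=A and h=snd and c=C and b=b and m=m, OF fin this x, unfolded 1 2 spectral_variance[OF D x a a0]]
    show ?thesis .
  qed
  note main = this
  show thesis
  proof (rule that[of I])
    show "I e \<in> borel_measurable M" if "e \<in> harmonic_frame k" for k e by (rule I[OF ec[OF that]])
  qed (rule main)
qed

section \<open>Dyadic windows\<close>

lemma littlewood_paley_cutoffD:
  assumes "littlewood_paley_cutoff \<Phi>"
  shows "0 \<le> \<Phi> x" "\<Phi> x \<le> 1" "0 \<le> x \<Longrightarrow> x \<le> 1 \<Longrightarrow> \<Phi> x = 1" "2 < x \<Longrightarrow> \<Phi> x = 0"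
proof -
  have c: "closure {x. \<Phi> x \<noteq> 0} \<subseteq> {-2..2}" "\<forall>x. 0 \<le> \<Phi> x \<and> \<Phi> x \<le> 1" "\<forall>x\<in>{0..1}. \<Phi> x = 1"
    using assms unfolding littlewood_paley_cutoff_def by - (elim conjE, assumption)+
  from c(2,3) show "0 \<le> \<Phi> x" "\<Phi> x \<le> 1" "0 \<le> x \<Longrightarrow> x \<le> 1 \<Longrightarrow> \<Phi> x = 1" by simp_all
  show "\<Phi> x = 0" if "2 < x"
  proof (rule ccontr)
    assume "\<Phi> x \<noteq> 0"
    then have "x \<in> closure {x. \<Phi> x \<noteq> 0}" by (intro subsetD[OF closure_subset]) simp
    then have "x \<in> {-2..2}" by (rule subsetD[OF c(1)])
    then show False using that by simp
  qed
qed

lemma dyadic_window_abs_le_1: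
  assumes "littlewood_paley_cutoff \<Phi>"
  shows "\<bar>dyadic_window \<Phi> j l\<bar> \<le> 1"
proof -
  note c = littlewood_paley_cutoffD(1,2)[OF assms]
  have "\<bar>\<Phi> l\<bar> \<le> 1" "\<bar>\<Phi> (l / 2 ^ j) - \<Phi> (2 * (l / 2 ^ j))\<bar> \<le> 1"
    using c[of l] c[of "l / 2 ^ j"] c[of "2 * (l / 2 ^ j)"] by linarith+
  then show ?thesis by (cases "j = 0") (simp_all only: dyadic_window_def simp_thms if_True if_False)
qed

lemma dyadic_window_eq_0:
  assumes "littlewood_paley_cutoff \<Phi>" and l: "2 ^ Suc j < l"
  shows "dyadic_window \<Phi> j l = 0"
proof -
  have 2: "2 < l / 2 ^ j" using l by (simp add: pos_less_divide_eq)
  note z = littlewood_paley_cutoffD(4)[OF assms(1)]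
  show ?thesis
  proof (cases "j = 0")
    case True
    then show ?thesis using z[of l] l by (simp add: dyadic_window_def)
  next
    case False
    have "2 < 2 * (l / 2 ^ j)" using 2 by simp
    then show ?thesis using z[OF 2] z[of "2 * (l / 2 ^ j)"] False by (simp add: dyadic_window_def)
  qed
qed

lemma dyadic_window_nonzero:
  assumes c: "littlewood_paley_cutoff \<Phi>" and "0 \<le> l" "dyadic_window \<Phi> (Suc j) l \<noteq> 0"
  shows "2 ^ Suc j \<le> 2 * l"
proof (rule ccontr)
  assume "\<not> 2 ^ Suc j \<le> 2 * l"
  then have l: "2 * (l / 2 ^ Suc j) \<le> 1" "0 \<le> l / 2 ^ Suc j" using assms(2) by (simp_all add: field_simps)
  then have l': "l / 2 ^ Suc j \<le> 1" "0 \<le> 2 * (l / 2 ^ Suc j)" by linarith+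
  have "\<Phi> (2 * (l / 2 ^ Suc j)) = 1" by (rule littlewood_paley_cutoffD(3)[OF c l'(2) l(1)])
  moreover have "\<Phi> (l / 2 ^ Suc j) = 1" by (rule littlewood_paley_cutoffD(3)[OF c l(2) l'(1)])
  ultimately show False using assms(3) by (simp only: dyadic_window_def nat.distinct(2) if_False)
qed

lemma dyadic_window_sum: "(\<Sum>j<Suc J. dyadic_window \<Phi> j l) = \<Phi> (l / 2 ^ J)"
proof (induction J)
  case (Suc J)
  have "2 * (l / 2 ^ Suc J) = l / 2 ^ J" by simp
  then show ?case using Suc by (simp add: dyadic_window_def del: power_Suc)
qed (simp add: dyadic_window_def)

text \<open>The partial sums telescope to \<open>\<Phi> (l / 2 ^ J)\<close>, which equals one as soon as \<open>2 ^ J\<close> exceeds \<open>l\<close>.\<close>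

lemma dyadic_window_sums:
  assumes c: "littlewood_paley_cutoff \<Phi>" and l: "0 \<le> l"
  shows "(\<lambda>j. dyadic_window \<Phi> j l) sums 1"
proof -
  obtain J where J: "l < 2 ^ J" using real_arch_pow[of 2 l] by auto
  have "(\<lambda>n. \<Sum>j<n. dyadic_window \<Phi> j l) \<longlonglongrightarrow> 1"
  proof (rule tendsto_eventually, rule eventually_sequentiallyI[of "Suc J"])
    fix n assume n: "Suc J \<le> n"
    then obtain i where i: "n = Suc i" "J \<le> i" by (cases n) auto
    have "(2::real) ^ J \<le> 2 ^ i" using i(2) by (intro power_increasing) auto
    then have "l \<le> 2 ^ i" using J by linarith
    then have "l / 2 ^ i \<le> 1" by simp
    then show "(\<Sum>j<n. dyadic_window \<Phi> j l) = 1"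
      unfolding i(1) dyadic_window_sum using l by (intro littlewood_paley_cutoffD(3)[OF c]) auto
  qed
  then show ?thesis by (simp add: sums_def)
qed

definition frequency :: "nat \<Rightarrow> nat \<Rightarrow> real" where
  "frequency D k = sqrt (lb_eigenvalue D k)"

lemma frequency_bounds:
  assumes "2 \<le> D"
  shows "real k \<le> frequency D k" "0 \<le> frequency D k" "k \<le> l \<Longrightarrow> frequency D k \<le> frequency D l"
proof -
  have "real k * real k \<le> lb_eigenvalue D k"
    unfolding lb_eigenvalue_def using assms by (intro mult_left_mono) simp_all
  then show "real k \<le> frequency D k"
    unfolding frequency_def by (intro real_le_rsqrt) (simp add: power2_eq_square)
  then show "0 \<le> frequency D k" using of_nat_0_le_iff order.trans by blast
  assume "k \<le> l"
  then have "lb_eigenvalue D k \<le> lb_eigenvalue D l"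
    using lb_eigenvalue_strict_mono[OF assms, of k l] by (auto simp: order_le_less)
  then show "frequency D k \<le> frequency D l" by (simp add: frequency_def)
qed

lemma dyadic_window_frequency_eq_0:
  assumes "2 \<le> D" "littlewood_paley_cutoff \<Phi>" "2 ^ Suc j < k"
  shows "dyadic_window \<Phi> j (frequency D k) = 0"
proof (rule dyadic_window_eq_0[OF assms(2)])
  have "real (2 ^ Suc j) < real k" using assms(3) by (simp only: of_nat_less_iff)
  then show "2 ^ Suc j < frequency D k" using frequency_bounds(1)[OF assms(1), of k] by simp
qed

section \<open>Besov regularity from the decay of the blocks\<close>

text \<open>The definite description in the definition of the projection has the value \<open>p\<close> on the sphere: two
  candidates differ by a harmonic polynomial that is orthogonal to itself.\<close>

lemma harmonic_proj_eq:
  fixes f :: "'a::euclidean_space \<Rightarrow> real"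
  assumes f: "continuous_on (sphere 0 1) f" and p: "p \<in> harmonics k"
    and orth: "\<And>g. g \<in> harmonics k \<Longrightarrow> sphere_inner f g = sphere_inner p g"
    and x: "x \<in> sphere 0 1"
  shows "harmonic_proj k f x = p x"
proof -
  let ?S = "sphere 0 1 :: 'a set"
  have eq: "surface_integral (\<lambda>x. (f x - restrict q ?S x) * restrict g ?S x) =
      sphere_inner f g - sphere_inner q g"
    if q: "q \<in> harmonics k" and g: "g \<in> harmonics k" for q g
  proof -
    have "surface_integral (\<lambda>x. (f x - restrict q ?S x) * restrict g ?S x) =
        sphere_inner (\<lambda>x. f x - q x) g"
      unfolding sphere_inner_def by (intro Bochner_Integration.integral_cong) auto
    then show ?thesis
      by (simp add: sphere_inner_diff_left[OF f continuous_on_harmonic[OF q] continuous_on_harmonic[OF g]])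
  qed
  have "harmonic_proj k f = restrict p ?S"
    unfolding harmonic_proj_def
  proof (rule the_equality)
    show "restrict p ?S \<in> spherical_harmonics k \<and> (\<forall>g\<in>spherical_harmonics k.
        surface_integral (\<lambda>x. (f x - restrict p ?S x) * g x) = 0)"
    proof (intro conjI ballI)
      show "restrict p ?S \<in> spherical_harmonics k"
        unfolding spherical_harmonics_def by (rule imageI[OF p])
      fix g assume "g \<in> (spherical_harmonics k :: ('a \<Rightarrow> real) set)"
      then obtain g' where g: "g' \<in> harmonics k" "g = restrict g' ?S"
        unfolding spherical_harmonics_def by (rule imageE)
      show "surface_integral (\<lambda>x. (f x - restrict p ?S x) * g x) = 0"
        unfolding g(2) eq[OF p g(1)] orth[OF g(1)] by simp
    qed
    fix h assume h: "h \<in> spherical_harmonics k \<and> (\<forall>g\<in>spherical_harmonics k.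
        surface_integral (\<lambda>x. (f x - h x) * g x) = 0)"
    then obtain q where q: "q \<in> harmonics k" "h = restrict q ?S"
      unfolding spherical_harmonics_def by blast
    have qp: "sphere_inner q g = sphere_inner p g" if g: "g \<in> harmonics k" for g
    proof -
      have "restrict g ?S \<in> spherical_harmonics k"
        unfolding spherical_harmonics_def by (rule imageI[OF g])
      then have "surface_integral (\<lambda>x. (f x - restrict q ?S x) * restrict g ?S x) = 0"
        using h q(2) by blast
      then show ?thesis using eq[OF q(1) g] orth[OF g] by simp
    qed
    have d: "(\<lambda>x. q x - p x) \<in> harmonics k"
      using fun_space.subspace_diff[OF subspace_harmonic q(1) p] by (simp add: fun_diff_def)
    have "sphere_inner (\<lambda>x. q x - p x) (\<lambda>x. q x - p x) = 0"
      using qp[OF d] sphere_inner_diff_left[OF continuous_on_harmonic[OF q(1)]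
          continuous_on_harmonic[OF p] continuous_on_harmonic[OF d]] by simp
    then have "q x - p x = 0" if "x \<in> ?S" for x
      by (rule sphere_inner_self_0[OF continuous_on_harmonic[OF d] _ that])
    then show "h = restrict p ?S" unfolding q(2) by (intro restrict_ext) simp
  qed
  then show ?thesis using x by simp
qed

text \<open>The \<open>j\<close>-th dyadic block of the series of the \<open>X k\<close>. The window vanishes for frequencies above
  \<open>2 ^ (j + 1)\<close>, and the frequency of degree \<open>k\<close> is at least \<open>k\<close>, so no term is lost.\<close>

definition frequency_block ::
  "(real \<Rightarrow> real) \<Rightarrow> (nat \<Rightarrow> 'a::euclidean_space \<Rightarrow> real) \<Rightarrow> nat \<Rightarrow> 'a \<Rightarrow> real" where
  "frequency_block \<Phi> X j x =
     (\<Sum>k\<le>2 ^ Suc j. dyadic_window \<Phi> j (frequency DIM('a) k) * X k x)"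

lemma frequency_block_extend:
  fixes X :: "nat \<Rightarrow> 'a::euclidean_space \<Rightarrow> real"
  assumes D: "2 \<le> DIM('a)" and c: "littlewood_paley_cutoff \<Phi>" and N: "2 ^ Suc j \<le> N"
  shows "frequency_block \<Phi> X j x = (\<Sum>k\<le>N. dyadic_window \<Phi> j (frequency DIM('a) k) * X k x)"
  unfolding frequency_block_def
proof (rule sum.mono_neutral_left)
  show "\<forall>k\<in>{..N} - {..2 ^ Suc j}. dyadic_window \<Phi> j (frequency DIM('a) k) * X k x = 0"
    using dyadic_window_frequency_eq_0[OF D c] by (simp del: power_Suc)
qed (use N in auto)

lemma sum_frequency_blocks:
  fixes X :: "nat \<Rightarrow> 'a::euclidean_space \<Rightarrow> real"
  assumes D: "2 \<le> DIM('a)" and c: "littlewood_paley_cutoff \<Phi>"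
  shows "(\<Sum>j<Suc J. frequency_block \<Phi> X j x) =
    (\<Sum>k\<le>2 ^ Suc J. \<Phi> (frequency DIM('a) k / 2 ^ J) * X k x)"
proof -
  have "(\<Sum>j<Suc J. frequency_block \<Phi> X j x) =
      (\<Sum>j<Suc J. \<Sum>k\<le>2 ^ Suc J. dyadic_window \<Phi> j (frequency DIM('a) k) * X k x)"
  proof (rule sum.cong[OF refl])
    fix j assume "j \<in> {..<Suc J}"
    then have "(2::nat) ^ Suc j \<le> 2 ^ Suc J" by (intro power_increasing) auto
    then show "frequency_block \<Phi> X j x = (\<Sum>k\<le>2 ^ Suc J. dyadic_window \<Phi> j (frequency DIM('a) k) * X k x)"
      by (rule frequency_block_extend[OF D c])
  qed
  also have "\<dots> = (\<Sum>k\<le>2 ^ Suc J. (\<Sum>j<Suc J. dyadic_window \<Phi> j (frequency DIM('a) k)) * X k x)"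
    unfolding sum_distrib_right by (rule sum.swap)
  finally show ?thesis unfolding dyadic_window_sum .
qed

lemma summable_powr_geometric: "0 < s \<Longrightarrow> summable (\<lambda>j. 2 powr (- s * real j))"
proof -
  assume "0 < s"
  then have "summable (\<lambda>j. (2 powr (- s)) ^ j)" by (intro summable_geometric) (simp add: powr_less_one)
  then show ?thesis by (simp add: powr_realpow[symmetric] powr_powr)
qed

text \<open>The series of the blocks converges uniformly, so it can be integrated against spherical harmonics
  term by term. As the windows add up to one, its projection to degree \<open>k\<close> is \<open>X k\<close> again, and the dyadic
  operators return the blocks.\<close>

lemma besov_of_frequency_blocks:
  fixes X :: "nat \<Rightarrow> 'a::euclidean_space \<Rightarrow> real"
  assumes D: "2 \<le> DIM('a)" and c: "littlewood_paley_cutoff \<Phi>"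
    and X: "\<And>k. X k \<in> harmonics k"
    and B: "\<And>j x. x \<in> sphere 0 1 \<Longrightarrow> \<bar>frequency_block \<Phi> X j x\<bar> \<le> B * 2 powr (- \<beta> * real j)"
    and \<beta>: "0 < \<beta>" "\<gamma> < \<beta>"
  shows "(\<lambda>x. \<Sum>j. frequency_block \<Phi> X j x) \<in> besov_inf_1 \<Phi> \<gamma>"
proof -
  let ?V = "frequency_block \<Phi> X"
  let ?Y = "\<lambda>x. \<Sum>j. ?V j x"
  let ?W = "\<lambda>j k. dyadic_window \<Phi> j (frequency DIM('a) k)"
  obtain b :: 'a where b: "b \<in> sphere 0 1" using nonempty_Basis norm_Basis by (metis all_not_in_conv mem_sphere_0)
  have Vc: "continuous_on (sphere 0 1) (?V j)" for j
    unfolding frequency_block_def[abs_def] by (intro continuous_intros continuous_on_harmonic[OF X])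
  have M: "summable (\<lambda>j. B * 2 powr (- \<beta> * real j))"
    by (intro summable_mult summable_powr_geometric \<beta>)
  have Yc: "continuous_on (sphere 0 1) ?Y" by (rule continuous_on_series[OF Vc B M])
  have proj: "harmonic_proj k ?Y x = X k x" if x: "x \<in> sphere 0 1" for k x
  proof (rule harmonic_proj_eq[OF Yc X _ x])
    fix g :: "'a \<Rightarrow> real" assume g: "g \<in> harmonics k"
    have Vg: "sphere_inner (?V j) g = ?W j k * sphere_inner (X k) g" for j
    proof -
      define N where "N = max k (2 ^ Suc j)"
      have N: "2 ^ Suc j \<le> N" "k \<le> N" by (simp_all add: N_def)
      have "?V j = (\<lambda>x. \<Sum>l\<le>N. ?W j l * X l x)"
        using frequency_block_extend[OF D c N(1)] by blast
      then have "sphere_inner (?V j) g = (\<Sum>l\<le>N. ?W j l * sphere_inner (X l) g)"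
        by (simp only: sphere_inner_sum_left[OF continuous_on_harmonic[OF X] continuous_on_harmonic[OF g]])
      also have "\<dots> = (\<Sum>l\<le>N. if l = k then ?W j k * sphere_inner (X k) g else 0)"
        using harmonic_orthogonal_inner[OF D _ X g] by (intro sum.cong) auto
      also have "\<dots> = ?W j k * sphere_inner (X k) g" using N(2) by simp
      finally show ?thesis .
    qed
    have "(\<lambda>j. sphere_inner (?V j) g) sums sphere_inner ?Y g"
      by (rule integral_series_sums[OF Vc continuous_on_harmonic[OF g] B M])
    moreover have "(\<lambda>j. ?W j k * sphere_inner (X k) g) sums (1 * sphere_inner (X k) g)"
      by (intro sums_mult2 dyadic_window_sums[OF c] frequency_bounds(2)[OF D])
    ultimately show "sphere_inner ?Y g = sphere_inner (X k) g"
      unfolding Vg using sums_unique2 by fastforce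
  qed
  have op: "dyadic_operator \<Phi> j ?Y x = ?V j x" if x: "x \<in> sphere 0 1" for j x
  proof -
    have "dyadic_operator \<Phi> j ?Y x = (\<Sum>k. ?W j k * X k x)"
      by (simp add: dyadic_operator_def frequency_def lb_eigenvalue_def proj[OF x])
    also have "\<dots> = (\<Sum>k\<le>2 ^ Suc j. ?W j k * X k x)"
      by (rule suminf_finite) (use dyadic_window_frequency_eq_0[OF D c] in \<open>auto simp: not_le simp del: power_Suc\<close>)
    finally show ?thesis by (simp only: frequency_block_def)
  qed
  have norm: "0 \<le> sphere_sup_norm (dyadic_operator \<Phi> j ?Y) \<and>
      sphere_sup_norm (dyadic_operator \<Phi> j ?Y) \<le> B * 2 powr (- \<beta> * real j)" for j
  proof -
    have "sphere_sup_norm (dyadic_operator \<Phi> j ?Y) = (SUP x\<in>sphere 0 1. \<bar>?V j x\<bar>)"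
      unfolding sphere_sup_norm_def by (intro SUP_cong) (simp_all add: op)
    moreover have "(SUP x\<in>sphere 0 1. \<bar>?V j x\<bar>) \<le> B * 2 powr (- \<beta> * real j)"
      using b by (intro cSUP_least B) auto
    moreover have "\<bar>?V j b\<bar> \<le> (SUP x\<in>sphere 0 1. \<bar>?V j x\<bar>)"
      by (rule cSUP_upper[OF b]) (use B[of _ j] in \<open>auto intro!: bdd_aboveI\<close>)
    ultimately show ?thesis by linarith
  qed
  have "summable (\<lambda>j. 2 powr (real j * \<gamma>) * sphere_sup_norm (dyadic_operator \<Phi> j ?Y))"
  proof (rule summable_comparison_test'[of "\<lambda>j. B * 2 powr (- (\<beta> - \<gamma>) * real j)" 0])
    show "summable (\<lambda>j. B * 2 powr (- (\<beta> - \<gamma>) * real j))"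
      using \<beta> by (intro summable_mult summable_powr_geometric) simp
    fix j
    have "2 powr (real j * \<gamma>) * sphere_sup_norm (dyadic_operator \<Phi> j ?Y) \<le>
        2 powr (real j * \<gamma>) * (B * 2 powr (- \<beta> * real j))"
      using norm[of j] by (intro mult_left_mono) auto
    also have "\<dots> = B * (2 powr (real j * \<gamma>) * 2 powr (- \<beta> * real j))" by (simp only: mult.left_commute)
    also have "2 powr (real j * \<gamma>) * 2 powr (- \<beta> * real j) = 2 powr (- (\<beta> - \<gamma>) * real j)"
      unfolding powr_add[symmetric] by (simp add: algebra_simps)
    finally show "norm (2 powr (real j * \<gamma>) * sphere_sup_norm (dyadic_operator \<Phi> j ?Y)) \<le>
        B * 2 powr (- (\<beta> - \<gamma>) * real j)"
      using norm[of j] by (simp add: abs_mult)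
  qed
  then show ?thesis using Yc by (simp add: besov_inf_1_def)
qed

section \<open>Almost sure decay of the blocks\<close>

text \<open>The bound \<open>nikolskii_L2\<close> for the power \<open>p ^ m\<close>. The factor is a power of \<open>m * N + 1\<close> with an exponent
  independent of \<open>m\<close>, so its root of order \<open>2 * m\<close> is small compared with any positive power of \<open>N\<close> when
  \<open>m\<close> is large.\<close>

lemma nikolskii_power:
  fixes p :: "'a::euclidean_space \<Rightarrow> real"
  assumes p: "p \<in> polynomials_le N" and x: "x \<in> sphere 0 1"
  shows "p x ^ (2 * m) * measure (surface_measure :: 'a measure) (sphere 0 1) \<le>
    real ((m * N + 1) ^ DIM('a)) * surface_integral (\<lambda>u. p u ^ (2 * m))"
  using nikolskii_L2[OF polynomials_le_power[OF p, of m] x]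
  by (simp add: sphere_inner_def power_mult[symmetric] power_add[symmetric] mult.commute mult_2_right)

lemma frequency_block_polynomial:
  assumes "\<And>k. X k \<in> harmonics k"
  shows "frequency_block \<Phi> X j \<in> polynomials_le (2 ^ Suc j)"
  unfolding frequency_block_def[abs_def]
  by (intro polynomials_le_sum polynomials_le_cmult homogeneous_polynomials_le[OF harmonicD(1)[OF assms]]) auto

lemma frequency_block_component_measurable:
  fixes x :: "'a::euclidean_space"
  assumes I: "\<And>k e. e \<in> harmonic_frame k \<Longrightarrow> I e \<in> borel_measurable M"
  shows "(\<lambda>w. frequency_block \<Phi> (\<lambda>k x. harmonic_component I k x w) j x) \<in> borel_measurable M"
  unfolding frequency_block_def harmonic_component_def
  by (intro borel_measurable_sum borel_measurable_times borel_measurable_const I) auto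

lemma frequency_block_component_jointly_measurable:
  fixes I :: "('a::euclidean_space \<Rightarrow> real) \<Rightarrow> 'w \<Rightarrow> real"
  assumes I: "\<And>k e. e \<in> harmonic_frame k \<Longrightarrow> I e \<in> borel_measurable M"
  shows "(\<lambda>p. frequency_block \<Phi> (\<lambda>k x. harmonic_component I k x (snd p)) j (fst p))
    \<in> borel_measurable (surface_measure \<Otimes>\<^sub>M M)"
  unfolding frequency_block_def harmonic_component_def
proof (intro borel_measurable_sum borel_measurable_times borel_measurable_const)
  fix k and e :: "'a \<Rightarrow> real" assume e: "e \<in> harmonic_frame k"
  have "e \<in> borel_measurable surface_measure"
    using e harmonic_frame_subset
    by (intro continuous_on_measurable_surface_measure continuous_on_harmonic) blast
  then show "(\<lambda>p. e (fst p)) \<in> borel_measurable (surface_measure \<Otimes>\<^sub>M M)"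
    by (rule measurable_compose[OF measurable_fst])
  show "(\<lambda>p. I e (snd p)) \<in> borel_measurable (surface_measure \<Otimes>\<^sub>M M)"
    by (rule measurable_compose[OF measurable_snd I[OF e]])
qed

text \<open>Summing the expected integrals of the \<open>2 * m\<close>-th powers of the blocks, with the weights \<open>t j\<close> that turn
  \<open>nikolskii_power\<close> into a bound for \<open>(2 powr (\<gamma> * j) * \<bar>block j\<bar>) ^ (2 * m)\<close>, gives a geometric series.
  Almost surely the weighted integrals are therefore summable and, in particular, bounded. Working with
  integrals instead of suprema avoids measurability questions.\<close>

lemma blocks_decay_of_moments:
  fixes I :: "('a::euclidean_space \<Rightarrow> real) \<Rightarrow> 'w \<Rightarrow> real"
  assumes M: "prob_space M"
    and I: "\<And>k e. e \<in> harmonic_frame k \<Longrightarrow> I e \<in> borel_measurable M"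
    and mom: "\<And>m. \<exists>C\<ge>0. \<forall>j. \<forall>x\<in>sphere 0 1.
      (\<integral>\<^sup>+w. ennreal (frequency_block \<Phi> (\<lambda>k x. harmonic_component I k x w) (Suc j) x ^ (2 * m)) \<partial>M) \<le>
      ennreal (C * (2 powr (- \<beta> * real (Suc j))) ^ (2 * m))"
    and \<gamma>: "\<gamma> < \<beta>"
  shows "AE w in M. \<exists>B. \<forall>j. \<forall>x\<in>sphere 0 1.
    \<bar>frequency_block \<Phi> (\<lambda>k x. harmonic_component I k x w) j x\<bar> \<le> B * 2 powr (- \<gamma> * real j)"
proof -
  interpret prob_space M by fact
  interpret pair_sigma_finite "surface_measure :: 'a measure" M ..
  let ?D = "DIM('a)"
  define s where "s = measure (surface_measure :: 'a measure) (sphere 0 1)"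
  have s: "0 < s" unfolding s_def by (rule measure_surface_pos)
  define V where "V j x w = frequency_block \<Phi> (\<lambda>k x. harmonic_component I k x w) j x" for j x w
  have Vp: "(\<lambda>x. V j x w) \<in> polynomials_le (2 ^ Suc j)" for j w
    unfolding V_def by (rule frequency_block_polynomial) (rule harmonic_component_harmonic)
  have Vc: "continuous_on (sphere 0 1) (\<lambda>x. V j x w)" for j w
    by (rule continuous_on_rpf[OF polynomials_leD[OF Vp]])
  have Vm [measurable]: "(\<lambda>p. V j (fst p) (snd p)) \<in> borel_measurable (surface_measure \<Otimes>\<^sub>M M)" for j
    unfolding V_def by (rule frequency_block_component_jointly_measurable[OF I])
  \<comment> \<open>So large that the factor \<open>2 powr (D * j)\<close> from the supremum bound is absorbed.\<close>
  define m where "m = Suc (nat \<lceil>real ?D / (\<beta> - \<gamma>)\<rceil>)"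
  have "real ?D / (\<beta> - \<gamma>) < real m" unfolding m_def by linarith
  then have "real ?D < real m * (\<beta> - \<gamma>)" using \<gamma> by (simp only: pos_divide_less_eq diff_gt_0_iff_gt)
  also have "\<dots> \<le> real (2 * m) * (\<beta> - \<gamma>)" using \<gamma> by (intro mult_right_mono) auto
  finally have m: "real ?D < real (2 * m) * (\<beta> - \<gamma>)" "0 < m" by (simp_all add: m_def)
  obtain C where C: "0 \<le> C" "\<And>j x. x \<in> sphere 0 1 \<Longrightarrow>
      (\<integral>\<^sup>+w. ennreal (V (Suc j) x w ^ (2 * m)) \<partial>M) \<le> ennreal (C * (2 powr (- \<beta> * real (Suc j))) ^ (2 * m))"
    using mom[of m] unfolding V_def by blast
  define U where "U j w = surface_integral (\<lambda>x. V (Suc j) x w ^ (2 * m))" for j w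
  have Vint: "integrable surface_measure (\<lambda>x. V j x w ^ (2 * m))" for j w
    by (intro integrable_surface_measure continuous_intros Vc)
  have U0: "0 \<le> U j w" for j w unfolding U_def by (intro integral_nonneg_AE) (simp add: power_mult)
  have U: "ennreal (U j w) = (\<integral>\<^sup>+x. ennreal (V (Suc j) x w ^ (2 * m)) \<partial>surface_measure)" for j w
    unfolding U_def by (rule nn_integral_eq_integral[symmetric, OF Vint]) (simp add: power_mult)
  have jm: "(\<lambda>(x, w). ennreal (V (Suc j) x w ^ (2 * m))) \<in> borel_measurable (surface_measure \<Otimes>\<^sub>M M)" for j
    unfolding split_beta by measurable
  have Um: "(\<lambda>w. ennreal (U j w)) \<in> borel_measurable M" for j
  proof -
    have "(\<lambda>(w, x). ennreal (V (Suc j) x w ^ (2 * m))) \<in> borel_measurable (M \<Otimes>\<^sub>M surface_measure)"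
      using measurable_pair_swap[OF jm[of j]] by simp
    then show ?thesis unfolding U by (rule surface.borel_measurable_nn_integral)
  qed
  have EU: "(\<integral>\<^sup>+w. ennreal (U j w) \<partial>M) \<le> ennreal (C * (2 powr (- \<beta> * real (Suc j))) ^ (2 * m) * s)" for j
  proof -
    have "(\<integral>\<^sup>+w. ennreal (U j w) \<partial>M) =
        (\<integral>\<^sup>+x. (\<integral>\<^sup>+w. ennreal (V (Suc j) x w ^ (2 * m)) \<partial>M) \<partial>surface_measure)"
      unfolding U by (rule Fubini'[OF jm])
    also have "\<dots> \<le> (\<integral>\<^sup>+(x::'a). ennreal (C * (2 powr (- \<beta> * real (Suc j))) ^ (2 * m)) \<partial>surface_measure)"
      by (intro nn_integral_mono C(2)) (simp only: space_surface_measure)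
    also have "\<dots> = ennreal (C * (2 powr (- \<beta> * real (Suc j))) ^ (2 * m)) * ennreal s"
      by (simp add: s_def surface.emeasure_eq_measure)
    also have "\<dots> = ennreal (C * (2 powr (- \<beta> * real (Suc j))) ^ (2 * m) * s)"
      using C(1) s by (intro ennreal_mult[symmetric]) auto
    finally show ?thesis .
  qed
  define N where "N j = m * 2 ^ Suc (Suc j) + 1" for j
  define t where "t j = (2 powr (\<gamma> * real (Suc j))) ^ (2 * m) * real (N j ^ ?D) / s" for j
  have t0: "0 \<le> t j" for j using s by (simp add: t_def)
  have pw: "V (Suc j) x w ^ (2 * m) * s \<le> real (N j ^ ?D) * U j w" if "x \<in> sphere 0 1" for j x w
    unfolding U_def N_def s_def by (rule nikolskii_power[OF Vp that])
  have sum_t: "summable (\<lambda>j. t j * (C * (2 powr (- \<beta> * real (Suc j))) ^ (2 * m) * s))"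
  proof -
    define q where "q = 2 powr (real ?D - real (2 * m) * (\<beta> - \<gamma>))"
    have q: "0 \<le> q" "q < 1" using m(1) by (simp_all add: q_def powr_less_one)
    show ?thesis
    proof (rule summable_comparison_test'[of "\<lambda>j. (C * real (2 * m + 1) ^ ?D) * q ^ Suc j" 0])
      show "summable (\<lambda>j. (C * real (2 * m + 1) ^ ?D) * q ^ Suc j)"
        using q by (intro summable_mult) (subst summable_Suc_iff, intro summable_geometric, simp)
      fix j
      have N: "real (N j ^ ?D) \<le> real (2 * m + 1) ^ ?D * (2 ^ Suc j) ^ ?D"
      proof -
        have "N j \<le> (2 * m + 1) * 2 ^ Suc j" by (simp add: N_def algebra_simps)
        then have "N j ^ ?D \<le> ((2 * m + 1) * 2 ^ Suc j) ^ ?D" by (rule power_mono) simp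
        then have "real (N j ^ ?D) \<le> real (((2 * m + 1) * 2 ^ Suc j) ^ ?D)" by (simp only: of_nat_le_iff)
        then show ?thesis by (simp only: of_nat_power of_nat_mult power_mult_distrib of_nat_numeral)
      qed
      have e: "(2 powr (\<gamma> * real (Suc j))) ^ (2 * m) * (2 powr (- \<beta> * real (Suc j))) ^ (2 * m) * (2 ^ Suc j) ^ ?D
          = q ^ Suc j"
      proof -
        have 1: "(2 powr r) ^ n = 2 powr (r * real n)" for r :: real and n
          by (simp add: powr_realpow[symmetric] powr_powr)
        have 2: "(2 ^ Suc j :: real) = 2 powr real (Suc j)" by (simp add: powr_realpow[symmetric] del: power_Suc)
        show ?thesis
          unfolding 2 q_def 1 powr_add[symmetric]
          by (simp add: algebra_simps)
      qed
      have "t j * (C * (2 powr (- \<beta> * real (Suc j))) ^ (2 * m) * s) =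
          C * real (N j ^ ?D) * ((2 powr (\<gamma> * real (Suc j))) ^ (2 * m) * (2 powr (- \<beta> * real (Suc j))) ^ (2 * m))"
        using s by (simp add: t_def mult_ac del: of_nat_power)
      also have "\<dots> \<le> C * (real (2 * m + 1) ^ ?D * (2 ^ Suc j) ^ ?D) *
          ((2 powr (\<gamma> * real (Suc j))) ^ (2 * m) * (2 powr (- \<beta> * real (Suc j))) ^ (2 * m))"
        using C(1) by (intro mult_right_mono mult_left_mono N) auto
      also have "\<dots> = (C * real (2 * m + 1) ^ ?D) * q ^ Suc j"
        unfolding e[symmetric] by (simp only: mult_ac)
      finally show "norm (t j * (C * (2 powr (- \<beta> * real (Suc j))) ^ (2 * m) * s)) \<le>
          (C * real (2 * m + 1) ^ ?D) * q ^ Suc j"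
        using t0[of j] C(1) s by (simp add: abs_mult)
    qed
  qed
  have "(\<integral>\<^sup>+w. (\<Sum>j. ennreal (t j) * ennreal (U j w)) \<partial>M) = (\<Sum>j. \<integral>\<^sup>+w. ennreal (t j) * ennreal (U j w) \<partial>M)"
    by (intro nn_integral_suminf borel_measurable_times_ennreal borel_measurable_const Um)
  also have "\<dots> = (\<Sum>j. ennreal (t j) * (\<integral>\<^sup>+w. ennreal (U j w) \<partial>M))"
    by (intro suminf_cong nn_integral_cmult Um)
  also have "\<dots> \<le> (\<Sum>j. ennreal (t j * (C * (2 powr (- \<beta> * real (Suc j))) ^ (2 * m) * s)))"
  proof (intro suminf_le allI)
    fix j
    have "ennreal (t j) * (\<integral>\<^sup>+w. ennreal (U j w) \<partial>M) \<le>
        ennreal (t j) * ennreal (C * (2 powr (- \<beta> * real (Suc j))) ^ (2 * m) * s)"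
      by (intro mult_left_mono EU) simp
    then show "ennreal (t j) * (\<integral>\<^sup>+w. ennreal (U j w) \<partial>M) \<le>
        ennreal (t j * (C * (2 powr (- \<beta> * real (Suc j))) ^ (2 * m) * s))"
      using t0[of j] C(1) s by (simp add: ennreal_mult)
  qed auto
  also have "\<dots> = ennreal (\<Sum>j. t j * (C * (2 powr (- \<beta> * real (Suc j))) ^ (2 * m) * s))"
    using t0 C(1) s by (intro suminf_ennreal2 sum_t) auto
  also have "\<dots> < \<infinity>" by simp
  finally have "AE w in M. (\<Sum>j. ennreal (t j) * ennreal (U j w)) \<noteq> \<infinity>"
    by (intro nn_integral_noteq_infinite borel_measurable_suminf_order borel_measurable_times_ennreal
        borel_measurable_const Um) auto
  then show ?thesis
  proof (rule AE_mp, intro AE_I2 impI)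
    fix w assume fin: "(\<Sum>j. ennreal (t j) * ennreal (U j w)) \<noteq> \<infinity>"
    then have "summable (\<lambda>j. t j * U j w)"
      using t0 U0 by (intro summable_suminf_not_top) (simp_all add: ennreal_mult)
    then have "(\<lambda>j. t j * U j w) \<longlonglongrightarrow> 0" by (rule summable_LIMSEQ_zero)
    then have "Bseq (\<lambda>j. t j * U j w)" by (rule convergent_imp_Bseq[OF convergentI])
    then obtain B where B: "\<And>j. t j * U j w \<le> B"
      unfolding Bseq_def real_norm_def by (meson abs_le_D1)
    have dec: "\<bar>V (Suc j) x w\<bar> \<le> max 1 B * 2 powr (- \<gamma> * real (Suc j))" if x: "x \<in> sphere 0 1" for j x
    proof -
      define g where "g = 2 powr (\<gamma> * real (Suc j))"
      have g: "0 < g" by (simp add: g_def)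
      have "(g * \<bar>V (Suc j) x w\<bar>) ^ (2 * m) = g ^ (2 * m) * V (Suc j) x w ^ (2 * m)"
        by (simp add: power_mult_distrib power_mult)
      also have "\<dots> \<le> g ^ (2 * m) * (real (N j ^ ?D) * U j w / s)"
        using pw[OF x, of j w] s g by (intro mult_left_mono) (simp_all add: pos_le_divide_eq del: of_nat_power)
      also have "\<dots> = t j * U j w" by (simp add: t_def g_def)
      also have "\<dots> \<le> B" by (rule B)
      finally have le: "(g * \<bar>V (Suc j) x w\<bar>) ^ (2 * m) \<le> B" .
      have "g * \<bar>V (Suc j) x w\<bar> \<le> max 1 B"
      proof (cases "g * \<bar>V (Suc j) x w\<bar> \<le> 1")
        case False
        then have "(g * \<bar>V (Suc j) x w\<bar>) ^ 1 \<le> (g * \<bar>V (Suc j) x w\<bar>) ^ (2 * m)"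
          using m(2) by (intro power_increasing) auto
        then show ?thesis using le by simp
      qed simp
      then have "\<bar>V (Suc j) x w\<bar> \<le> max 1 B * inverse g"
        using g by (simp add: field_simps)
      moreover have "2 powr (- \<gamma> * real (Suc j)) = inverse g"
        unfolding g_def powr_minus[symmetric] by (simp add: algebra_simps)
      ultimately show ?thesis by simp
    qed
    have "bounded ((\<lambda>x. V 0 x w) ` sphere 0 1)"
      using compact_continuous_image[OF Vc compact_sphere] compact_imp_bounded by blast
    then obtain B0 where B0: "\<And>x. x \<in> sphere 0 1 \<Longrightarrow> norm (V 0 x w) \<le> B0"
      unfolding bounded_iff by blast
    have "\<bar>V j x w\<bar> \<le> max B0 (max 1 B) * 2 powr (- \<gamma> * real j)" if x: "x \<in> sphere 0 1" for j x
    proof (cases j)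
      case 0
      then show ?thesis using B0[OF x] by simp
    next
      case (Suc i)
      have le: "max 1 B * 2 powr (- \<gamma> * real (Suc i)) \<le> max B0 (max 1 B) * 2 powr (- \<gamma> * real (Suc i))"
        by (intro mult_right_mono) auto
      show ?thesis unfolding Suc by (rule order.trans[OF dec[OF x] le])
    qed
    then show "\<exists>B. \<forall>j. \<forall>x\<in>sphere 0 1.
        \<bar>frequency_block \<Phi> (\<lambda>k x. harmonic_component I k x w) j x\<bar> \<le> B * 2 powr (- \<gamma> * real j)"
      unfolding V_def by blast
  qed
qed

section \<open>The sum of the blocks as a modification\<close>

text \<open>The power \<open>n\<close> contains only degrees up to \<open>n\<close>, so a multiplier that equals one up to \<open>L\<close> reproduces the
  powers \<open>n \<le> L\<close> exactly. Each of the remaining powers contributes an error of at most \<open>a n\<close>.\<close>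

lemma truncation_error:
  fixes x :: "'a::euclidean_space" and a c :: "nat \<Rightarrow> real"
  assumes D: "2 \<le> DIM('a)" and x: "x \<in> sphere 0 1"
    and a: "summable a" and a0: "\<And>n. 0 \<le> a n"
    and c: "\<And>k. 0 \<le> c k" "\<And>k. c k \<le> 1" "\<And>k. k \<le> L \<Longrightarrow> c k = 1" and L: "L \<le> N"
  shows "(\<Sum>n. a n * (1\<^sup>2 - 2 * 1 * (\<Sum>k\<le>N. c k * spectral_weight n k x)
      + (\<Sum>k\<le>N. (c k)\<^sup>2 * spectral_weight n k x))) \<le> suminf a - (\<Sum>n\<le>L. a n)"
proof -
  note w = spectral_weight_nonneg[OF D x]
  define P where "P n = (\<Sum>k\<le>N. c k * spectral_weight n k x)" for n
  define R where "R n = (\<Sum>k\<le>N. (c k)\<^sup>2 * spectral_weight n k x)" for n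
  have P0: "0 \<le> P n" and R0: "0 \<le> R n" for n
    unfolding P_def R_def using c(1) w by (auto intro!: sum_nonneg)
  have RP: "R n \<le> P n" for n
    unfolding P_def R_def power2_eq_square
    using c(1,2) w by (intro sum_mono mult_right_mono) (auto intro: mult_left_le)
  have P1: "P n \<le> 1" for n
  proof -
    have "P n \<le> (\<Sum>k\<le>N. 1 * spectral_weight n k x)"
      unfolding P_def by (intro sum_mono mult_right_mono c(2) w)
    then show ?thesis using spectral_weight_sum_le_1[OF D x, of n N] by simp
  qed
  have low: "1 - 2 * P n + R n = 0" if n: "n \<le> L" for n
  proof -
    have e: "c k * spectral_weight n k x = spectral_weight n k x" for k
      using c(3)[of k] spectral_weight_sums(1)[OF D x, of n k] n by (cases "k \<le> L") auto
    have "P n = (\<Sum>k\<le>N. spectral_weight n k x)" "R n = (\<Sum>k\<le>N. spectral_weight n k x)"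
      by (simp_all only: P_def R_def power2_eq_square mult.assoc e)
    then show ?thesis using spectral_weight_sums(2)[OF D x, of n N] n L by simp
  qed
  have le: "a n * (1 - 2 * P n + R n) \<le> a n - (if n \<in> {..L} then a n else 0)" for n
  proof (cases "n \<le> L")
    case False
    have "a n * (1 - 2 * P n + R n) \<le> a n * 1"
      using P0[of n] RP[of n] by (intro mult_left_mono a0) linarith
    then show ?thesis using False by simp
  qed (simp add: low)
  have sl: "summable (\<lambda>n. a n * (1 - 2 * P n + R n))"
  proof (rule summable_comparison_test'[OF summable_mult2[OF a, of 4], of 0])
    fix n
    have "\<bar>1 - 2 * P n + R n\<bar> \<le> 4" using P0[of n] R0[of n] RP[of n] P1[of n] by linarith
    then show "norm (a n * (1 - 2 * P n + R n)) \<le> a n * 4"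
      using a0[of n] mult_left_mono[of _ 4 "a n"] by (simp add: abs_mult)
  qed
  have sr: "(\<lambda>n. a n - (if n \<in> {..L} then a n else 0)) sums (suminf a - (\<Sum>n\<in>{..L}. a n))"
    by (intro sums_diff summable_sums a sums_If_finite_set) simp
  have "(\<Sum>n. a n * (1 - 2 * P n + R n)) \<le> suminf a - (\<Sum>n\<in>{..L}. a n)"
    using suminf_le[OF le sl sums_summable[OF sr]] unfolding sums_unique[OF sr, symmetric] .
  then show ?thesis by (simp add: P_def R_def)
qed

text \<open>The partial sums of the blocks are the components with the multiplier \<open>\<Phi> (frequency / 2 ^ J)\<close>. Their
  mean square distance to \<open>Z x\<close> tends to zero by \<open>truncation_error\<close>, and by Fatou's lemma their almost
  sure limit has mean square distance zero from \<open>Z x\<close>.\<close>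

lemma frequency_series_is_modification:
  fixes Z :: "'a::euclidean_space \<Rightarrow> 'w \<Rightarrow> real" and I :: "('a \<Rightarrow> real) \<Rightarrow> 'w \<Rightarrow> real"
  assumes D: "2 \<le> DIM('a)" and cut: "littlewood_paley_cutoff \<Phi>"
    and a: "summable a" and a0: "\<And>n. 0 \<le> a n" and x: "x \<in> sphere 0 1"
    and Z: "Z x \<in> borel_measurable M"
    and I: "\<And>k e. e \<in> harmonic_frame k \<Longrightarrow> I e \<in> borel_measurable M"
    and mom: "\<And>c N. (\<integral>\<^sup>+w. ennreal ((1 * Z x w - (\<Sum>k\<le>N. c k * harmonic_component I k x w)) ^ (2 * 1)) \<partial>M) \<le>
      ennreal (gaussian_moment 1 * (\<Sum>n. a n * (1\<^sup>2 - 2 * 1 * (\<Sum>k\<le>N. c k * spectral_weight n k x)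
        + (\<Sum>k\<le>N. (c k)\<^sup>2 * spectral_weight n k x))) ^ 1)"
    and conv: "AE w in M. summable (\<lambda>j. frequency_block \<Phi> (\<lambda>k x. harmonic_component I k x w) j x)"
  shows "AE w in M. (\<Sum>j. frequency_block \<Phi> (\<lambda>k x. harmonic_component I k x w) j x) = Z x w"
proof -
  define V where "V j w = frequency_block \<Phi> (\<lambda>k x. harmonic_component I k x w) j x" for j w
  define Y where "Y w = (\<Sum>j. V j w)" for w
  define S where "S J w = (\<Sum>j<Suc J. V j w)" for J w
  have Vm [measurable]: "V j \<in> borel_measurable M" for j
    unfolding V_def by (rule frequency_block_component_measurable[OF I])
  have Sm [measurable]: "S J \<in> borel_measurable M" for J unfolding S_def by measurable
  have Ym [measurable]: "Y \<in> borel_measurable M" unfolding Y_def by measurable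
  note Z [measurable]
  have small: "\<forall>\<^sub>F J in sequentially. (\<integral>\<^sup>+w. ennreal ((Z x w - S J w)\<^sup>2) \<partial>M) \<le> ennreal e" if e: "0 < e" for e
  proof -
    have "(\<lambda>L. \<Sum>n\<le>L. a n) \<longlonglongrightarrow> suminf a" by (rule summable_LIMSEQ'[OF a])
    then have "\<forall>\<^sub>F L in sequentially. suminf a - e < (\<Sum>n\<le>L. a n)"
      by (rule order_tendstoD(1)) (use e in simp)
    then obtain L where L: "suminf a - e < (\<Sum>n\<le>L. a n)" by (auto simp: eventually_sequentially)
    obtain J0 where J0: "frequency DIM('a) L < 2 ^ J0" using real_arch_pow[of 2] by auto
    show ?thesis
    proof (rule eventually_sequentiallyI[of J0])
      fix J assume J: "J0 \<le> J"
      define c where "c k = \<Phi> (frequency DIM('a) k / 2 ^ J)" for k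
      have "(2::real) ^ J0 \<le> 2 ^ J" using J by (intro power_increasing) auto
      then have FL: "frequency DIM('a) L < 2 ^ J" using J0 by linarith
      have c1: "c k = 1" if "k \<le> L" for k
      proof -
        have "frequency DIM('a) k \<le> 2 ^ J" using frequency_bounds(3)[OF D that] FL by linarith
        then have "frequency DIM('a) k / 2 ^ J \<le> 1" by simp
        moreover have "0 \<le> frequency DIM('a) k / 2 ^ J" using frequency_bounds(2)[OF D, of k] by simp
        ultimately show ?thesis unfolding c_def by (intro littlewood_paley_cutoffD(3)[OF cut])
      qed
      have "real L < real (2 ^ Suc J)" using frequency_bounds(1)[OF D, of L] FL by simp
      then have LN: "L \<le> 2 ^ Suc J" by (simp only: of_nat_less_iff less_imp_le)
      have S: "S J w = (\<Sum>k\<le>2 ^ Suc J. c k * harmonic_component I k x w)" for w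
        unfolding S_def V_def c_def by (rule sum_frequency_blocks[OF D cut])
      have "(\<integral>\<^sup>+w. ennreal ((Z x w - S J w)\<^sup>2) \<partial>M) \<le>
          ennreal (\<Sum>n. a n * (1\<^sup>2 - 2 * 1 * (\<Sum>k\<le>2 ^ Suc J. c k * spectral_weight n k x)
            + (\<Sum>k\<le>2 ^ Suc J. (c k)\<^sup>2 * spectral_weight n k x)))"
        using mom[where c=c and N="2 ^ Suc J"] unfolding S[symmetric]
        by (simp add: gaussian_moment_def del: power_Suc)
      also have "\<dots> \<le> ennreal (suminf a - (\<Sum>n\<le>L. a n))"
        by (intro ennreal_leI truncation_error[OF D x a a0 _ _ c1 LN])
          (auto simp: c_def littlewood_paley_cutoffD(1,2)[OF cut])
      also have "\<dots> \<le> ennreal e" using L by (intro ennreal_leI) simp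
      finally show "(\<integral>\<^sup>+w. ennreal ((Z x w - S J w)\<^sup>2) \<partial>M) \<le> ennreal e" .
    qed
  qed
  have "AE w in M. ennreal ((Z x w - Y w)\<^sup>2) = liminf (\<lambda>J. ennreal ((Z x w - S J w)\<^sup>2))"
    using conv
  proof (rule AE_mp, intro AE_I2 impI)
    fix w assume "summable (\<lambda>j. frequency_block \<Phi> (\<lambda>k x. harmonic_component I k x w) j x)"
    then have "(\<lambda>n. \<Sum>j<n. V j w) \<longlonglongrightarrow> Y w" unfolding Y_def V_def by (rule summable_LIMSEQ)
    then have "(\<lambda>J. S J w) \<longlonglongrightarrow> Y w" unfolding S_def by (rule LIMSEQ_Suc)
    then have "(\<lambda>J. ennreal ((Z x w - S J w)\<^sup>2)) \<longlonglongrightarrow> ennreal ((Z x w - Y w)\<^sup>2)"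
      by (intro tendsto_intros)
    then show "ennreal ((Z x w - Y w)\<^sup>2) = liminf (\<lambda>J. ennreal ((Z x w - S J w)\<^sup>2))"
      by (intro lim_imp_Liminf[symmetric]) auto
  qed
  then have "(\<integral>\<^sup>+w. ennreal ((Z x w - Y w)\<^sup>2) \<partial>M) = (\<integral>\<^sup>+w. liminf (\<lambda>J. ennreal ((Z x w - S J w)\<^sup>2)) \<partial>M)"
    by (rule nn_integral_cong_AE)
  also have "\<dots> \<le> liminf (\<lambda>J. \<integral>\<^sup>+w. ennreal ((Z x w - S J w)\<^sup>2) \<partial>M)"
    by (rule nn_integral_liminf) measurable
  finally have F: "(\<integral>\<^sup>+w. ennreal ((Z x w - Y w)\<^sup>2) \<partial>M) \<le> liminf (\<lambda>J. \<integral>\<^sup>+w. ennreal ((Z x w - S J w)\<^sup>2) \<partial>M)" .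
  have "(\<integral>\<^sup>+w. ennreal ((Z x w - Y w)\<^sup>2) \<partial>M) \<le> 0"
  proof (rule ennreal_le_epsilon)
    fix e :: real assume e: "0 < e"
    have "liminf (\<lambda>J. \<integral>\<^sup>+w. ennreal ((Z x w - S J w)\<^sup>2) \<partial>M) \<le> limsup (\<lambda>J. \<integral>\<^sup>+w. ennreal ((Z x w - S J w)\<^sup>2) \<partial>M)"
      by (rule Liminf_le_Limsup) simp
    also have "\<dots> \<le> ennreal e" by (rule Limsup_bounded[OF small[OF e]])
    finally show "(\<integral>\<^sup>+w. ennreal ((Z x w - Y w)\<^sup>2) \<partial>M) \<le> 0 + ennreal e" using F by simp
  qed
  then have "(\<integral>\<^sup>+w. ennreal ((Z x w - Y w)\<^sup>2) \<partial>M) = 0" by simp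
  then have "AE w in M. ennreal ((Z x w - Y w)\<^sup>2) = 0"
    by (subst (asm) nn_integral_0_iff_AE) auto
  then have "AE w in M. Y w = Z x w" by eventually_elim (simp add: ennreal_eq_0_iff)
  then show ?thesis by (simp only: Y_def V_def)
qed

text \<open>The exceptional null set must not depend on \<open>\<gamma>\<close>. The decay of the blocks is therefore used for the
  countably many exponents \<open>g i\<close>, which increase to \<open>\<alpha>\<close>.\<close>

lemma gaussian_power_series_besov:
  fixes Z :: "'a::euclidean_space \<Rightarrow> 'w \<Rightarrow> real" and a :: "nat \<Rightarrow> real"
  assumes D: "2 \<le> DIM('a)" and cut: "littlewood_paley_cutoff \<Phi>" and \<alpha>: "0 < \<alpha>"
    and a0: "\<And>n. 0 \<le> a n" and aO: "a \<in> O(\<lambda>n. 1 / real n powr (1 + \<alpha>))"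
    and M: "prob_space M"
    and Z: "centered_gaussian_process M (sphere 0 1) (power_series_kernel a) Z"
  shows "\<exists>Y. modification_of M (sphere 0 1) Z Y \<and>
    (AE w in M. \<forall>\<gamma>. 0 < \<gamma> \<and> \<gamma> < \<alpha> \<longrightarrow> (\<lambda>x. Y x w) \<in> besov_inf_1 \<Phi> \<gamma>)"
proof -
  have "summable (\<lambda>n. a n * (real n + 1) powr 0)" by (rule summable_coefficients[OF aO \<alpha>])
  then have a: "summable a" by (rule summable_cong[THEN iffD1, rotated]) (simp add: always_eventually)
  show ?thesis
  proof (rule harmonic_components_of_process[OF D M a a0 Z])
    fix I :: "('a \<Rightarrow> real) \<Rightarrow> 'w \<Rightarrow> real"
    assume I: "\<And>k e. e \<in> harmonic_frame k \<Longrightarrow> I e \<in> borel_measurable M"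
      and mom: "\<And>b c N x m. x \<in> sphere 0 1 \<Longrightarrow>
        (\<integral>\<^sup>+w. ennreal ((b * Z x w - (\<Sum>k\<le>N. c k * harmonic_component I k x w)) ^ (2 * m)) \<partial>M) \<le>
        ennreal (gaussian_moment m * (\<Sum>n. a n * (b\<^sup>2 - 2 * b * (\<Sum>k\<le>N. c k * spectral_weight n k x)
          + (\<Sum>k\<le>N. (c k)\<^sup>2 * spectral_weight n k x))) ^ m)"
    define V where "V j x w = frequency_block \<Phi> (\<lambda>k x. harmonic_component I k x w) j x" for j x w
    have decay: "AE w in M. \<exists>B. \<forall>j. \<forall>x\<in>sphere 0 1. \<bar>V j x w\<bar> \<le> B * 2 powr (- \<gamma> * real j)"
      if \<gamma>: "0 < \<gamma>" "\<gamma> < \<alpha>" for \<gamma>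
    proof -
      define \<beta> where "\<beta> = (\<gamma> + \<alpha>) / 2"
      have \<beta>: "0 < \<beta>" "\<beta> < \<alpha>" "\<gamma> < \<beta>" using \<gamma> by (simp_all add: \<beta>_def)
      obtain C where C: "0 \<le> C" "\<And>j N \<psi> (x::'a). x \<in> sphere 0 1 \<Longrightarrow> (\<And>k. \<bar>\<psi> k\<bar> \<le> 1) \<Longrightarrow>
        (\<And>k. \<psi> k \<noteq> 0 \<Longrightarrow> 4 ^ j \<le> 4 * lb_eigenvalue DIM('a) k) \<Longrightarrow>
        (\<Sum>n. a n * (\<Sum>k\<le>N. (\<psi> k)\<^sup>2 * spectral_weight n k x)) \<le> C * (2 powr (- \<beta> * real j))\<^sup>2"
        by (rule dyadic_block_variance[OF D aO a0 \<beta>(1,2)]) blast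
      have "(\<integral>\<^sup>+w. ennreal (V (Suc j) x w ^ (2 * m)) \<partial>M) \<le>
          ennreal (gaussian_moment m * C ^ m * (2 powr (- \<beta> * real (Suc j))) ^ (2 * m))"
        if x: "x \<in> sphere 0 1" for m j x
      proof -
        define \<psi> where "\<psi> k = dyadic_window \<Phi> (Suc j) (frequency DIM('a) k)" for k
        define N :: nat where "N = 2 ^ Suc (Suc j)"
        have \<psi>: "4 ^ Suc j \<le> 4 * lb_eigenvalue DIM('a) k" if "\<psi> k \<noteq> 0" for k
        proof -
          have "2 ^ Suc j \<le> 2 * frequency DIM('a) k"
            using dyadic_window_nonzero[OF cut frequency_bounds(2)[OF D]] that unfolding \<psi>_def by blast
          then have "(2 ^ Suc j)\<^sup>2 \<le> (2 * frequency DIM('a) k)\<^sup>2" by (rule power_mono) simp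
          moreover have "(2 ^ Suc j :: real)\<^sup>2 = 4 ^ Suc j"
            unfolding power_even_eq[symmetric] by (simp add: power_mult power2_eq_square power_mult_distrib[symmetric])
          moreover have "(2 * frequency DIM('a) k)\<^sup>2 = 4 * lb_eigenvalue DIM('a) k"
            using lb_eigenvalue_nonneg[OF D, of k] by (simp add: frequency_def power_mult_distrib)
          ultimately show ?thesis by simp
        qed
        have v: "(\<Sum>n. a n * (\<Sum>k\<le>N. (\<psi> k)\<^sup>2 * spectral_weight n k x)) \<le> C * (2 powr (- \<beta> * real (Suc j)))\<^sup>2"
          by (rule C(2)[OF x _ \<psi>]) (simp_all add: \<psi>_def dyadic_window_abs_le_1[OF cut])
        have v0: "0 \<le> (\<Sum>n. a n * (\<Sum>k\<le>N. (\<psi> k)\<^sup>2 * spectral_weight n k x))"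
        proof (rule suminf_nonneg)
          have s: "0 \<le> (\<Sum>k\<le>N. (\<psi> k)\<^sup>2 * spectral_weight n k x) \<and> (\<Sum>k\<le>N. (\<psi> k)\<^sup>2 * spectral_weight n k x) \<le> 1" for n
          proof
            show "0 \<le> (\<Sum>k\<le>N. (\<psi> k)\<^sup>2 * spectral_weight n k x)"
              by (intro sum_nonneg mult_nonneg_nonneg spectral_weight_nonneg[OF D x]) simp
            have "(\<psi> k)\<^sup>2 \<le> 1" for k
              using dyadic_window_abs_le_1[OF cut, of "Suc j" "frequency DIM('a) k"]
              unfolding \<psi>_def by (rule abs_square_le_1[THEN iffD2])
            then have "(\<Sum>k\<le>N. (\<psi> k)\<^sup>2 * spectral_weight n k x) \<le> (\<Sum>k\<le>N. 1 * spectral_weight n k x)"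
              by (intro sum_mono mult_right_mono spectral_weight_nonneg[OF D x])
            then show "(\<Sum>k\<le>N. (\<psi> k)\<^sup>2 * spectral_weight n k x) \<le> 1"
              using spectral_weight_sum_le_1[OF D x, of n N] by simp
          qed
          show "0 \<le> a n * (\<Sum>k\<le>N. (\<psi> k)\<^sup>2 * spectral_weight n k x)" for n
            using s[of n] a0[of n] by simp
          show "summable (\<lambda>n. a n * (\<Sum>k\<le>N. (\<psi> k)\<^sup>2 * spectral_weight n k x))"
          proof (rule summable_comparison_test'[OF a, of 0])
            show "norm (a n * (\<Sum>k\<le>N. (\<psi> k)\<^sup>2 * spectral_weight n k x)) \<le> a n" for n
              using s[of n] a0[of n] mult_left_le[of "\<Sum>k\<le>N. (\<psi> k)\<^sup>2 * spectral_weight n k x" "a n"]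
              by (simp add: abs_mult)
          qed
        qed
        have "(\<integral>\<^sup>+w. ennreal (V (Suc j) x w ^ (2 * m)) \<partial>M) =
            (\<integral>\<^sup>+w. ennreal ((0 * Z x w - (\<Sum>k\<le>N. \<psi> k * harmonic_component I k x w)) ^ (2 * m)) \<partial>M)"
          by (simp add: V_def frequency_block_def \<psi>_def N_def power_mult del: power_Suc)
        also have "\<dots> \<le> ennreal (gaussian_moment m * (\<Sum>n. a n * (\<Sum>k\<le>N. (\<psi> k)\<^sup>2 * spectral_weight n k x)) ^ m)"
          using mom[OF x, where b=0 and c=\<psi> and N=N and m=m] by simp
        also have "\<dots> \<le> ennreal (gaussian_moment m * (C * (2 powr (- \<beta> * real (Suc j)))\<^sup>2) ^ m)"
          by (intro ennreal_leI mult_left_mono power_mono v v0 gaussian_moment_nonneg)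
        also have "\<dots> = ennreal (gaussian_moment m * C ^ m * (2 powr (- \<beta> * real (Suc j))) ^ (2 * m))"
          by (simp add: power_mult_distrib power_mult mult.assoc)
        finally show ?thesis .
      qed
      then have "\<exists>C\<ge>0. \<forall>j. \<forall>x\<in>sphere 0 1.
        (\<integral>\<^sup>+w. ennreal (frequency_block \<Phi> (\<lambda>k x. harmonic_component I k x w) (Suc j) x ^ (2 * m)) \<partial>M) \<le>
        ennreal (C * (2 powr (- \<beta> * real (Suc j))) ^ (2 * m))" for m
        unfolding V_def using C(1) gaussian_moment_nonneg[of m]
        by (intro exI[of _ "gaussian_moment m * C ^ m"] conjI mult_nonneg_nonneg zero_le_power) auto
      from blocks_decay_of_moments[OF M I this \<beta>(3)]
      show ?thesis unfolding V_def .
    qed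
    define g where "g i = \<alpha> * (real i + 1) / (real i + 2)" for i :: nat
    have g: "0 < g i" "g i < \<alpha>" for i
      using \<alpha> by (simp_all add: g_def pos_divide_less_eq)
    have glim: "g \<longlonglongrightarrow> \<alpha>"
      unfolding g_def by real_asymp
    have AE: "AE w in M. \<forall>i. \<exists>B. \<forall>j. \<forall>x\<in>sphere 0 1. \<bar>V j x w\<bar> \<le> B * 2 powr (- g i * real j)"
      unfolding AE_all_countable using decay[OF g] by blast
    define Y where "Y x w = (\<Sum>j. V j x w)" for x w
    have Zm: "Z x \<in> borel_measurable M" if x: "x \<in> sphere 0 1" for x
      using gaussian_process_combination(1)[OF M Z, of 1 "\<lambda>_. x" "\<lambda>_. 1"] x by simp
    have "Y x \<in> borel_measurable M \<and> (AE w in M. Y x w = Z x w)" if x: "x \<in> sphere 0 1" for x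
    proof
      have "V j x \<in> borel_measurable M" for j
        unfolding V_def by (rule frequency_block_component_measurable[OF I])
      then show "Y x \<in> borel_measurable M" unfolding Y_def by measurable
      have conv: "AE w in M. summable (\<lambda>j. V j x w)"
        using AE
      proof (rule AE_mp, intro AE_I2 impI)
        fix w assume "\<forall>i. \<exists>B. \<forall>j. \<forall>x\<in>sphere 0 1. \<bar>V j x w\<bar> \<le> B * 2 powr (- g i * real j)"
        then obtain B where B: "\<forall>j. \<forall>x\<in>sphere 0 1. \<bar>V j x w\<bar> \<le> B * 2 powr (- g 0 * real j)" by blast
        show "summable (\<lambda>j. V j x w)"
          by (rule summable_comparison_test'[OF summable_mult[OF summable_powr_geometric[OF g(1)[of 0]], of B], of 0])
            (use B x in auto)
      qed
      show "AE w in M. Y x w = Z x w"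
        unfolding Y_def V_def
        by (rule frequency_series_is_modification[where Z=Z and x=x and M=M and I=I and a=a and \<Phi>=\<Phi>,
              OF D cut a a0 x Zm[OF x] _ mom[OF x, where b=1 and m=1] conv[unfolded V_def]]) (rule I)
    qed
    then have "modification_of M (sphere 0 1) Z Y" by (simp add: modification_of_def)
    moreover have "AE w in M. \<forall>\<gamma>. 0 < \<gamma> \<and> \<gamma> < \<alpha> \<longrightarrow> (\<lambda>x. Y x w) \<in> besov_inf_1 \<Phi> \<gamma>"
      using AE
    proof (rule AE_mp, intro AE_I2 impI allI)
      fix w \<gamma>
      assume B: "\<forall>i. \<exists>B. \<forall>j. \<forall>x\<in>sphere 0 1. \<bar>V j x w\<bar> \<le> B * 2 powr (- g i * real j)"
        and \<gamma>: "0 < \<gamma> \<and> \<gamma> < \<alpha>"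
      have "\<forall>\<^sub>F i in sequentially. \<gamma> < g i" using glim \<gamma> by (intro order_tendstoD(1)) auto
      then obtain i where i: "\<gamma> < g i" by (auto simp: eventually_sequentially)
      from B obtain B' where "\<forall>j. \<forall>x\<in>sphere 0 1. \<bar>V j x w\<bar> \<le> B' * 2 powr (- g i * real j)" by blast
      then show "(\<lambda>x. Y x w) \<in> besov_inf_1 \<Phi> \<gamma>"
        unfolding Y_def V_def
        by (intro besov_of_frequency_blocks[OF D cut _ _ g(1)[of i] i, of _ B']) (auto intro: harmonic_component_harmonic)
    qed
    ultimately show ?thesis by blast
  qed
qed

theorem theorem7:
  fixes \<alpha> :: real and A :: "nat \<Rightarrow> real" and f :: "real \<Rightarrow> real"
    and \<Phi> :: "real \<Rightarrow> real" and d :: nat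
    and K :: "real^'n::finite \<Rightarrow> real^'n \<Rightarrow> real"
  assumes "0 < \<alpha>"
    and "\<And>n. 0 \<le> A n"
    and "(\<lambda>n. A n / fact n) \<in> O(\<lambda>n. 1 / real n powr (1 + \<alpha>))"
    and "\<And>x. x \<in> {-1..1} \<Longrightarrow> f x = (\<Sum>n. A n / fact n * x ^ n)"
    and "littlewood_paley_cutoff \<Phi>"
    and "1 \<le> d" and "CARD('n) = d + 1"
    and "\<And>\<xi> \<eta>. \<xi> \<in> sphere 0 1 \<Longrightarrow> \<eta> \<in> sphere 0 1 \<Longrightarrow> K \<xi> \<eta> = f (\<xi> \<bullet> \<eta>)"
  shows "positive_definite_on (sphere 0 1) K \<and>
    SO_invariant K \<and>
    (\<forall>(M :: 'w measure) (Z :: real^'n \<Rightarrow> 'w \<Rightarrow> real).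
       prob_space M \<longrightarrow> centered_gaussian_process M (sphere 0 1) K Z \<longrightarrow>
       (\<exists>Y. modification_of M (sphere 0 1) Z Y \<and>
            (AE w in M. \<forall>\<gamma>. 0 < \<gamma> \<and> \<gamma> < \<alpha> \<longrightarrow> (\<lambda>\<xi>. Y \<xi> w) \<in> besov_inf_1 \<Phi> \<gamma>)))"
proof -
  define a where "a n = A n / fact n" for n
  have a0: "0 \<le> a n" for n using assms(2) by (simp add: a_def)
  have aO: "a \<in> O(\<lambda>n. 1 / real n powr (1 + \<alpha>))" using assms(3) by (simp add: a_def[abs_def])
  have "summable (\<lambda>n. a n * (real n + 1) powr 0)" by (rule summable_coefficients[OF aO assms(1)])
  then have a: "summable a" by (rule summable_cong[THEN iffD1, rotated]) (simp add: always_eventually)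
  have D: "2 \<le> DIM(real^'n)" using assms(6,7) by simp
  have K: "K \<xi> \<eta> = power_series_kernel a \<xi> \<eta>" if "\<xi> \<in> sphere 0 1" "\<eta> \<in> sphere 0 1" for \<xi> \<eta>
  proof -
    have "\<bar>\<xi> \<bullet> \<eta>\<bar> \<le> 1" using abs_inner_power_le_1[OF that, of 1] by simp
    then show ?thesis
      using assms(4)[of "\<xi> \<bullet> \<eta>"] assms(8)[OF that] by (simp add: power_series_kernel_def a_def abs_le_iff)
  qed
  have posdef: "positive_definite_on (sphere 0 1) K"
  proof -
    have "positive_definite_on (sphere 0 1) (power_series_kernel a :: real^'n \<Rightarrow> _)"
      by (rule power_series_kernel_positive_definite[OF a a0])
    then show ?thesis unfolding positive_definite_on_def by (simp add: K)
  qed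
  have inv: "SO_invariant K"
    unfolding SO_invariant_def
  proof (intro allI impI ballI)
    fix Q :: "real^'n^'n" and x y :: "real^'n"
    assume Q: "rotation_matrix Q" and xy: "x \<in> sphere 0 1" "y \<in> sphere 0 1"
    have "orthogonal_transformation ((*v) Q)"
      using Q by (simp add: rotation_matrix_def orthogonal_transformation_matrix)
    then have "(Q *v x) \<bullet> (Q *v y) = x \<bullet> y" "norm (Q *v x) = norm x" "norm (Q *v y) = norm y"
      by (simp_all add: orthogonal_transformation_def orthogonal_transformation_norm)
    then show "K (Q *v x) (Q *v y) = K x y" using xy assms(8) by simp
  qed
  have "\<exists>Y. modification_of M (sphere 0 1) Z Y \<and>
      (AE w in M. \<forall>\<gamma>. 0 < \<gamma> \<and> \<gamma> < \<alpha> \<longrightarrow> (\<lambda>\<xi>. Y \<xi> w) \<in> besov_inf_1 \<Phi> \<gamma>)"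
    if M: "prob_space M" and Z: "centered_gaussian_process M (sphere 0 1) K Z"
    for M :: "'w measure" and Z :: "real^'n \<Rightarrow> 'w \<Rightarrow> real"
  proof (rule gaussian_power_series_besov[OF D assms(5) assms(1) a0 aO M])
    show "centered_gaussian_process M (sphere 0 1) (power_series_kernel a) Z"
      using Z unfolding centered_gaussian_process_def by (simp add: K)
  qed
  then show ?thesis using posdef inv by blast
qed

end
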